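(* Let $L,G,D,\delta,\beta,K>0$ be constants. Let $\sigma\in C^2(\mathbb{R})$ be non-increasing, let $\alpha\in(3/4,1]$, and let $u^0=(h^0,m^0,\Gamma^0)\in O_\alpha$. Let $$u=(h,m,\Gamma)\in C\big([0,T),O_\alpha\big)\cap C^1\big((0,T),L_2\big)\cap C\big((0,T),H_N^2\big)$$ be the corresponding unique positive strong solution, with maximal existence time $T\in(0,\infty]$, to \begin{align*} &\partial_t h-\partial_x\Big(\tfrac{G}{3}h^3\partial_x h-\tfrac12 h^2\partial_x\sigma(\Gamma)\Big)=0,\\ &\partial_t m-\partial_x\Big(\tfrac{G}{3}h^2 m\,\partial_x h-\tfrac12 h\,m\,\partial_x\sigma(\Gamma)+\delta\,\partial_x m-\delta\,\tfrac{m}{h}\,\partial_x h\Big)=-K\Big(\tfrac{\beta m}{h}-\Gamma\Big),\\ &\partial_t\Gamma-\partial_x\Big(\tfrac{G}{2}h^2\,\Gamma\,\partial_x h-h\,\Gamma\,\partial_x\sigma(\Gamma)+D\,\partial_x\Gamma\Big)=K\Big(\tfrac{\beta m}{h}-\Gamma\Big) \end{align*} for $x\in(0,L)$, $t>0$, with $\partial_x h=\partial_x m=\partial_x\Gamma=0$ at $x=0,L$ and $(h,m,\Gamma)(0,\cdot)=u^0$. Let $\phi$ be a function on $(0,\infty)$ such that $\phi''(r)\,r=-\sigma'(r)\ge0$ for $r>0$. Then, for $t\in[0,T)$, \begin{align*} \frac{\mathrm d}{\mathrm dt}\int_0^L&\Big(\phi(\Gamma)+\frac1\beta\,h\,\phi\Big(\frac{\beta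 m}{h}\Big)+\frac G2h^2\Big)\,\mathrm dx\\ =&-D\int_0^L\phi''(\Gamma)\,|\partial_x\Gamma|^2\,\mathrm dx-\frac\delta\beta\int_0^L\phi''\Big(\frac{\beta m}{h}\Big)\,h\,\Big|\partial_x\Big(\frac{\beta m}{h}\Big)\Big|^2\,\mathrm dx\\ &-\frac14\int_0^Lh\,|\partial_x\sigma(\Gamma)|^2\,\mathrm dx-\int_0^L\Big(\frac{G}{\sqrt3}\,h^{3/2}\,\partial_xh-\frac{\sqrt3}{2}\,h^{1/2}\,\partial_x\sigma(\Gamma)\Big)^2\,\mathrm dx\\ &-K\int_0^L\Big(\phi'(\Gamma)-\phi'\Big(\frac{\beta m}{h}\Big)\Big)\Big(\Gamma-\frac{\beta m}{h}\Big)\,\mathrm dx . \end{align*}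
   Context: $L_2:=L_2((0,L),\mathbb{R}^3)$. For $\alpha\in(3/4,1]$, $H_N^{2\alpha}:=\{u\in H^{2\alpha}((0,L),\mathbb{R}^3):\partial_x u=0\text{ for }x=0,L\}$, where $H^{2\alpha}$ is the usual ($L_2$-based) Sobolev space, and $O_\alpha:=H_N^{2\alpha}\cap C([0,L],(0,\infty)^3)$, with the topology of $H_N^{2\alpha}$. For every $u^0\in O_\alpha$ the initial-boundary value problem in the claim has a unique strictly positive strong solution in the indicated class with a maximal existence time $T\in(0,\infty]$ (the equations holding in $L_2$ for $t\in(0,T)$). At $t=0$ the time derivative is the one-sided one. *)

theory Defs
  imports "HOL-Analysis.Analysis"
begin

subsection \<open>Function spaces on the interval from 0 to L\<close>

text \<open>Elements of the function spaces are represented by functions on the whole real line, of which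
  only the values on the interval matter; almost everywhere equal functions are not identified.\<close>

definition L2_space :: "real \<Rightarrow> (real \<Rightarrow> 'a::euclidean_space) set" where
  "L2_space L = {f. f \<in> borel_measurable (lebesgue_on {0<..<L}) \<and>
                    integrable (lebesgue_on {0<..<L}) (\<lambda>x. (norm (f x))\<^sup>2)}"

definition L2_norm :: "real \<Rightarrow> (real \<Rightarrow> 'a::euclidean_space) \<Rightarrow> real" where
  "L2_norm L f = sqrt (LINT x|lebesgue_on {0<..<L}. (norm (f x))\<^sup>2)"

definition test_functions :: "real \<Rightarrow> (real \<Rightarrow> real) set" where
  "test_functions L = {\<psi>. (\<forall>n x. (deriv ^^ n) \<psi> differentiable (at x)) \<and>
                          closure {x. \<psi> x \<noteq> 0} \<subseteq> {0<..<L}}"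

definition has_weak_deriv ::
  "real \<Rightarrow> nat \<Rightarrow> (real \<Rightarrow> 'a::euclidean_space) \<Rightarrow> (real \<Rightarrow> 'a) \<Rightarrow> bool" where
  "has_weak_deriv L n f g \<longleftrightarrow> f \<in> L2_space L \<and> g \<in> L2_space L \<and>
     (\<forall>\<psi>\<in>test_functions L.
        (LINT x|lebesgue_on {0<..<L}. (deriv ^^ n) \<psi> x *\<^sub>R f x)
          = (-1) ^ n *\<^sub>R (LINT x|lebesgue_on {0<..<L}. \<psi> x *\<^sub>R g x))"

text \<open>The weak derivative is unique up to null sets; only its class matters below.\<close>

definition weak_deriv :: "real \<Rightarrow> nat \<Rightarrow> (real \<Rightarrow> 'a::euclidean_space) \<Rightarrow> (real \<Rightarrow> 'a)" where
  "weak_deriv L n f = (SOME g. has_weak_deriv L n f g)"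

text \<open>Integrand of the Slobodeckij seminorm of order \<open>\<theta> \<in> (0,1)\<close>.\<close>

definition slobodeckij_kernel ::
  "real \<Rightarrow> (real \<Rightarrow> 'a::euclidean_space) \<Rightarrow> real \<times> real \<Rightarrow> real" where
  "slobodeckij_kernel \<theta> f = (\<lambda>(x, y). (norm (f x - f y))\<^sup>2 / \<bar>x - y\<bar> powr (1 + 2 * \<theta>))"

text \<open>The space \<open>H\<^sup>s\<close> and its norm for real \<open>s \<ge> 0\<close> (Sobolev--Slobodeckij).\<close>

definition sobolev_space :: "real \<Rightarrow> real \<Rightarrow> (real \<Rightarrow> 'a::euclidean_space) set" where
  "sobolev_space L s = {f. (\<forall>n\<le>nat \<lfloor>s\<rfloor>. \<exists>g. has_weak_deriv L n f g) \<and>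
     (frac s \<noteq> 0 \<longrightarrow>
        integrable (lebesgue_on {0<..<L} \<Otimes>\<^sub>M lebesgue_on {0<..<L})
          (slobodeckij_kernel (frac s) (weak_deriv L (nat \<lfloor>s\<rfloor>) f)))}"

definition sobolev_norm :: "real \<Rightarrow> real \<Rightarrow> (real \<Rightarrow> 'a::euclidean_space) \<Rightarrow> real" where
  "sobolev_norm L s f = sqrt ((\<Sum>n\<le>nat \<lfloor>s\<rfloor>. (L2_norm L (weak_deriv L n f))\<^sup>2) +
     (if frac s = 0 then 0
      else integral\<^sup>L (lebesgue_on {0<..<L} \<Otimes>\<^sub>M lebesgue_on {0<..<L})
             (slobodeckij_kernel (frac s) (weak_deriv L (nat \<lfloor>s\<rfloor>) f))))"

text \<open>\<open>H\<^sub>N\<^sup>s\<close> for \<open>s > 3/2\<close>: then \<open>H\<^sup>s\<close> embeds into \<open>C\<^sup>1([0,L])\<close>, so each class is represented by its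
  continuous member and the boundary condition is about its classical one-sided derivatives.\<close>

definition sobolev_space_N :: "real \<Rightarrow> real \<Rightarrow> (real \<Rightarrow> real^3) set" where
  "sobolev_space_N L s = {u. u \<in> sobolev_space L s \<and> continuous_on {0..L} u \<and>
     (\<forall>x\<in>{0, L}. (u has_vector_derivative 0) (at x within {0..L}))}"

definition positive_states :: "real \<Rightarrow> real \<Rightarrow> (real \<Rightarrow> real^3) set" where
  "positive_states L \<alpha> = {u. u \<in> sobolev_space_N L (2 * \<alpha>) \<and> (\<forall>x\<in>{0..L}. \<forall>i. u x $ i > 0)}"


subsection \<open>Curves in function spaces\<close>

definition continuous_curve ::
  "((real \<Rightarrow> 'a::euclidean_space) \<Rightarrow> real) \<Rightarrow> real set \<Rightarrow> (real \<Rightarrow> real \<Rightarrow> 'a) \<Rightarrow> bool" where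
  "continuous_curve nrm I u \<longleftrightarrow>
     (\<forall>t\<in>I. ((\<lambda>s. nrm (\<lambda>x. u s x - u t x)) \<longlongrightarrow> 0) (at t within I))"

text \<open>\<open>u\<close> is in \<open>C\<^sup>1(I, L\<^sub>2)\<close> with time derivative \<open>v\<close>.\<close>

definition C1_curve_L2 ::
  "real \<Rightarrow> real set \<Rightarrow> (real \<Rightarrow> real \<Rightarrow> 'a::euclidean_space) \<Rightarrow> (real \<Rightarrow> real \<Rightarrow> 'a) \<Rightarrow> bool" where
  "C1_curve_L2 L I u v \<longleftrightarrow>
     (\<forall>t\<in>I. u t \<in> L2_space L \<and> v t \<in> L2_space L \<and>
        ((\<lambda>s. L2_norm L (\<lambda>x. (u s x - u t x) /\<^sub>R (s - t) - v t x)) \<longlongrightarrow> 0) (at t within I)) \<and>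
     continuous_curve (L2_norm L) I v"


subsection \<open>The evolution problem\<close>

text \<open>The three equations at a fixed time, in \<open>L\<^sub>2\<close>, where \<open>ht, mt, \<Gamma>t\<close> are the time derivatives and
  \<open>J1, J2, J3\<close> the weak \<open>x\<close>-derivatives of the fluxes. The derivatives inside the fluxes are classical:
  \<open>h, m, \<Gamma>\<close> are of class \<open>C\<^sup>1\<close> on the interval.\<close>

definition film_equations ::
  "real \<Rightarrow> real \<Rightarrow> real \<Rightarrow> real \<Rightarrow> real \<Rightarrow> real \<Rightarrow> (real \<Rightarrow> real) \<Rightarrow>
   (real \<Rightarrow> real) \<Rightarrow> (real \<Rightarrow> real) \<Rightarrow> (real \<Rightarrow> real) \<Rightarrow>
   (real \<Rightarrow> real) \<Rightarrow> (real \<Rightarrow> real) \<Rightarrow> (real \<Rightarrow> real) \<Rightarrow> bool" where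
  "film_equations L G D \<delta> \<beta> K \<sigma> h m \<Gamma> ht mt \<Gamma>t \<longleftrightarrow>
     (\<exists>J1 J2 J3.
       has_weak_deriv L 1
         (\<lambda>x. G / 3 * (h x)^3 * deriv h x - 1 / 2 * (h x)^2 * deriv (\<lambda>y. \<sigma> (\<Gamma> y)) x) J1 \<and>
       has_weak_deriv L 1
         (\<lambda>x. G / 3 * (h x)^2 * m x * deriv h x - 1 / 2 * h x * m x * deriv (\<lambda>y. \<sigma> (\<Gamma> y)) x
              + \<delta> * deriv m x - \<delta> * (m x / h x) * deriv h x) J2 \<and>
       has_weak_deriv L 1
         (\<lambda>x. G / 2 * (h x)^2 * \<Gamma> x * deriv h x - h x * \<Gamma> x * deriv (\<lambda>y. \<sigma> (\<Gamma> y)) x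
              + D * deriv \<Gamma> x) J3 \<and>
       (AE x in lebesgue_on {0<..<L}.
          ht x - J1 x = 0 \<and>
          mt x - J2 x = - K * (\<beta> * m x / h x - \<Gamma> x) \<and>
          \<Gamma>t x - J3 x = K * (\<beta> * m x / h x - \<Gamma> x)))"

text \<open>Strictly positive strong solutions on \<open>[0,T)\<close>, \<open>T \<in> (0,\<infinity>]\<close>; the Neumann conditions are part of the
  spaces.\<close>

definition strong_solution ::
  "real \<Rightarrow> real \<Rightarrow> real \<Rightarrow> real \<Rightarrow> real \<Rightarrow> real \<Rightarrow> (real \<Rightarrow> real) \<Rightarrow> real \<Rightarrow>
   (real \<Rightarrow> real^3) \<Rightarrow> ereal \<Rightarrow> (real \<Rightarrow> real \<Rightarrow> real^3) \<Rightarrow> bool" where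
  "strong_solution L G D \<delta> \<beta> K \<sigma> \<alpha> u0 T u \<longleftrightarrow>
     0 < T \<and>
     (\<forall>t\<in>{t. 0 \<le> t \<and> ereal t < T}. u t \<in> positive_states L \<alpha>) \<and>
     continuous_curve (sobolev_norm L (2 * \<alpha>)) {t. 0 \<le> t \<and> ereal t < T} u \<and>
     (\<forall>t\<in>{t. 0 < t \<and> ereal t < T}. u t \<in> sobolev_space_N L 2) \<and>
     continuous_curve (sobolev_norm L 2) {t. 0 < t \<and> ereal t < T} u \<and>
     (\<exists>v. C1_curve_L2 L {t. 0 < t \<and> ereal t < T} u v \<and>
        (\<forall>t\<in>{t. 0 < t \<and> ereal t < T}.
           film_equations L G D \<delta> \<beta> K \<sigma>
             (\<lambda>x. u t x $ 1) (\<lambda>x. u t x $ 2) (\<lambda>x. u t x $ 3)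
             (\<lambda>x. v t x $ 1) (\<lambda>x. v t x $ 2) (\<lambda>x. v t x $ 3))) \<and>
     (\<forall>x\<in>{0..L}. u 0 x = u0 x)"

definition maximal_strong_solution ::
  "real \<Rightarrow> real \<Rightarrow> real \<Rightarrow> real \<Rightarrow> real \<Rightarrow> real \<Rightarrow> (real \<Rightarrow> real) \<Rightarrow> real \<Rightarrow>
   (real \<Rightarrow> real^3) \<Rightarrow> ereal \<Rightarrow> (real \<Rightarrow> real \<Rightarrow> real^3) \<Rightarrow> bool" where
  "maximal_strong_solution L G D \<delta> \<beta> K \<sigma> \<alpha> u0 T u \<longleftrightarrow>
     strong_solution L G D \<delta> \<beta> K \<sigma> \<alpha> u0 T u \<and>
     (\<forall>T' w. strong_solution L G D \<delta> \<beta> K \<sigma> \<alpha> u0 T' w \<and> T \<le> T' \<and>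
        (\<forall>t\<in>{t. 0 \<le> t \<and> ereal t < T}. \<forall>x\<in>{0..L}. w t x = u t x) \<longrightarrow> T' = T)"

end

theory Submission
  imports Defs "HOL-Computational_Algebra.Polynomial"
begin

text \<open>
  For \<open>t > 0\<close> the energy is differentiated under the integral: a quadratic Taylor remainder, uniform on
  compact sets of positive states, reduces this to differentiability of the curve in \<open>L\<^sub>2\<close>. For the
  perspective function \<open>h \<phi>(c)\<close> with \<open>c = \<beta> m / h\<close> the remainder is \<open>h\<close> times that of \<open>\<phi>\<close> in \<open>c\<close>.
  Inserting the equations and integrating by parts gives the dissipation, where no boundary
  terms appear because the fluxes vanish with the slopes. Since a flux is only known to have a weak
  derivative, the integration by parts is Fubini's theorem applied to the primitive of that derivative.

  At \<open>t = 0\<close> the one-sided derivative follows from the mean value theorem, because energy and dissipation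
  are continuous along curves that are continuous in \<open>H\<^sup>s\<close>, \<open>s = 2 \<alpha> > 3/2\<close>. This uses the embedding of
  \<open>H\<^sup>s\<close> into \<open>C\<^sup>1([0,L])\<close>: for \<open>w\<close> in \<open>H\<^sup>s\<close> the second difference
  \<open>w(x + 2 r) - 2 w(x + r) + w(x)\<close> is at most a constant times \<open>r\<close> to the power \<open>s - 1/2 > 1\<close>, so the
  dyadic difference quotients converge uniformly.
\<close>

subsection \<open>Smooth cut-off functions\<close>

text \<open>Functions are known only through integrals against test functions, and
  \<open>weak_deriv\<close> is an arbitrary choice among almost everywhere equal functions.
  Pointwise facts are extracted with two explicit families of test functions: bumps that tend to the
  indicator of an interval, and antiderivatives of the difference of two translates of one bump,
  which have compact support because the masses cancel. They turn weak derivatives into statements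
  about integrals over windows. Second differences fit this form: that of w is the difference of the
  integrals of its weak derivative over two adjacent windows, and the Slobodeckij seminorm bounds it
  by Cauchy--Schwarz on the product of the windows. The exponent exceeds 1 because \<alpha> > 3/4.
  Three cancellations shape the balance. The h component of the gradient removes the part of the m
  flux that is carried along with h. The relation between \<phi>'' and \<sigma>' expresses the
  \<Gamma> term through the slope of \<sigma>(\<Gamma>), so that a square can be completed. The
  factor 1 / \<beta> in the energy makes its m derivative \<phi>'(c), so that the reaction terms
  form one product.\<close>

primrec differentiable_times :: "nat \<Rightarrow> (real \<Rightarrow> real) \<Rightarrow> bool" where
  "differentiable_times 0 f \<longleftrightarrow> True"
| "differentiable_times (Suc n) f \<longleftrightarrow> (\<forall>x. f differentiable at x) \<and> differentiable_times n (deriv f)"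

lemma differentiable_times_SucI:
  assumes "\<And>x. (f has_real_derivative f' x) (at x)" "differentiable_times n f'"
  shows "differentiable_times (Suc n) f"
proof -
  have "deriv f = f'"
    using assms(1) DERIV_imp_deriv by blast
  then show ?thesis
    using assms real_differentiable_def by auto
qed

lemma differentiable_times_SucE:
  assumes "differentiable_times (Suc n) f"
  shows "(f has_real_derivative deriv f x) (at x)" "differentiable_times n (deriv f)"
  using assms DERIV_deriv_iff_real_differentiable by auto

lemma differentiable_times_Suc_imp: "differentiable_times (Suc n) f \<Longrightarrow> differentiable_times n f"
  by (induction n arbitrary: f) auto

lemma differentiable_times_add:
  assumes "differentiable_times n f" "differentiable_times n g"
  shows "differentiable_times n (\<lambda>x. f x + g x)"
  using assms
proof (induction n arbitrary: f g)
  case (Suc n)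
  show ?case
    by (rule differentiable_times_SucI[where f' = "\<lambda>x. deriv f x + deriv g x"])
       (auto intro!: derivative_eq_intros differentiable_times_SucE[OF Suc.prems(1)]
          differentiable_times_SucE[OF Suc.prems(2)] Suc.IH)
qed simp

lemma differentiable_times_mult:
  assumes "differentiable_times n f" "differentiable_times n g"
  shows "differentiable_times n (\<lambda>x. f x * g x)"
  using assms
proof (induction n arbitrary: f g)
  case (Suc n)
  note [simp] = Suc.prems[THEN differentiable_times_Suc_imp]
  show ?case
    by (rule differentiable_times_SucI[where f' = "\<lambda>x. deriv f x * g x + deriv g x * f x"])
       (auto intro!: derivative_eq_intros differentiable_times_SucE[OF Suc.prems(1)]
          differentiable_times_SucE[OF Suc.prems(2)] Suc.IH differentiable_times_add)
qed simp

lemma differentiable_times_const: "differentiable_times n (\<lambda>x. c)"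
  by (induction n arbitrary: c) auto

lemma differentiable_times_diff:
  assumes "differentiable_times n f" "differentiable_times n g"
  shows "differentiable_times n (\<lambda>x. f x - g x)"
  using differentiable_times_add[OF assms(1)
      differentiable_times_mult[OF differentiable_times_const[of n "-1"] assms(2)]] by simp

lemma differentiable_times_affine:
  assumes "differentiable_times n f"
  shows "differentiable_times n (\<lambda>x. f (a * x + b))"
  using assms
proof (induction n arbitrary: f)
  case (Suc n)
  show ?case
  proof (rule differentiable_times_SucI)
    show "((\<lambda>x. f (a * x + b)) has_real_derivative a * deriv f (a * x + b)) (at x)" for x
      by (rule DERIV_cong, rule DERIV_chain2[OF differentiable_times_SucE(1)[OF Suc.prems]])
         (auto intro!: derivative_eq_intros)
    show "differentiable_times n (\<lambda>x. a * deriv f (a * x + b))"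
      using Suc.IH[OF differentiable_times_SucE(2)[OF Suc.prems]]
      by (intro differentiable_times_mult differentiable_times_const)
  qed
qed simp

text \<open>Connects to the form \<open>deriv ^^ n\<close> used in \<open>test_functions\<close>.
  The recursive predicate peels off the first derivative, so closure under sums, products and affine
  substitution is an induction on the order with the function left free.\<close>

lemma differentiable_times_funpow_deriv:
  "differentiable_times (Suc n) f \<Longrightarrow> (deriv ^^ n) f differentiable (at x)"
  by (induction n arbitrary: f) (auto simp: funpow_swap1)

text \<open>The flat function exp(-1/x) is not closed under differentiation; with polynomials in 1/x
  as coefficients it is, so smoothness becomes an induction. With y = 1/x, the derivative of p(y)
  exp(-y) in x is y^2 (p(y) - p'(y)) exp(-y).\<close>

definition flat_exp :: "real poly \<Rightarrow> real \<Rightarrow> real" where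
  "flat_exp p x = (if x > 0 then poly p (1 / x) * exp (- (1 / x)) else 0)"

lemma poly_exp_tendsto_0: "((\<lambda>y. poly p y * exp (- y)) \<longlongrightarrow> (0::real)) at_top"
proof -
  have "((\<lambda>y. \<Sum>i\<le>degree p. coeff p i * (y ^ i / exp y)) \<longlongrightarrow> (\<Sum>i\<le>degree p. coeff p i * 0)) at_top"
    by (intro tendsto_sum tendsto_mult tendsto_const tendsto_power_div_exp_0)
  moreover have "(\<lambda>y. poly p y * exp (- y)) = (\<lambda>y. \<Sum>i\<le>degree p. coeff p i * (y ^ i / exp y))"
    by (simp add: poly_altdef sum_distrib_right exp_minus divide_inverse mult.assoc)
  ultimately show ?thesis by simp
qed

lemma has_derivative_flat_exp:
  "(flat_exp p has_real_derivative flat_exp ([:0, 0, 1:] * (p - pderiv p)) x) (at x)"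
proof -
  consider "x > 0" | "x < 0" | "x = 0" by linarith
  then show ?thesis
  proof cases
    case 1
    have "((\<lambda>x. poly p (1 / x) * exp (- (1 / x))) has_real_derivative
        flat_exp ([:0, 0, 1:] * (p - pderiv p)) x) (at x)"
      using 1 by (auto intro!: derivative_eq_intros DERIV_chain2[OF poly_DERIV]
          simp: flat_exp_def power2_eq_square field_simps)
    then show ?thesis
      by (rule has_field_derivative_transform_within_open[of _ _ _ "{0<..}"])
         (use 1 in \<open>auto simp: flat_exp_def\<close>)
  next
    case 2
    have "((\<lambda>x. 0) has_real_derivative flat_exp ([:0, 0, 1:] * (p - pderiv p)) x) (at x)"
      using 2 by (simp add: flat_exp_def)
    then show ?thesis
      by (rule has_field_derivative_transform_within_open[of _ _ _ "{..<0}"])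
         (use 2 in \<open>auto simp: flat_exp_def\<close>)
  next
    case 3
    have "((\<lambda>h. (flat_exp p h - flat_exp p 0) / (h - 0)) \<longlongrightarrow> 0) (at 0)"
      proof (rule filterlim_split_at)
      \<comment> \<open>The difference quotient at 0 is y p(y) exp(-y) with y = 1/h; the factor y is
        the shift \<open>pCons 0 p\<close>.\<close>
      have "((\<lambda>h. (\<lambda>y. poly (pCons 0 p) y * exp (- y)) (inverse h)) \<longlongrightarrow> 0) (at_right 0)"
        by (rule filterlim_compose[OF poly_exp_tendsto_0 filterlim_inverse_at_top_right])
      then show "((\<lambda>h. (flat_exp p h - flat_exp p 0) / (h - 0)) \<longlongrightarrow> 0) (at_right 0)"
        by (rule Lim_transform_eventually)
           (auto simp: eventually_at_filter flat_exp_def field_simps)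
      show "((\<lambda>h. (flat_exp p h - flat_exp p 0) / (h - 0)) \<longlongrightarrow> 0) (at_left 0)"
        by (rule Lim_transform_eventually[OF tendsto_const])
           (auto simp: eventually_at_filter flat_exp_def)
    qed
    then show ?thesis
      using 3 by (simp add: has_field_derivative_iff flat_exp_def)
  qed
qed

lemma differentiable_times_flat_exp: "differentiable_times n (flat_exp p)"
  by (induction n arbitrary: p) (auto intro!: differentiable_times_SucI has_derivative_flat_exp
      simp del: differentiable_times.simps(2))

text \<open>The support stays fixed while n steepens both flanks: exp(-1/((n+1) c)) tends to 1 for
  every c > 0. Bounded by 1 and pointwise convergent to the indicator of the open interval, these
  functions admit dominated convergence without any convolution.\<close>

definition bump :: "real \<Rightarrow> real \<Rightarrow> nat \<Rightarrow> real \<Rightarrow> real" where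
  "bump a b n x = flat_exp 1 (real (Suc n) * (x - a)) * flat_exp 1 (real (Suc n) * (b - x))"

lemma differentiable_times_bump: "differentiable_times k (bump a b n)"
proof -
  have "bump a b n = (\<lambda>x. flat_exp 1 (real (Suc n) * x + real (Suc n) * (- a)) *
      flat_exp 1 (- real (Suc n) * x + real (Suc n) * b))"
    by (auto simp: bump_def algebra_simps)
  then show ?thesis
    by (simp only:) (intro differentiable_times_mult differentiable_times_affine differentiable_times_flat_exp)
qed

lemma flat_exp_1_bounds: "0 \<le> flat_exp 1 x" "flat_exp 1 x \<le> 1"
  by (auto simp: flat_exp_def)

lemma bump_nonneg: "0 \<le> bump a b n x" and bump_le_1: "bump a b n x \<le> 1"
  by (auto simp: bump_def flat_exp_1_bounds mult_le_one)

lemma bump_eq_0: "x \<notin> {a<..<b} \<Longrightarrow> bump a b n x = 0"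
  by (auto simp: bump_def flat_exp_def zero_less_mult_iff)

lemma bump_tendsto_indicator: "(\<lambda>n. bump a b n x) \<longlonglongrightarrow> indicator {a<..<b} x"
proof (cases "x \<in> {a<..<b}")
  case True
  have *: "(\<lambda>n. flat_exp 1 (real (Suc n) * c)) \<longlonglongrightarrow> 1" if "c > 0" for c
  proof -
    have "(\<lambda>n. exp (- (inverse (real (Suc n)) * (1 / c)))) \<longlonglongrightarrow> exp (- (0 * (1 / c)))"
      by (intro tendsto_intros LIMSEQ_inverse_real_of_nat)
    then show ?thesis
      using that by (simp add: flat_exp_def zero_less_mult_iff field_simps del: of_nat_Suc)
  qed
  have "(\<lambda>n. bump a b n x) \<longlonglongrightarrow> 1 * 1"
    unfolding bump_def using True by (intro tendsto_mult *) auto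
  then show ?thesis using True by simp
next
  case False
  then show ?thesis by (simp add: bump_eq_0)
qed

lemma test_functionI:
  assumes "\<And>n. differentiable_times n \<psi>" "\<And>x. x \<notin> {a..b} \<Longrightarrow> \<psi> x = 0" "0 < a" "b < L"
  shows "\<psi> \<in> test_functions L"
proof -
  have "closure {x. \<psi> x \<noteq> 0} \<subseteq> {a..b}"
    by (rule closure_minimal) (use assms(2) in blast, simp)
  then show ?thesis
    using assms by (auto simp: test_functions_def intro!: differentiable_times_funpow_deriv)
qed

lemma continuous_on_bump: "continuous_on S (bump a b n)"
  using differentiable_times_SucE(1)[OF differentiable_times_bump]
  by (meson DERIV_isCont continuous_at_imp_continuous_on)

lemma bump_test_function: "0 < a \<Longrightarrow> b < L \<Longrightarrow> bump a b n \<in> test_functions L"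
  by (rule test_functionI[where a=a and b=b]) (auto simp: differentiable_times_bump bump_eq_0)

lemma bump_shift: "bump (a + d) (b + d) n x = bump a b n (x - d)"
  by (simp add: bump_def algebra_simps)

text \<open>Subtracting a translate cancels the total mass, so the antiderivative S(x) - S(x - d)
  vanishes on both sides and becomes a test function once the windows lie inside the interval. It is
  at most r because S grows only on an interval of length r, with slope at most 1.\<close>

lemma bump_difference_antiderivative:
  fixes a r d :: real
  assumes "0 \<le> r" "0 \<le> d"
  obtains \<psi> where "\<And>x. (\<psi> has_real_derivative (bump a (a + r) n x - bump (a + d) (a + d + r) n x)) (at x)"
    "\<And>x. x \<notin> {a<..a + d + r} \<Longrightarrow> \<psi> x = 0" "\<And>x. \<bar>\<psi> x\<bar> \<le> r" "\<And>k. differentiable_times k \<psi>"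
proof -
  obtain S where S: "\<And>x. (S has_real_derivative bump a (a + r) n x) (at x)"
  proof -
    have "\<exists>F. \<forall>x::real. - \<infinity> < ereal x \<longrightarrow> ereal x < \<infinity> \<longrightarrow> (F has_vector_derivative bump a (a + r) n x) (at x)"
      by (rule einterval_antiderivative)
         (use continuous_on_bump[of UNIV] in \<open>auto simp: continuous_on_eq_continuous_at\<close>)
    then show ?thesis
      using that by (auto simp: has_real_derivative_iff_has_vector_derivative)
  qed
  have mono: "S x \<le> S y" if "x \<le> y" for x y
    by (rule DERIV_nonneg_imp_nondecreasing[OF that]) (use S bump_nonneg in blast)
  have le: "S y - S x \<le> y - x" if "x \<le> y" for x y
  proof -
    have "(\<lambda>x. S x - x) y \<le> (\<lambda>x. S x - x) x"
      by (rule DERIV_nonpos_imp_nonincreasing[OF that])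
         (auto intro!: exI[of _ "bump a (a + r) n _ - 1"] derivative_eq_intros S simp: bump_le_1)
    then show ?thesis by simp
  qed
  have left: "S x = S a" if "x \<le> a" for x

  proof -
    have "S a - S x = 0"
    proof (cases "x = a")
      case False
      then obtain z where "x < z" "z < a" "S a - S x = (a - x) * bump a (a + r) n z"
        using MVT2[of x a S "bump a (a + r) n", OF _ S] \<open>x \<le> a\<close> False by (metis order_le_less)
      then show ?thesis by (simp add: bump_eq_0)
    qed simp
    then show ?thesis by simp
  qed
  have right: "S x = S (a + r)" if "x \<ge> a + r" for x
  proof -
    have "S x - S (a + r) = 0"
    proof (cases "x = a + r")
      case False
      then obtain z where "a + r < z" "z < x" "S x - S (a + r) = (x - (a + r)) * bump a (a + r) n z"
        using MVT2[of "a + r" x S "bump a (a + r) n", OF _ S] \<open>x \<ge> a + r\<close> False by (metis order_le_less)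
      then show ?thesis by (simp add: bump_eq_0)
    qed simp
    then show ?thesis by simp
  qed
  have total: "S y - S x \<le> r" if "x \<le> y" for x y
  proof -
    have "S y \<le> S (a + r)"
      using right[of y] mono[of y "a + r"] by linarith
    moreover have "S x \<ge> S a"
      using left[of x] mono[of a x] by linarith
    ultimately show ?thesis using le[of a "a + r"] assms by linarith
  qed
  define \<psi> where "\<psi> x = S x - S (x - d)" for x
  have der: "(\<psi> has_real_derivative (bump a (a + r) n x - bump (a + d) (a + d + r) n x)) (at x)" for x
  proof -
    have "((\<lambda>x. S (x - d)) has_real_derivative bump a (a + r) n (x - d) * 1) (at x)"
      by (rule DERIV_chain2[OF S]) (auto intro!: derivative_eq_intros)
    from DERIV_diff[OF S this] show ?thesis
      using bump_shift[of a d "a + r" n x] by (simp add: \<psi>_def[abs_def] add_ac)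
  qed
  show thesis
  proof (rule that[OF der])
    show "\<psi> x = 0" if "x \<notin> {a<..a + d + r}" for x
      using left[of x] left[of "x - d"] right[of x] right[of "x - d"] that assms
      unfolding \<psi>_def greaterThanAtMost_iff by linarith
    show "\<bar>\<psi> x\<bar> \<le> r" for x
      using total[of "x - d" x] mono[of "x - d" x] assms unfolding \<psi>_def by linarith
    have "differentiable_times (Suc k) \<psi>" for k
      by (rule differentiable_times_SucI[OF der])
         (intro differentiable_times_diff differentiable_times_bump)
    then show "differentiable_times k \<psi>" for k
      by (rule differentiable_times_Suc_imp)
  qed
qed

subsection \<open>Integrals over subintervals\<close>

abbreviation (input) leb_interval :: "real \<Rightarrow> real measure" where
  "leb_interval L \<equiv> lebesgue_on {0<..<L}"

lemma finite_measure_leb_interval: "finite_measure (leb_interval L)"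
  by (rule finite_measureI) (cases "0 \<le> L"; simp add: emeasure_restrict_space space_restrict_space)

lemma borel_measurable_leb_intervalI:
  "f \<in> borel_measurable borel \<Longrightarrow> f \<in> borel_measurable (leb_interval L)"
  by (intro measurable_restrict_space1 measurable_completion) simp

lemma measurable_continuous_leb_interval:
  fixes f :: "real \<Rightarrow> 'a::euclidean_space"
  shows "continuous_on {0<..<L} f \<Longrightarrow> f \<in> borel_measurable (leb_interval L)"
  by (simp add: continuous_imp_measurable_on_sets_lebesgue)

lemma integrable_continuous_leb_interval:
  fixes f :: "real \<Rightarrow> 'a::euclidean_space"
  assumes "continuous_on {0..L} f"
  shows "integrable (leb_interval L) f"
proof -
  interpret finite_measure "leb_interval L" by (rule finite_measure_leb_interval)
  have "bounded (f ` {0..L})"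
    by (intro compact_imp_bounded compact_continuous_image assms) simp
  then obtain B where B: "\<And>x. x \<in> {0..L} \<Longrightarrow> norm (f x) \<le> B"
    by (force simp: bounded_iff)
  show ?thesis
    by (rule integrable_const_bound[where B = B])
       (auto intro!: measurable_continuous_leb_interval continuous_on_subset[OF assms] B AE_I2
         simp: space_restrict_space)
qed

lemma integrable_continuous_scaleR:
  fixes f :: "real \<Rightarrow> 'a::euclidean_space" and c :: "real \<Rightarrow> real"
  assumes c: "continuous_on {0..L} c" and f: "integrable (leb_interval L) f"
  shows "integrable (leb_interval L) (\<lambda>x. c x *\<^sub>R f x)"
proof -
  have "bounded (c ` {0..L})"
    by (intro compact_imp_bounded compact_continuous_image c) simp
  then obtain B where B: "\<And>x. x \<in> {0..L} \<Longrightarrow> \<bar>c x\<bar> \<le> B"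
    by (force simp: bounded_iff)
  have m: "c \<in> borel_measurable (leb_interval L)"
    by (intro measurable_continuous_leb_interval continuous_on_subset[OF c]) auto
  show ?thesis
  proof (rule Bochner_Integration.integrable_bound)
    show "integrable (leb_interval L) (\<lambda>x. B *\<^sub>R f x)"
      using f by simp
    show "(\<lambda>x. c x *\<^sub>R f x) \<in> borel_measurable (leb_interval L)"
      by (rule borel_measurable_scaleR[OF m borel_measurable_integrable[OF f]])
    show "AE x in leb_interval L. norm (c x *\<^sub>R f x) \<le> norm (B *\<^sub>R f x)"
      using B by (intro AE_I2)
        (auto simp: space_restrict_space intro!: mult_right_mono order_trans[OF _ abs_ge_self])
  qed
qed

lemma sets_leb_interval_borel: "A \<in> sets borel \<Longrightarrow> A \<subseteq> {0<..<L} \<Longrightarrow> A \<in> sets (leb_interval L)"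
  by (simp add: sets_restrict_space_iff)

lemma AE_leb_interval_neq: "AE x in leb_interval L. x \<noteq> c"
proof -
  have "AE x in lebesgue. x \<noteq> c"
    using AE_lborel_singleton by (rule AE_completion)
  then show ?thesis
    by (subst AE_restrict_space_iff) auto
qed

text \<open>The half-open interval makes additivity in the endpoints exact.\<close>

definition iint :: "real \<Rightarrow> real \<Rightarrow> real \<Rightarrow> (real \<Rightarrow> 'a::euclidean_space) \<Rightarrow> 'a" where
  "iint L a b f = (LINT x|leb_interval L. indicator {a<..b} x *\<^sub>R f x)"

lemma integrable_indicator_leb_interval:
  fixes f :: "real \<Rightarrow> 'a::euclidean_space"
  assumes "integrable (leb_interval L) f" "A \<in> sets borel"
  shows "integrable (leb_interval L) (\<lambda>x. indicator A x *\<^sub>R f x)"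
proof (rule Bochner_Integration.integrable_bound[OF assms(1)])
  show "(\<lambda>x. indicator A x *\<^sub>R f x) \<in> borel_measurable (leb_interval L)"
    by (intro borel_measurable_scaleR borel_measurable_integrable assms
        borel_measurable_leb_intervalI borel_measurable_indicator)
qed (auto simp: indicator_def)

lemma iint_add:
  fixes f :: "real \<Rightarrow> 'a::euclidean_space"
  assumes "integrable (leb_interval L) f" "a \<le> b" "b \<le> c"
  shows "iint L a c f = iint L a b f + iint L b c f"
  unfolding iint_def
proof (subst Bochner_Integration.integral_add[symmetric])
  show "(LINT x|leb_interval L. indicator {a<..c} x *\<^sub>R f x) =
      (LINT x|leb_interval L. indicator {a<..b} x *\<^sub>R f x + indicator {b<..c} x *\<^sub>R f x)"
    using assms by (intro Bochner_Integration.integral_cong) (auto simp: indicator_def)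
qed (intro integrable_indicator_leb_interval assms; simp)+

lemma iint_diff:
  fixes f g :: "real \<Rightarrow> 'a::euclidean_space"
  assumes "integrable (leb_interval L) f" "integrable (leb_interval L) g"
  shows "iint L a b (\<lambda>x. f x - g x) = iint L a b f - iint L a b g"
  unfolding iint_def scaleR_diff_right
  by (intro Bochner_Integration.integral_diff integrable_indicator_leb_interval assms) auto

lemma norm_iint_le:
  fixes f :: "real \<Rightarrow> 'a::euclidean_space"
  shows "norm (iint L a b f) \<le> iint L a b (\<lambda>x. norm (f x))"
  unfolding iint_def by (rule order_trans[OF integral_norm_bound]) simp

lemma iint_const:
  assumes "0 \<le> a" "a \<le> b" "b < L \<or> b = L"
  shows "iint L a b (\<lambda>x. c) = (b - a) *\<^sub>R (c :: 'a::euclidean_space)"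
proof -
  have "iint L a b (\<lambda>x. c) = (LINT x|leb_interval L. indicator {a<..<b} x *\<^sub>R c)"
    unfolding iint_def
    by (rule integral_cong_AE) (use AE_leb_interval_neq[of b L] in
       \<open>auto intro!: borel_measurable_scaleR borel_measurable_leb_intervalI elim!: eventually_mono simp: indicator_def\<close>)
  also have "\<dots> = measure (leb_interval L) {a<..<b} *\<^sub>R c"
    using assms by (subst integral_scaleR_left)
      (auto simp: finite_measure.emeasure_finite[OF finite_measure_leb_interval] less_top[symmetric]
        intro!: integrable_real_indicator sets_leb_interval_borel)
  also have "measure (leb_interval L) {a<..<b} = b - a"
    using assms by (subst measure_restrict_space) auto
  finally show ?thesis .
qed

lemma iint_eq_integral:
  fixes f :: "real \<Rightarrow> 'a::euclidean_space"
  assumes f: "continuous_on {a..b} f" and "0 \<le> a" "b \<le> L"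
  shows "iint L a b f = integral {a..b} f"
proof -
  have ai: "f absolutely_integrable_on {a..b}"
    using absolutely_integrable_continuous_real[OF f] .
  then have m: "(\<lambda>x. indicator {a..b} x *\<^sub>R f x) \<in> borel_measurable lebesgue"
    by (auto simp: set_integrable_def)
  have eq: "(\<lambda>x. indicator {0<..<L} x *\<^sub>R indicator {a<..b} x *\<^sub>R f x) =
      (\<lambda>x. indicator ({0<..<L} \<inter> {a<..}) x *\<^sub>R (indicator {a..b} x *\<^sub>R f x))"
    by (auto simp: indicator_def)
  have "iint L a b f = (LINT x|lebesgue. indicator {0<..<L} x *\<^sub>R indicator {a<..b} x *\<^sub>R f x)"
    unfolding iint_def by (subst integral_restrict_space) auto
  also have "\<dots> = (LINT x|lebesgue. indicator {a..b} x *\<^sub>R f x)"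
  proof (rule integral_cong_AE)
    show "(\<lambda>x. indicator {0<..<L} x *\<^sub>R indicator {a<..b} x *\<^sub>R f x) \<in> borel_measurable lebesgue"
      unfolding eq by (intro borel_measurable_scaleR borel_measurable_indicator m) auto
    have "AE x in lebesgue. x \<noteq> a \<and> x \<noteq> b"
      using AE_completion[OF AE_lborel_singleton] by (auto intro: eventually_conj)
    then show "AE x in lebesgue. indicator {0<..<L} x *\<^sub>R indicator {a<..b} x *\<^sub>R f x = indicator {a..b} x *\<^sub>R f x"
      by (rule eventually_mono) (use assms in \<open>auto simp: indicator_def\<close>)
  qed (rule m)
  also have "\<dots> = integral {a..b} f"
    using set_lebesgue_integral_eq_integral(2)[OF ai] by (simp add: set_lebesgue_integral_def)
  finally show ?thesis .
qed

lemma iint_FTC: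
  fixes \<psi> :: "real \<Rightarrow> 'a::euclidean_space"
  assumes "\<And>x. x \<in> {0..L} \<Longrightarrow> (\<psi> has_vector_derivative \<psi>' x) (at x within {0..L})"
    "continuous_on {0..L} \<psi>'" "0 \<le> a" "a \<le> b" "b \<le> L"
  shows "iint L a b \<psi>' = \<psi> b - \<psi> a"
proof -
  have "(\<psi>' has_integral (\<psi> b - \<psi> a)) {a..b}"
    by (rule fundamental_theorem_of_calculus)
       (use assms in \<open>auto intro: has_vector_derivative_within_subset[where S = "{0..L}"]\<close>)
  then show ?thesis
    using iint_eq_integral[of a b \<psi>' L] assms continuous_on_subset[OF assms(2), of "{a..b}"]
    by (simp add: integral_unique)
qed

subsection \<open>The Cauchy--Schwarz inequality\<close>

text \<open>For every c the integral over A of the square of \<open>norm (f x) - c\<close> is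
  nonnegative; a good c gives the inequality. The general measure with a set A serves both a
  subinterval, where the root of its length is gained, and a rectangle in the product space.\<close>

lemma integral_norm_indicator_le:
  fixes f :: "'b \<Rightarrow> 'a::{banach, second_countable_topology}"
  assumes fin: "finite_measure M" and f: "f \<in> borel_measurable M"
    and sq: "integrable M (\<lambda>x. (norm (f x))\<^sup>2)" and A: "A \<in> sets M"
  shows "integrable M f"
    and "(LINT x|M. indicator A x * norm (f x))
      \<le> sqrt (measure M A * (LINT x|M. indicator A x * (norm (f x))\<^sup>2))"
proof -
  interpret finite_measure M by (rule fin)
  have n: "integrable M (\<lambda>x. norm (f x))"
    by (rule square_integrable_imp_integrable) (use f sq in auto)
  then show "integrable M f"
    using f by (simp add: integrable_norm_iff)
  define X Y \<mu> where "X = (LINT x|M. indicator A x * norm (f x))"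
    and "Y = (LINT x|M. indicator A x * (norm (f x))\<^sup>2)" and "\<mu> = measure M A"
  have i: "integrable M (\<lambda>x. indicator A x * norm (f x))" "integrable M (\<lambda>x. indicator A x * (norm (f x))\<^sup>2)"
    "integrable M (indicat_real A)"
    using integrable_mult_indicator[OF A n] integrable_mult_indicator[OF A sq] A by (auto simp: less_top[symmetric])
  have *: "0 \<le> Y - 2 * c * X + c\<^sup>2 * \<mu>" for c
  proof -
    have "0 \<le> (LINT x|M. indicator A x * (norm (f x) - c)\<^sup>2)"
      by (intro integral_nonneg_AE) auto
    also have "(\<lambda>x. indicator A x * (norm (f x) - c)\<^sup>2) =
        (\<lambda>x. indicator A x * (norm (f x))\<^sup>2 - (2 * c) * (indicator A x * norm (f x)) + c\<^sup>2 * indicat_real A x)"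
      by (auto simp: power2_eq_square algebra_simps)
    also have "(LINT x|M. \<dots> x) = Y - 2 * c * X + c\<^sup>2 * \<mu>"
      using i A by (simp add: X_def Y_def \<mu>_def)
    finally show ?thesis .
  qed
  have "X\<^sup>2 \<le> \<mu> * Y"
  proof (cases "\<mu> = 0")
    case True
    have "X = 0"
    proof (rule ccontr)
      assume "X \<noteq> 0"
      \<comment> \<open>For measure 0 the quadratic is affine in c, and this c gives it the value
        -1. Otherwise its minimum, at \<open>X / \<mu>\<close>, is used.\<close>
      then show False
        using *[of "(Y + 1) / (2 * X)"] True by simp
    qed
    then show ?thesis using True by simp
  next
    case False
    then have "\<mu> > 0" by (simp add: \<mu>_def zero_less_measure_iff)
    then show ?thesis
      using *[of "X / \<mu>"] by (simp add: field_simps power2_eq_square)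
  qed
  then have "X \<le> sqrt (\<mu> * Y)"
    by (rule real_le_rsqrt)
  then show "X \<le> sqrt (measure M A * Y)"
    by (simp add: \<mu>_def)
qed

lemma L2_space_imp_integrable:
  fixes f :: "real \<Rightarrow> 'a::euclidean_space"
  shows "f \<in> L2_space L \<Longrightarrow> integrable (leb_interval L) f"
  unfolding L2_space_def
  by (rule integral_norm_indicator_le(1)[OF finite_measure_leb_interval _ _ sets.empty_sets]) auto

lemma L2_norm_nonneg: "0 \<le> L2_norm L f"
  unfolding L2_norm_def by (intro real_sqrt_ge_zero integral_nonneg_AE) auto

lemma L2_norm_square: "(L2_norm L f)\<^sup>2 = (LINT x|leb_interval L. (norm (f x))\<^sup>2)"
  unfolding L2_norm_def by (intro real_sqrt_pow2 integral_nonneg_AE) auto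

lemma iint_norm_le_L2_norm:
  fixes f :: "real \<Rightarrow> 'a::euclidean_space"
  assumes f: "f \<in> L2_space L" and "0 \<le> a" "a \<le> b" "b \<le> L"
  shows "iint L a b (\<lambda>x. norm (f x)) \<le> sqrt (b - a) * L2_norm L f"
proof -
  let ?M = "leb_interval L" and ?A = "{a<..b} \<inter> {0<..<L}"
  have f': "f \<in> borel_measurable ?M" "integrable ?M (\<lambda>x. (norm (f x))\<^sup>2)"
    using f by (auto simp: L2_space_def)
  have A: "?A \<in> sets ?M"
    by (rule sets_leb_interval_borel) auto
  have "iint L a b (\<lambda>x. norm (f x)) = (LINT x|?M. indicator ?A x * norm (f x))"
    unfolding iint_def
    by (intro Bochner_Integration.integral_cong) (auto simp: space_restrict_space indicator_def)
  also have "\<dots> \<le> sqrt (measure ?M ?A * (LINT x|?M. indicator ?A x * (norm (f x))\<^sup>2))"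
    by (rule integral_norm_indicator_le(2)[OF finite_measure_leb_interval f' A])
  also have "\<dots> \<le> sqrt ((b - a) * (LINT x|?M. (norm (f x))\<^sup>2))"
  proof (intro real_sqrt_le_mono mult_mono)
    have "measure ?M ?A = measure lebesgue ?A"
      by (subst measure_restrict_space) auto
    also have "\<dots> \<le> measure lebesgue {a<..b}"
      by (rule measure_mono_fmeasurable) (auto intro: fmeasurableI simp: bounded_set_imp_lmeasurable)
    finally show "measure ?M ?A \<le> b - a" using assms by simp
    show "(LINT x|?M. indicator ?A x * (norm (f x))\<^sup>2) \<le> (LINT x|?M. (norm (f x))\<^sup>2)"
      using integrable_mult_indicator[OF A f'(2)]
      by (intro integral_mono f') (auto simp: indicator_def)
  qed (use assms in \<open>auto intro!: integral_nonneg_AE\<close>)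
  finally show ?thesis
    by (simp add: L2_norm_def real_sqrt_mult)
qed

subsection \<open>Integration by parts against a primitive\<close>

text \<open>Fubini for \<psi>'(x) J(y) on the triangle y < x: integrating over y first produces the
  primitive, over x first the factor \<psi>(L) - \<psi>(y). No pointwise derivative of the primitive
  is involved, so J may be merely integrable.\<close>

lemma integral_primitive_by_parts:
  fixes J :: "real \<Rightarrow> 'a::euclidean_space" and \<psi> :: "real \<Rightarrow> real"
  assumes "0 \<le> L" and J: "integrable (leb_interval L) J"
    and \<psi>: "\<And>x. x \<in> {0..L} \<Longrightarrow> (\<psi> has_real_derivative \<psi>' x) (at x within {0..L})"
    and \<psi>': "continuous_on {0..L} \<psi>'"
  shows "(LINT x|leb_interval L. \<psi>' x *\<^sub>R iint L 0 x J)
    = \<psi> L *\<^sub>R (LINT x|leb_interval L. J x) - (LINT x|leb_interval L. \<psi> x *\<^sub>R J x)"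
proof -
  let ?M = "leb_interval L"
  interpret finite_measure ?M by (rule finite_measure_leb_interval)
  interpret P: pair_sigma_finite ?M ?M ..
  have \<psi>'': "integrable ?M \<psi>'"
    by (rule integrable_continuous_leb_interval[OF \<psi>'])
  have c: "continuous_on {0..L} \<psi>"
    using \<psi> by (meson DERIV_continuous_on)
  have \<psi>i: "integrable ?M (\<lambda>x. \<psi> x *\<^sub>R J x)"
    by (rule integrable_continuous_scaleR[OF c J])
  define F where "F = (\<lambda>(x, y). (indicator {y<..} x * \<psi>' x) *\<^sub>R J y)"
  have [measurable]: "\<psi>' \<in> borel_measurable ?M" "J \<in> borel_measurable ?M"
    using \<psi>'' J by auto
  have [measurable]: "(\<lambda>x. x) \<in> ?M \<rightarrow>\<^sub>M borel"
    by (rule borel_measurable_leb_intervalI) simp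
  have Fm: "F \<in> borel_measurable (?M \<Otimes>\<^sub>M ?M)"
  proof -
    have "F = (\<lambda>z. ((if snd z < fst z then 1 else 0) * \<psi>' (fst z)) *\<^sub>R J (snd z))"
      by (auto simp: F_def indicator_def)
    moreover have "\<dots> \<in> borel_measurable (?M \<Otimes>\<^sub>M ?M)"
      by measurable
    ultimately show ?thesis by simp
  qed
  have FI: "integrable (?M \<Otimes>\<^sub>M ?M) F"
  proof (rule P.Fubini_integrable[OF Fm])
    show "AE x in ?M. integrable ?M (\<lambda>y. F (x, y))"
    proof (rule AE_I2)
      fix x
      have "integrable ?M (\<lambda>y. \<psi>' x *\<^sub>R indicator {..<x} y *\<^sub>R J y)"
        by (intro integrable_scaleR_right integrable_indicator_leb_interval J) auto
      then show "integrable ?M (\<lambda>y. F (x, y))"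
        by (rule back_subst[of "integrable ?M"]) (auto simp: F_def indicator_def)
    qed
    show "integrable ?M (\<lambda>x. LINT y|?M. norm (F (x, y)))"
    proof (rule Bochner_Integration.integrable_bound)
      show "integrable ?M (\<lambda>x. (LINT y|?M. norm (J y)) * \<psi>' x)"
        using \<psi>'' by simp
      show "(\<lambda>x. LINT y|?M. norm (F (x, y))) \<in> borel_measurable ?M"
        using Fm by measurable
      have "norm (LINT y|?M. norm (F (x, y))) \<le> norm ((LINT y|?M. norm (J y)) * \<psi>' x)" for x
      proof -
        have i1: "integrable ?M (\<lambda>y. norm (J y) * \<bar>\<psi>' x\<bar>)"
          using J by simp
        have "(LINT y|?M. norm (F (x, y))) \<le> (LINT y|?M. norm (J y) * \<bar>\<psi>' x\<bar>)"
        proof (rule integral_mono_AE'[OF i1])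
        qed (auto simp: F_def indicator_def mult.commute)
        moreover have "0 \<le> (LINT y|?M. norm (F (x, y)))" "0 \<le> (LINT y|?M. norm (J y))"
          by (auto intro!: integral_nonneg_AE)
        ultimately show ?thesis
          by (simp add: abs_mult)
      qed
      then show "AE x in ?M. norm (LINT y|?M. norm (F (x, y))) \<le> norm ((LINT y|?M. norm (J y)) * \<psi>' x)"
        by simp
    qed
  qed
  have "(LINT x|?M. \<psi>' x *\<^sub>R iint L 0 x J) = (LINT x|?M. LINT y|?M. F (x, y))"
  proof (rule Bochner_Integration.integral_cong[OF refl])
    fix x
    have "(LINT y|?M. F (x, y)) = (LINT y|?M. \<psi>' x *\<^sub>R indicator {0<..x} y *\<^sub>R J y)"
    proof (rule integral_cong_AE)
      show "AE y in ?M. F (x, y) = \<psi>' x *\<^sub>R indicator {0<..x} y *\<^sub>R J y"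
        using AE_leb_interval_neq[of x L] AE_space[of ?M]
        by eventually_elim (auto simp: F_def indicator_def space_restrict_space)
      show "(\<lambda>y. F (x, y)) \<in> borel_measurable ?M"
        unfolding F_def by (auto intro!: borel_measurable_scaleR borel_measurable_times
          borel_measurable_leb_intervalI simp: indicator_def[abs_def])
      show "(\<lambda>y. \<psi>' x *\<^sub>R indicator {0<..x} y *\<^sub>R J y) \<in> borel_measurable ?M"
        by (auto intro!: borel_measurable_scaleR borel_measurable_leb_intervalI)
    qed
    then show "\<psi>' x *\<^sub>R iint L 0 x J = (LINT y|?M. F (x, y))"
      by (simp only: iint_def integral_scaleR_right)
  qed
  also have "\<dots> = (LINT y|?M. LINT x|?M. F (x, y))"
    by (rule P.Fubini_integral[symmetric]) (use FI in \<open>simp add: case_prod_eta\<close>)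
  also have "\<dots> = (LINT y|?M. (\<psi> L - \<psi> y) *\<^sub>R J y)"
  proof (rule Bochner_Integration.integral_cong[OF refl])
    fix y assume "y \<in> space ?M"
    then have y: "0 < y" "y < L" by (auto simp: space_restrict_space)
    have "(LINT x|?M. F (x, y)) = (LINT x|?M. (indicator {y<..L} x *\<^sub>R \<psi>' x) *\<^sub>R J y)"
      by (intro Bochner_Integration.integral_cong) (auto simp: F_def space_restrict_space indicator_def)
    also have "\<dots> = iint L y L \<psi>' *\<^sub>R J y"
      unfolding iint_def
      by (rule integral_scaleR_left) (intro integrable_indicator_leb_interval \<psi>'' impI, simp)
    also have "iint L y L \<psi>' = \<psi> L - \<psi> y"
      by (rule iint_FTC) (use \<psi> \<psi>' y in \<open>auto simp: has_real_derivative_iff_has_vector_derivative\<close>)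
    finally show "(LINT x|?M. F (x, y)) = (\<psi> L - \<psi> y) *\<^sub>R J y" .
  qed
  also have "\<dots> = \<psi> L *\<^sub>R (LINT x|?M. J x) - (LINT x|?M. \<psi> x *\<^sub>R J x)"
    unfolding scaleR_diff_left using J \<psi>i by simp
  finally show ?thesis .
qed

subsection \<open>Weak derivatives\<close>

lemma test_function_has_derivative:
  assumes "\<psi> \<in> test_functions L"
  shows "(\<psi> has_real_derivative deriv \<psi> x) (at x)"
proof -
  have "(deriv ^^ 0) \<psi> differentiable (at x)"
    using assms unfolding test_functions_def by blast
  then show ?thesis
    by (simp add: DERIV_deriv_iff_real_differentiable)
qed

lemma continuous_on_funpow_deriv_test_function:
  assumes "\<psi> \<in> test_functions L"
  shows "continuous_on S ((deriv ^^ n) \<psi>)"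
  using assms by (auto simp: test_functions_def
      intro!: continuous_at_imp_continuous_on differentiable_imp_continuous_within)

lemma test_function_eq_0: "\<psi> \<in> test_functions L \<Longrightarrow> x \<notin> {0<..<L} \<Longrightarrow> \<psi> x = 0"
  using closure_subset[of "{x. \<psi> x \<noteq> 0}"] unfolding test_functions_def by blast

lemma deriv_test_function:
  assumes "\<psi> \<in> test_functions L"
  shows "deriv \<psi> \<in> test_functions L"
proof -
  let ?C = "closure {x. \<psi> x \<noteq> 0}"
  have "deriv \<psi> x = 0" if "x \<notin> ?C" for x
  proof (rule DERIV_imp_deriv)
    show "(\<psi> has_real_derivative 0) (at x)"
      by (rule has_field_derivative_transform_within_open[of "\<lambda>_. 0" _ _ "- ?C"])
         (use that closure_subset[of "{x. \<psi> x \<noteq> 0}"] in auto)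
  qed
  then have "closure {x. deriv \<psi> x \<noteq> 0} \<subseteq> ?C"
    by (intro closure_minimal) auto
  moreover have "(deriv ^^ n) (deriv \<psi>) differentiable (at x)" for n x
  proof -
    have "(deriv ^^ Suc n) \<psi> differentiable (at x)"
      using assms unfolding test_functions_def by blast
    then show ?thesis by (simp add: funpow_swap1)
  qed
  ultimately show ?thesis
    using assms by (auto simp: test_functions_def)
qed

lemma continuous_imp_L2_space:
  fixes f :: "real \<Rightarrow> 'a::euclidean_space"
  assumes "continuous_on {0..L} f"
  shows "f \<in> L2_space L"
  unfolding L2_space_def
  by (auto intro!: integrable_continuous_leb_interval continuous_intros assms
      measurable_continuous_leb_interval intro: continuous_on_subset[OF assms])

lemma L2_space_diff:
  fixes f g :: "real \<Rightarrow> 'a::euclidean_space"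
  assumes "f \<in> L2_space L" "g \<in> L2_space L"
  shows "(\<lambda>x. f x - g x) \<in> L2_space L"
proof -
  let ?M = "leb_interval L"
  have m: "f \<in> borel_measurable ?M" "g \<in> borel_measurable ?M"
    using assms by (auto simp: L2_space_def)
  have "integrable ?M (\<lambda>x. (norm (f x - g x))\<^sup>2)"
  proof (rule Bochner_Integration.integrable_bound)
    show "integrable ?M (\<lambda>x. 2 * (norm (f x))\<^sup>2 + 2 * (norm (g x))\<^sup>2)"
      using assms by (simp add: L2_space_def)
    show "(\<lambda>x. (norm (f x - g x))\<^sup>2) \<in> borel_measurable ?M"
      using m by measurable
    have "(norm (f x - g x))\<^sup>2 \<le> 2 * (norm (f x))\<^sup>2 + 2 * (norm (g x))\<^sup>2" for x
    proof -
      have "(norm (f x - g x))\<^sup>2 \<le> (norm (f x) + norm (g x))\<^sup>2"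
        by (intro power_mono norm_triangle_ineq4) auto
      then show ?thesis
        using sum_squares_bound[of "norm (f x)" "norm (g x)"] by (simp add: power2_sum)
    qed
    then show "AE x in ?M. norm ((norm (f x - g x))\<^sup>2) \<le> norm (2 * (norm (f x))\<^sup>2 + 2 * (norm (g x))\<^sup>2)"
      by simp
  qed
  then show ?thesis
    using m by (simp add: L2_space_def)
qed

lemma has_weak_deriv_diff:
  fixes f f' g g' :: "real \<Rightarrow> 'a::euclidean_space"
  assumes "has_weak_deriv L n f g" "has_weak_deriv L n f' g'"
  shows "has_weak_deriv L n (\<lambda>x. f x - f' x) (\<lambda>x. g x - g' x)"
proof -
  let ?M = "leb_interval L"
  have L2: "f \<in> L2_space L" "f' \<in> L2_space L" "g \<in> L2_space L" "g' \<in> L2_space L"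
    using assms by (auto simp: has_weak_deriv_def)
  note i = L2[THEN L2_space_imp_integrable]
  have "(LINT x|?M. (deriv ^^ n) \<psi> x *\<^sub>R (f x - f' x)) = (-1) ^ n *\<^sub>R (LINT x|?M. \<psi> x *\<^sub>R (g x - g' x))"
    if \<psi>: "\<psi> \<in> test_functions L" for \<psi>
  proof -
    note c = continuous_on_funpow_deriv_test_function[OF \<psi>]
    show ?thesis
      using assms \<psi> integrable_continuous_scaleR[OF c i(1), of n] integrable_continuous_scaleR[OF c i(2), of n]
        integrable_continuous_scaleR[OF c i(3), of 0] integrable_continuous_scaleR[OF c i(4), of 0]
      by (simp add: has_weak_deriv_def scaleR_diff_right)
  qed
  then show ?thesis
    using L2 by (auto simp: has_weak_deriv_def intro: L2_space_diff)
qed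

section \<open>Window integrals and the primitive of a weak derivative\<close>

lemma integral_bump_tendsto_iint:
  fixes f :: "real \<Rightarrow> 'a::euclidean_space"
  assumes f: "integrable (leb_interval L) f"
  shows "(\<lambda>n. LINT x|leb_interval L. bump a b n x *\<^sub>R f x) \<longlonglongrightarrow> iint L a b f"
  unfolding iint_def
proof (rule integral_dominated_convergence[where w = "\<lambda>x. norm (f x)"])
  have "bump a b n \<in> borel_measurable (leb_interval L)" for n
    by (intro measurable_continuous_leb_interval continuous_on_bump)
  then show "(\<lambda>x. bump a b n x *\<^sub>R f x) \<in> borel_measurable (leb_interval L)" for n
    using f by simp
  show "(\<lambda>x. indicator {a<..b} x *\<^sub>R f x) \<in> borel_measurable (leb_interval L)"
    using integrable_indicator_leb_interval[OF f] by simp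
  show "AE x in leb_interval L. (\<lambda>n. bump a b n x *\<^sub>R f x) \<longlonglongrightarrow> indicator {a<..b} x *\<^sub>R f x"
    using AE_leb_interval_neq[of b L]
  proof eventually_elim
    case (elim x)
    then have "indicator {a<..b} x = indicat_real {a<..<b} x"
      by (auto simp: indicator_def)
    then show ?case
      using bump_tendsto_indicator[of a b x] by (auto intro: tendsto_scaleR)
  qed
  show "AE x in leb_interval L. norm (bump a b n x *\<^sub>R f x) \<le> norm (f x)" for n
    by (auto simp: bump_nonneg bump_le_1 mult_left_le_one_le)
qed (use f in simp)

text \<open>The weak derivative is tested with antiderivatives of bump differences, and n tends to
  infinity. There are two uses: g = 0 makes the window means of f agree, hence a continuous f
  constant; d = r bounds second differences by a second weak derivative. The strict bounds at 0 and
  L keep the supports inside the open interval.\<close>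

lemma weak_deriv_mean_difference:
  fixes f g :: "real \<Rightarrow> 'a::euclidean_space"
  assumes w: "has_weak_deriv L 1 f g" and "0 < a" "0 \<le> r" "0 \<le> d" "a + d + r < L"
  shows "norm (iint L a (a + r) f - iint L (a + d) (a + d + r) f)
    \<le> r * iint L a (a + d + r) (\<lambda>x. norm (g x))"
proof -
  let ?M = "leb_interval L"
  have f: "integrable ?M f" and g: "integrable ?M g"
    using w by (auto simp: has_weak_deriv_def intro: L2_space_imp_integrable)
  let ?k = "\<lambda>n x. bump a (a + r) n x - bump (a + d) (a + d + r) n x"
  have "norm (LINT x|?M. ?k n x *\<^sub>R f x) \<le> r * iint L a (a + d + r) (\<lambda>x. norm (g x))" for n
  proof -
    obtain \<psi> where \<psi>: "\<And>x. (\<psi> has_real_derivative ?k n x) (at x)"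
      "\<And>x. x \<notin> {a<..a + d + r} \<Longrightarrow> \<psi> x = 0" "\<And>x. \<bar>\<psi> x\<bar> \<le> r" "\<And>k. differentiable_times k \<psi>"
      using bump_difference_antiderivative[of r d a n] assms by blast
    have t: "\<psi> \<in> test_functions L"
      by (rule test_functionI[OF \<psi>(4), of a "a + d + r"]) (use assms in \<open>auto intro!: \<psi>(2)\<close>)
    have "deriv \<psi> = ?k n"
      using \<psi>(1) DERIV_imp_deriv by blast
    moreover have "(LINT x|?M. (deriv ^^ 1) \<psi> x *\<^sub>R f x) = (-1) ^ 1 *\<^sub>R (LINT x|?M. \<psi> x *\<^sub>R g x)"
      using w t unfolding has_weak_deriv_def by blast
    ultimately have "(LINT x|?M. ?k n x *\<^sub>R f x) = - (LINT x|?M. \<psi> x *\<^sub>R g x)"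
      by simp
    then have "norm (LINT x|?M. ?k n x *\<^sub>R f x) \<le> (LINT x|?M. norm (\<psi> x *\<^sub>R g x))"
      using integral_norm_bound[of ?M "\<lambda>x. \<psi> x *\<^sub>R g x"] by simp
    also have "\<dots> \<le> (LINT x|?M. r * (indicator {a<..a + d + r} x *\<^sub>R norm (g x)))"
    proof (rule integral_mono_AE')
      show "integrable ?M (\<lambda>x. r * (indicator {a<..a + d + r} x *\<^sub>R norm (g x)))"
        by (intro integrable_mult_right integrable_indicator_leb_interval integrable_norm g impI) auto
      show "AE x in ?M. norm (\<psi> x *\<^sub>R g x) \<le> r * (indicator {a<..a + d + r} x *\<^sub>R norm (g x))"
        using \<psi>(2,3) by (auto simp: indicator_def intro!: AE_I2 mult_right_mono)
    qed (use assms in auto)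
    also have "\<dots> = r * iint L a (a + d + r) (\<lambda>x. norm (g x))"
      unfolding iint_def by (rule integral_mult_right_zero)
    finally show ?thesis .
  qed
  moreover have "(\<lambda>n. LINT x|?M. ?k n x *\<^sub>R f x) \<longlonglongrightarrow> iint L a (a + r) f - iint L (a + d) (a + d + r) f"
  proof -
    have "(LINT x|?M. ?k n x *\<^sub>R f x) = (LINT x|?M. bump a (a + r) n x *\<^sub>R f x) - (LINT x|?M. bump (a + d) (a + d + r) n x *\<^sub>R f x)" for n
      unfolding scaleR_diff_left
      by (intro Bochner_Integration.integral_diff integrable_continuous_scaleR continuous_on_bump f)
    then show ?thesis
      by (simp only:) (intro tendsto_diff integral_bump_tendsto_iint f)
  qed
  ultimately show ?thesis
    by (intro Lim_norm_ubound[OF trivial_limit_sequentially]) auto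
qed

lemma norm_primitive_diff_le:
  fixes g :: "real \<Rightarrow> 'a::euclidean_space"
  assumes g: "g \<in> L2_space L" and "x \<in> {0..L}" "y \<in> {0..L}"
  shows "norm (iint L 0 y g - iint L 0 x g) \<le> sqrt \<bar>y - x\<bar> * L2_norm L g"
proof -
  have *: "norm (iint L 0 y g - iint L 0 x g) \<le> sqrt \<bar>y - x\<bar> * L2_norm L g"
    if "0 \<le> x" "x \<le> y" "y \<le> L" for x y
    using iint_add[OF L2_space_imp_integrable[OF g], of 0 x y] iint_norm_le_L2_norm[OF g, of x y]
      norm_iint_le[of L x y g] that by simp
  show ?thesis
    using *[of x y] *[of y x] assms by (cases "x \<le> y") (auto simp: norm_minus_commute abs_minus_commute)
qed

lemma continuous_on_primitive:
  fixes g :: "real \<Rightarrow> 'a::euclidean_space"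
  assumes g: "g \<in> L2_space L"
  shows "continuous_on {0..L} (\<lambda>x. iint L 0 x g)"
  unfolding continuous_on_def
proof
  fix x assume x: "x \<in> {0..L}"
  have 1: "((\<lambda>y. sqrt \<bar>y - x\<bar> * L2_norm L g) \<longlongrightarrow> sqrt \<bar>x - x\<bar> * L2_norm L g) (at x within {0..L})"
    by (intro tendsto_intros)
  have 2: "\<forall>\<^sub>F y in at x within {0..L}. norm (iint L 0 y g - iint L 0 x g) \<le> sqrt \<bar>y - x\<bar> * L2_norm L g"
    unfolding eventually_at_filter by (intro always_eventually allI impI norm_primitive_diff_le[OF g x])
  have "((\<lambda>y. iint L 0 y g - iint L 0 x g) \<longlongrightarrow> 0) (at x within {0..L})"
    by (rule Lim_null_comparison[OF 2]) (use 1 in simp)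
  then show "((\<lambda>y. iint L 0 y g) \<longlongrightarrow> iint L 0 x g) (at x within {0..L})"
    by (rule LIM_zero_cancel)
qed

lemma has_weak_deriv_primitive:
  fixes g :: "real \<Rightarrow> 'a::euclidean_space"
  assumes "0 \<le> L" and g: "g \<in> L2_space L"
  shows "has_weak_deriv L 1 (\<lambda>x. iint L 0 x g) g"
  unfolding has_weak_deriv_def
proof (intro conjI ballI g)
  show "(\<lambda>x. iint L 0 x g) \<in> L2_space L"
    by (intro continuous_imp_L2_space continuous_on_primitive g)
  fix \<psi> assume \<psi>: "\<psi> \<in> test_functions L"
  have "(LINT x|leb_interval L. deriv \<psi> x *\<^sub>R iint L 0 x g)
    = \<psi> L *\<^sub>R (LINT x|leb_interval L. g x) - (LINT x|leb_interval L. \<psi> x *\<^sub>R g x)"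
    by (rule integral_primitive_by_parts[OF assms(1) L2_space_imp_integrable[OF g]])
       (use continuous_on_funpow_deriv_test_function[OF \<psi>, of "{0..L}" 1]
         test_function_has_derivative[OF \<psi>] in \<open>auto intro: has_field_derivative_at_within\<close>)
  then show "(LINT x|leb_interval L. (deriv ^^ 1) \<psi> x *\<^sub>R iint L 0 x g) =
      (- 1) ^ 1 *\<^sub>R (LINT x|leb_interval L. \<psi> x *\<^sub>R g x)"
    using test_function_eq_0[OF \<psi>, of L] by simp
qed

text \<open>The du Bois-Reymond argument: f minus the primitive of g has weak derivative 0, so its
  integrals over windows of equal length agree. Continuity turns this into equality of values, at
  the endpoints by closure.\<close>

lemma weak_deriv_fundamental_theorem:
  fixes f g :: "real \<Rightarrow> 'a::euclidean_space"
  assumes w: "has_weak_deriv L 1 f g" and f: "continuous_on {0..L} f" and xy: "0 \<le> x" "x \<le> y" "y \<le> L"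
  shows "f y - f x = iint L x y g"
proof (cases "0 < L")
  case False
  then have "x = y" using xy by simp
  then show ?thesis by (simp add: iint_def)
next
  case True
  let ?M = "leb_interval L"
  have g: "g \<in> L2_space L" using w by (simp add: has_weak_deriv_def)
  define F where "F x = f x - iint L 0 x g" for x
  have F: "continuous_on {0..L} F"
    unfolding F_def by (intro continuous_intros f continuous_on_primitive g)
  have wF: "has_weak_deriv L 1 F (\<lambda>x. 0)"
    using has_weak_deriv_diff[OF w has_weak_deriv_primitive[OF _ g]] True by (simp add: F_def[abs_def])
  \<comment> \<open>Over a window on which F varies by at most e, the integral determines
    \<open>r *\<^sub>R F x\<close> up to e * r.\<close>
  have near: "norm (iint L x (x + r) F - r *\<^sub>R F x) \<le> e * r"
    if "0 < x" "0 \<le> r" "x + r < L" "\<And>z. z \<in> {x..x + r} \<Longrightarrow> norm (F z - F x) \<le> e" for x r e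
  proof -
    have "iint L x (x + r) F - r *\<^sub>R F x = iint L x (x + r) (\<lambda>z. F z - F x)"
      using that by (subst iint_diff) (auto intro!: integrable_continuous_leb_interval F simp: iint_const)
    also have "norm \<dots> \<le> iint L x (x + r) (\<lambda>z. norm (F z - F x))"
      by (rule norm_iint_le)
    also have "\<dots> \<le> iint L x (x + r) (\<lambda>z. e)"
      unfolding iint_def
      by (intro integral_mono_AE integrable_indicator_leb_interval integrable_continuous_leb_interval
          continuous_intros F AE_I2) (auto simp: indicator_def that(4))
    also have "\<dots> = e * r"
      using that by (simp add: iint_const mult.commute)
    finally show ?thesis .
  qed
  have eq: "F x = F y" if that': "0 < x" "x < y" "y < L" for x y
  proof (rule ccontr)
    assume "F x \<noteq> F y"
    define e where "e = norm (F x - F y) / 3"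
    have e: "e > 0" using \<open>F x \<noteq> F y\<close> by (simp add: e_def)
    obtain d1 where d1: "d1 > 0" "\<And>z. z \<in> {0..L} \<Longrightarrow> \<bar>z - x\<bar> < d1 \<Longrightarrow> norm (F z - F x) < e"
      using F[unfolded continuous_on_iff dist_norm real_norm_def, rule_format, of x e] e that' by auto
    obtain d2 where d2: "d2 > 0" "\<And>z. z \<in> {0..L} \<Longrightarrow> \<bar>z - y\<bar> < d2 \<Longrightarrow> norm (F z - F y) < e"
      using F[unfolded continuous_on_iff dist_norm real_norm_def, rule_format, of y e] e that' by auto
    \<comment> \<open>Short enough for both windows to stay within the continuity radii and left of
      L. Since e is a third of the distance of the two values, two errors e cannot bridge
      it.\<close>
    define r where "r = min (min d1 d2) (L - y) / 2"
    have r: "0 < r" "r < d1" "r < d2" "y + r < L"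
      using d1 d2 that by (auto simp: r_def min_def field_simps)
    have "norm (iint L x (x + r) F - iint L (x + (y - x)) (x + (y - x) + r) F) \<le> r * iint L x (x + (y - x) + r) (\<lambda>x. norm (0::'a))"
      by (rule weak_deriv_mean_difference[OF wF]) (use that r in auto)
    then have "iint L x (x + r) F = iint L y (y + r) F"
      by (simp add: iint_def)
    moreover have "norm (iint L x (x + r) F - r *\<^sub>R F x) \<le> e * r"
      by (rule near) (use that r in \<open>auto intro!: less_imp_le d1(2)\<close>)
    moreover have "norm (iint L y (y + r) F - r *\<^sub>R F y) \<le> e * r"
      by (rule near) (use that r in \<open>auto intro!: less_imp_le d2(2)\<close>)
    ultimately have "norm (r *\<^sub>R F x - r *\<^sub>R F y) \<le> e * r + e * r"
      by (metis dist_norm dist_triangle_le dist_commute add.commute add_mono)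
    then have "r * norm (F x - F y) \<le> r * (2 * e)"
      using r by (simp add: scaleR_diff_right[symmetric] mult_ac)
    then show False
      using r e by (simp add: e_def)
  qed
  have const: "F z = F (L / 2)" if "z \<in> {0..L}" for z
  proof (rule continuous_constant_on_closure[of "{0<..<L}" F])
    show "continuous_on (closure {0<..<L}) F" using F True by simp
    show "F z = F (L / 2)" if "z \<in> {0<..<L}" for z
      using eq[of z "L / 2"] eq[of "L / 2" z] that by (cases "z = L / 2") force+
  qed (use that True in auto)
  have "F x = F y" using xy by (intro trans[OF const const[symmetric]]) auto
  then have "f y - f x = iint L 0 y g - iint L 0 x g"
    by (simp add: F_def algebra_simps)
  then show ?thesis
    using iint_add[OF L2_space_imp_integrable[OF g], of 0 x y] xy by simp
qed

text \<open>The fundamental lemma of the calculus of variations; it makes the arbitrary choice in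
  \<open>weak_deriv\<close> harmless. Bumps give integral 0 over intervals, a Dynkin system argument
  extends this to Borel sets and negligible sets to Lebesgue sets; a function whose integral over
  every measurable set is 0 vanishes almost everywhere.\<close>

lemma AE_eq_of_integral_test_functions:
  fixes f g :: "real \<Rightarrow> 'a::euclidean_space"
  assumes f: "integrable (leb_interval L) f" and g: "integrable (leb_interval L) g"
    and eq: "\<And>\<psi>. \<psi> \<in> test_functions L \<Longrightarrow>
      (LINT x|leb_interval L. \<psi> x *\<^sub>R f x) = (LINT x|leb_interval L. \<psi> x *\<^sub>R g x)"
  shows "AE x in leb_interval L. f x = g x"
proof -
  let ?M = "leb_interval L"
  interpret finite_measure ?M by (rule finite_measure_leb_interval)
  define d where "d x = f x - g x" for x
  have d: "integrable ?M d"
    unfolding d_def using f g by simp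
  have inner_interval: "iint L a b d = 0" if "0 < a" "b < L" for a b
  proof -
    have "(LINT x|?M. bump a b n x *\<^sub>R d x) = 0" for n
      using eq[OF bump_test_function[OF that]] unfolding d_def scaleR_diff_right
      by (subst Bochner_Integration.integral_diff) (auto intro!: integrable_continuous_scaleR continuous_on_bump f g)
    then show ?thesis
      using integral_bump_tendsto_iint[OF d, of a b] by (simp add: LIMSEQ_const_iff)
  qed
  have interval: "(LINT x|?M. indicator {a<..<b} x *\<^sub>R d x) = 0" for a b
  proof -
    \<comment> \<open>Bumps are test functions only on intervals strictly inside (0, L), so an
      arbitrary interval is exhausted by such ones from within.\<close>
    define p q where "p n = max a 0 + 1 / real (Suc n)" and "q n = min b L - 1 / real (Suc n)" for n
    have "(\<lambda>n. iint L (p n) (q n) d) \<longlonglongrightarrow> (LINT x|?M. indicator {a<..<b} x *\<^sub>R d x)"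
      unfolding iint_def
    proof (rule integral_dominated_convergence[where w = "\<lambda>x. norm (d x)"])
      show "AE x in ?M. (\<lambda>n. indicator {p n<..q n} x *\<^sub>R d x) \<longlonglongrightarrow> indicator {a<..<b} x *\<^sub>R d x"
      proof (rule AE_I2)
        fix x assume "x \<in> space ?M"
        then have x: "0 < x" "x < L" by (auto simp: space_restrict_space)
        show "(\<lambda>n. indicator {p n<..q n} x *\<^sub>R d x) \<longlonglongrightarrow> indicator {a<..<b} x *\<^sub>R d x"
        proof (cases "x \<in> {a<..<b}")
          case True
          have "(\<lambda>n. 1 / real (Suc n)) \<longlonglongrightarrow> 0"
            using LIMSEQ_inverse_real_of_nat by (simp only: inverse_eq_divide)
          then have "p \<longlonglongrightarrow> max a 0 + 0" "q \<longlonglongrightarrow> min b L - 0"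
            unfolding p_def q_def by (intro tendsto_add tendsto_diff tendsto_const; assumption)+
          then have "eventually (\<lambda>n. p n < x) sequentially" "eventually (\<lambda>n. x < q n) sequentially"
            using True x by (auto dest: order_tendstoD)
          then have "eventually (\<lambda>n. indicator {a<..<b} x *\<^sub>R d x = indicator {p n<..q n} x *\<^sub>R d x) sequentially"
            by eventually_elim (use True in auto)
          then show ?thesis
            by (rule Lim_transform_eventually[OF tendsto_const])
        next
          case False
          have "x \<notin> {p n<..q n}" for n
          proof -
            have "0 < 1 / real (Suc n)" by simp
            then have "p n > a" "q n < b" unfolding p_def q_def by linarith+
            then show ?thesis using False by auto
          qed
          then show ?thesis using False by simp
        qed
      qed
      show "(\<lambda>x. indicator {a<..<b} x *\<^sub>R d x) \<in> borel_measurable ?M"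
        "(\<lambda>x. indicator {p n<..q n} x *\<^sub>R d x) \<in> borel_measurable ?M" for n
        by (intro borel_measurable_integrable integrable_indicator_leb_interval d; simp)+
    qed (use d in \<open>auto simp: indicator_def\<close>)
    moreover have "iint L (p n) (q n) d = 0" for n
    proof (rule inner_interval)
      have "0 < 1 / real (Suc n)" by simp
      then show "0 < p n" "q n < L" unfolding p_def q_def by linarith+
    qed
    ultimately show ?thesis by (simp add: LIMSEQ_const_iff)
  qed
  have total: "(LINT x|?M. d x) = 0"
    using interval[of 0 L] by (subst Bochner_Integration.integral_cong[OF refl, of _ _ "\<lambda>x. indicator {0<..<L} x *\<^sub>R d x"])
      (auto simp: space_restrict_space)
  have borel: "(borel :: real measure) = sigma UNIV (range (\<lambda>(a, b). {a<..<b}))"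
    unfolding borel_eq_box by (intro arg_cong2[where f = sigma] image_cong refl) auto
  have Int_stable: "Int_stable (range (\<lambda>(a, b). {a<..<b::real}))"
    by (auto simp: Int_stable_def)
  have zero: "(LINT x|?M. indicator A x *\<^sub>R d x) = 0" if A: "A \<in> sets borel" for A
  proof -
    have sub: "range (\<lambda>(a, b). {a<..<b::real}) \<subseteq> Pow UNIV" by auto
    have "A \<in> sigma_sets UNIV (range (\<lambda>(a, b). {a<..<b::real}))"
      using A by (simp add: borel sets_measure_of)
    from Int_stable sub this show ?thesis
    proof (induction rule: sigma_sets_induct_disjoint)
      case (basic A)
      then show ?case using interval by auto
    next
      case (compl A)
      then have A: "A \<in> sets borel"
        by (simp add: borel sets_measure_of)
      have "(LINT x|?M. indicator (UNIV - A) x *\<^sub>R d x) = (LINT x|?M. d x - indicator A x *\<^sub>R d x)"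
        by (intro Bochner_Integration.integral_cong) (auto simp: indicator_def)
      then show ?case
        using compl.IH total d integrable_indicator_leb_interval[OF d A] by simp
    next
      case (union A)
      then have A: "A i \<in> sets borel" for i
        by (auto simp: borel sets_measure_of)
      have "(\<lambda>n. LINT x|?M. indicator (\<Union>i<n. A i) x *\<^sub>R d x) \<longlonglongrightarrow> (LINT x|?M. indicator (\<Union>i. A i) x *\<^sub>R d x)"
      proof (rule integral_dominated_convergence[where w = "\<lambda>x. norm (d x)"])
        show "AE x in ?M. (\<lambda>n. indicator (\<Union>i<n. A i) x *\<^sub>R d x) \<longlonglongrightarrow> indicator (\<Union>i. A i) x *\<^sub>R d x"
          by (intro AE_I2 tendsto_scaleR tendsto_const LIMSEQ_indicator_UN)
        show "(\<lambda>x. indicator (\<Union>i<n. A i) x *\<^sub>R d x) \<in> borel_measurable ?M" for n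
          by (intro borel_measurable_integrable integrable_indicator_leb_interval d sets.finite_UN A) auto
        show "(\<lambda>x. indicator (\<Union>i. A i) x *\<^sub>R d x) \<in> borel_measurable ?M"
          by (intro borel_measurable_integrable integrable_indicator_leb_interval d sets.countable_UN) (use A in auto)
      qed (use d in \<open>auto simp: indicator_def\<close>)
      moreover have "(LINT x|?M. indicator (\<Union>i<n. A i) x *\<^sub>R d x) = 0" for n
      proof (induction n)
        case (Suc n)
        have "A n \<inter> A i = {}" if "i < n" for i
          using union(1) that by (intro disjoint_family_onD[of A UNIV]) auto
        then have "A n \<inter> (\<Union>i<n. A i) = {}"
          by blast
        then have "(LINT x|?M. indicator (\<Union>i<Suc n. A i) x *\<^sub>R d x) =
            (LINT x|?M. indicator (A n) x *\<^sub>R d x + indicator (\<Union>i<n. A i) x *\<^sub>R d x)"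
          by (intro Bochner_Integration.integral_cong) (auto simp: lessThan_Suc indicator_def)
        also have "\<dots> = 0"
          using Suc union(3) A
          by (subst Bochner_Integration.integral_add)
             (auto intro!: integrable_indicator_leb_interval d sets.finite_UN)
        finally show ?case .
      qed simp
      ultimately show ?case by (simp add: LIMSEQ_const_iff)
    qed auto
  qed
  have "set_lebesgue_integral ?M A d = 0" if "A \<in> sets ?M" for A
  proof -
    have A: "A \<in> sets lebesgue"
      using that by (simp add: sets_restrict_space_iff)
    \<comment> \<open>The measurable sets here are Lebesgue sets, whereas the induction reaches only
      Borel sets; the gap is negligible.\<close>
    obtain B N where BN: "B \<in> sets borel" "negligible N" "B \<union> N = A"
      using sets_lebesgue_almost_borel[OF A] .
    have "AE x in lebesgue. x \<notin> N"
      using BN(2) by (intro AE_not_in) (simp add: negligible_iff_null_sets)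
    then have N: "AE x in ?M. x \<notin> N"
      by (subst AE_restrict_space_iff) auto
    have "set_lebesgue_integral ?M A d = (LINT x|?M. indicator B x *\<^sub>R d x)"
      unfolding set_lebesgue_integral_def
    proof (rule integral_cong_AE)
      show "AE x in ?M. indicator A x *\<^sub>R d x = indicator B x *\<^sub>R d x"
        using N by eventually_elim (use BN(3) in \<open>auto simp: indicator_def\<close>)
      show "(\<lambda>x. indicator A x *\<^sub>R d x) \<in> borel_measurable ?M"
        using that d by (intro borel_measurable_scaleR borel_measurable_indicator) auto
      show "(\<lambda>x. indicator B x *\<^sub>R d x) \<in> borel_measurable ?M"
        by (intro borel_measurable_integrable integrable_indicator_leb_interval d BN)
    qed
    then show ?thesis using zero[OF BN(1)] by simp
  qed
  from density_zero[OF d this] show ?thesis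
    by (simp add: d_def)
qed

subsection \<open>Second differences and continuous differentiability\<close>

text \<open>Convergence of quotients along a single sequence of steps gives no direct hold on other
  steps. Averages do: with P' = u, the functions (P(x + r k) - P(x)) / r k have these quotients as
  derivatives and tend to u, so the theorem on uniformly convergent derivatives applies.\<close>

lemma difference_quotient_uniform_limit_has_vector_derivative:
  fixes u :: "real \<Rightarrow> 'a::euclidean_space"
  assumes u: "continuous_on UNIV u" and r: "\<And>k. r k > 0" "r \<longlonglongrightarrow> 0"
    and lim: "uniform_limit {a..b} (\<lambda>k x. (u (x + r k) - u x) /\<^sub>R r k) v sequentially"
    and x: "x \<in> {a..b}"
  shows "(u has_vector_derivative v x) (at x within {a..b})"
proof -
  obtain P where P: "\<And>x. (P has_vector_derivative u x) (at x)"
  proof -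
    have "\<exists>F. \<forall>x::real. - \<infinity> < ereal x \<longrightarrow> ereal x < \<infinity> \<longrightarrow> (F has_vector_derivative u x) (at x)"
      by (rule einterval_antiderivative) (use u in \<open>auto simp: continuous_on_eq_continuous_at\<close>)
    then show ?thesis using that by auto
  qed
  define U where "U k x = (P (x + r k) - P x) /\<^sub>R r k" for k x
  have dU: "(U k has_vector_derivative (u (x + r k) - u x) /\<^sub>R r k) (at x within {a..b})" for k x
  proof -
    have "((\<lambda>x. P (x + r k)) has_vector_derivative u (x + r k)) (at x)"
    proof -
      have "((\<lambda>x. x + r k) has_vector_derivative 1) (at x)"
        by (auto intro!: derivative_eq_intros)
      from vector_diff_chain_at[OF this P] show ?thesis by (simp add: o_def)
    qed
    from bounded_linear.has_vector_derivative[OF bounded_linear_scaleR_right has_vector_derivative_diff[OF this P],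
        of "inverse (r k)"]
    have "(U k has_vector_derivative (u (x + r k) - u x) /\<^sub>R r k) (at x)"
      by (simp only: U_def[abs_def])
    then show ?thesis by (rule has_vector_derivative_at_within)
  qed
  have U: "(\<lambda>k. U k x) \<longlonglongrightarrow> u x" for x
  proof -
    have "((\<lambda>y. norm ((P y - P x) - (y - x) *\<^sub>R u x) / norm (y - x)) \<longlongrightarrow> 0) (at x)"
      using P[of x] unfolding has_vector_derivative_def has_derivative_iff_norm by simp
    moreover have "filterlim (\<lambda>k. x + r k) (at x) sequentially"
    proof -
      have "(\<lambda>k. x + r k) \<longlonglongrightarrow> x + 0"
        by (intro tendsto_intros r)
      then show ?thesis
        using r(1) by (auto simp: filterlim_at eventually_sequentially less_imp_neq[symmetric])
    qed
    ultimately have "(\<lambda>k. norm ((P (x + r k) - P x) - (x + r k - x) *\<^sub>R u x) / norm (x + r k - x)) \<longlonglongrightarrow> 0"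
      by (rule filterlim_compose)
    moreover have "norm ((P (x + r k) - P x) - (x + r k - x) *\<^sub>R u x) / norm (x + r k - x) = norm (U k x - u x)" for k
    proof -
      have "U k x - u x = (1 / r k) *\<^sub>R ((P (x + r k) - P x) - (x + r k - x) *\<^sub>R u x)"
        using r(1)[of k] by (simp add: U_def scaleR_diff_right divide_inverse)
      then show ?thesis
        using r(1)[of k] by (simp only: norm_scaleR) simp
    qed
    ultimately have "(\<lambda>k. norm (U k x - u x)) \<longlonglongrightarrow> 0" by simp
    then show ?thesis
      by (rule LIM_zero_cancel[OF tendsto_norm_zero_cancel])
  qed
  have "\<exists>g. \<forall>x\<in>{a..b}. (\<lambda>k. U k x) \<longlonglongrightarrow> g x \<and> (g has_derivative (\<lambda>h. h *\<^sub>R v x)) (at x within {a..b})"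
  proof (rule has_derivative_sequence[where f' = "\<lambda>k x h. h *\<^sub>R ((u (x + r k) - u x) /\<^sub>R r k)"])
    show "(U k has_derivative (\<lambda>h. h *\<^sub>R ((u (x + r k) - u x) /\<^sub>R r k))) (at x within {a..b})" for k x
      using dU[of k x] by (simp only: has_vector_derivative_def)
    show "\<forall>\<^sub>F k in sequentially. \<forall>x\<in>{a..b}. \<forall>h. norm (h *\<^sub>R ((u (x + r k) - u x) /\<^sub>R r k) - h *\<^sub>R v x) \<le> e * norm h"
      if "e > 0" for e
      using uniform_limitD[OF lim that]
    proof eventually_elim
      case (elim k)
      show ?case
      proof (intro ballI allI)
        fix x h assume "x \<in> {a..b}"
        then have "norm ((u (x + r k) - u x) /\<^sub>R r k - v x) \<le> e"
          using elim by (auto simp: dist_norm intro: less_imp_le)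
        then show "norm (h *\<^sub>R ((u (x + r k) - u x) /\<^sub>R r k) - h *\<^sub>R v x) \<le> e * norm h"
          unfolding scaleR_diff_right[symmetric] norm_scaleR
          by (subst mult.commute) (auto intro: mult_right_mono)
      qed
    qed
  qed (use x U in auto)
  then obtain g where g: "\<And>x. x \<in> {a..b} \<Longrightarrow> (\<lambda>k. U k x) \<longlonglongrightarrow> g x"
    "\<And>x. x \<in> {a..b} \<Longrightarrow> (g has_derivative (\<lambda>h. h *\<^sub>R v x)) (at x within {a..b})" by blast
  have "g y = u y" if "y \<in> {a..b}" for y
    using LIMSEQ_unique[OF g(1)[OF that] U] .
  then have "(u has_derivative (\<lambda>h. h *\<^sub>R v x)) (at x within {a..b})"
    using has_derivative_transform[OF x _ g(2)[OF x]] by auto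
  then show ?thesis by (simp add: has_vector_derivative_def)
qed

text \<open>Consecutive dyadic quotients differ by a second difference divided by twice the smaller
  step, hence by a constant times the k-th power of \<open>2 powr (- \<gamma>)\<close>; the
  geometric series gives uniform convergence and the explicit bound. The quotients look to the
  right, so the derivative is obtained only up to b while u is controlled up to b + R.\<close>

lemma second_difference_C1_right:
  fixes u :: "real \<Rightarrow> 'a::euclidean_space"
  assumes u: "continuous_on {a..b + R} u" and ab: "a < b" and R: "0 < R" and \<gamma>: "0 < \<gamma>" and M: "0 \<le> M"
    and sd: "\<And>x r. a < x \<Longrightarrow> 0 < r \<Longrightarrow> x + 2 * r < b + R \<Longrightarrow>
      norm (u (x + 2 * r) - 2 *\<^sub>R u (x + r) + u x) \<le> M * r powr (1 + \<gamma>)"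
  obtains v where "continuous_on {a..b} v"
    "\<And>x. x \<in> {a..b} \<Longrightarrow> (u has_vector_derivative v x) (at x within {a..b})"
    "\<And>x. x \<in> {a..b} \<Longrightarrow> norm (v x - (u (x + R) - u x) /\<^sub>R R) \<le> M * R powr \<gamma> / (1 - 2 powr (- \<gamma>))"
proof -
  \<comment> \<open>Clamping the argument extends u continuously to the whole line, as the lemma on
    difference quotients requires. For x in {a..b} no quotient sees the extension, since r k \<le>
    R.\<close>
  define w where "w x = u (max a (min (b + R) x))" for x
  have wu: "w x = u x" if "x \<in> {a..b + R}" for x
    using that by (auto simp: w_def max_def min_def)
  have w: "continuous_on UNIV w"
    unfolding w_def
    by (rule continuous_on_compose2[OF u]) (use ab R in \<open>auto intro!: continuous_intros\<close>)
  define r where "r k = R / 2 ^ k" for k :: nat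
  have r: "r k > 0" "r k \<le> R" "r k = 2 * r (Suc k)" for k
    using R by (auto simp: r_def field_simps)
  have r0: "r \<longlonglongrightarrow> 0"
    unfolding r_def using tendsto_mult[OF tendsto_const[of R] LIMSEQ_inverse_realpow_zero[of 2]]
    by (simp add: divide_inverse)
  define D where "D k x = (w (x + r k) - w x) /\<^sub>R r k" for k x
  define q where "q = 2 powr (- \<gamma>)"
  have q: "0 < q" "q < 1"
    using \<gamma> by (auto simp: q_def powr_less_one)
  have cD: "continuous_on S (D k)" for k S
    unfolding D_def
    by (intro continuous_intros continuous_on_compose2[OF w] subset_UNIV continuous_on_subset[OF w])
  have step: "norm (D (Suc k) x - D k x) \<le> M * R powr \<gamma> * q ^ k" if x: "x \<in> {a..b}" for k x
  \<comment> \<open>The second differences are bounded only for base points strictly inside;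
    continuity of the quotients carries the estimate to the endpoints.\<close>
  proof (rule continuous_on_closure_norm_le[of "{a<..<b}"])
    show "continuous_on (closure {a<..<b}) (\<lambda>x. D (Suc k) x - D k x)"
      by (intro continuous_intros cD)
    show "x \<in> closure {a<..<b}" using x ab by simp
    show "\<forall>y\<in>{a<..<b}. norm (D (Suc k) y - D k y) \<le> M * R powr \<gamma> * q ^ k"
    proof
      fix y assume y: "y \<in> {a<..<b}"
      define s where "s = r (Suc k)"
      have s: "s > 0" "r k = 2 * s" "y + 2 * s < b + R"
        using r(1)[of "Suc k"] r(2)[of k] r(3)[of k] y by (auto simp: s_def)
      have "D (Suc k) y - D k y = - ((1 / (2 * s)) *\<^sub>R (u (y + 2 * s) - 2 *\<^sub>R u (y + s) + u y))"
        using s y by (simp add: D_def s_def[symmetric] wu scaleR_diff_right scaleR_add_right scaleR_left_distrib[symmetric] field_simps algebra_simps)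
      then have "norm (D (Suc k) y - D k y) = (1 / (2 * s)) * norm (u (y + 2 * s) - 2 *\<^sub>R u (y + s) + u y)"
        using s by simp
      also have "\<dots> \<le> (1 / (2 * s)) * (M * s powr (1 + \<gamma>))"
        using s y by (intro mult_left_mono sd) auto
      also have "\<dots> = M / 2 * s powr \<gamma>"
        using s by (simp add: powr_add)
      also have "s powr \<gamma> = R powr \<gamma> * q ^ Suc k"
      proof -
        have "q ^ Suc k = (2 ^ Suc k) powr (- \<gamma>)"
          by (simp add: q_def powr_realpow[symmetric] powr_powr mult.commute del: power_Suc of_nat_Suc)
        then show ?thesis
          using R by (simp add: s_def r_def powr_divide powr_minus_divide del: power_Suc)
      qed
      also have "M / 2 * (R powr \<gamma> * q ^ Suc k) = M * R powr \<gamma> * q ^ k * (q / 2)"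
        by simp
      also have "\<dots> \<le> M * R powr \<gamma> * q ^ k"
        using q M by (intro mult_right_le_one_le) auto
      finally show "norm (D (Suc k) y - D k y) \<le> M * R powr \<gamma> * q ^ k" .
    qed
  qed
  have sm: "summable (\<lambda>k. M * R powr \<gamma> * q ^ k)"
    using q by (intro summable_mult summable_geometric) auto
  define v where "v x = D 0 x + (\<Sum>k. D (Suc k) x - D k x)" for x
  have "uniform_limit {a..b} (\<lambda>n x. \<Sum>k<n. D (Suc k) x - D k x) (\<lambda>x. \<Sum>k. D (Suc k) x - D k x) sequentially"
    by (rule Weierstrass_m_test[OF step sm])
  then have "uniform_limit {a..b} (\<lambda>n x. D 0 x + (\<Sum>k<n. D (Suc k) x - D k x)) v sequentially"
    unfolding v_def by (intro uniform_limit_add uniform_limit_const)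
  then have lim: "uniform_limit {a..b} D v sequentially"
    by (simp add: sum_lessThan_telescope[of "\<lambda>k. D k x" for x])
  have cv: "continuous_on {a..b} v"
    by (rule uniform_limit_theorem[OF _ lim]) (simp_all add: cD)
  show thesis
  proof (rule that[OF cv])
    fix x assume x: "x \<in> {a..b}"
    have "(w has_vector_derivative v x) (at x within {a..b})"
      by (rule difference_quotient_uniform_limit_has_vector_derivative[OF w r(1) r0 _ x])
         (use lim in \<open>simp add: D_def[abs_def]\<close>)
    then show "(u has_vector_derivative v x) (at x within {a..b})"
      by (rule has_vector_derivative_transform[OF x, rotated]) (use R in \<open>auto simp: wu\<close>)
    have "norm (\<Sum>k. D (Suc k) x - D k x) \<le> (\<Sum>k. M * R powr \<gamma> * q ^ k)"
      by (rule norm_suminf_le[OF step[OF x] sm])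
    also have "\<dots> = M * R powr \<gamma> / (1 - q)"
      using q by (subst suminf_mult) (auto simp: suminf_geometric)
    finally show "norm (v x - (u (x + R) - u x) /\<^sub>R R) \<le> M * R powr \<gamma> / (1 - 2 powr (- \<gamma>))"
      using x R by (simp add: v_def D_def r_def wu q_def)
  qed
qed

text \<open>Right quotients with first step L / 4 serve [0, 3L/4], and the same for the reflected
  function u(L - x) serves [L/4, L]. The norm bound adds the size of the first quotient and the sum
  of the geometric series.\<close>

lemma second_difference_C1:
  fixes u :: "real \<Rightarrow> 'a::euclidean_space"
  assumes L: "0 < L" and u: "continuous_on {0..L} u" and \<gamma>: "0 < \<gamma>" and M: "0 \<le> M"
    and sd: "\<And>x r. 0 < x \<Longrightarrow> 0 < r \<Longrightarrow> x + 2 * r < L \<Longrightarrow>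
      norm (u (x + 2 * r) - 2 *\<^sub>R u (x + r) + u x) \<le> M * r powr (1 + \<gamma>)"
    and B: "\<And>x. x \<in> {0..L} \<Longrightarrow> norm (u x) \<le> B"
  obtains v where "continuous_on {0..L} v"
    "\<And>x. x \<in> {0..L} \<Longrightarrow> (u has_vector_derivative v x) (at x within {0..L})"
    "\<And>x. x \<in> {0..L} \<Longrightarrow> norm (v x) \<le> 8 / L * B + M * (L / 4) powr \<gamma> / (1 - 2 powr (- \<gamma>))"
proof -
  let ?K = "M * (L / 4) powr \<gamma> / (1 - 2 powr (- \<gamma>))"
  have L4: "3 * L / 4 + L / 4 = L" by simp
  \<comment> \<open>The constant 8 / L: two values of norm at most B are subtracted and divided by L
    / 4.\<close>
  have quot: "norm ((u x - u y) /\<^sub>R (L / 4)) \<le> 8 / L * B" if "x \<in> {0..L}" "y \<in> {0..L}" for x y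
  proof -
    have "norm (u x - u y) \<le> B + B"
      using norm_triangle_ineq4[of "u x" "u y"] B[OF that(1)] B[OF that(2)] by linarith
    then have "4 / L * norm (u x - u y) \<le> 4 / L * (B + B)"
      using L by (intro mult_left_mono) auto
    then show ?thesis using L by (simp add: inverse_eq_divide)
  qed
  obtain v1 where v1: "continuous_on {0..3 * L / 4} v1"
    "\<And>x. x \<in> {0..3 * L / 4} \<Longrightarrow> (u has_vector_derivative v1 x) (at x within {0..3 * L / 4})"
    "\<And>x. x \<in> {0..3 * L / 4} \<Longrightarrow> norm (v1 x - (u (x + L / 4) - u x) /\<^sub>R (L / 4)) \<le> ?K"
    using second_difference_C1_right[of 0 "3 * L / 4" "L / 4" u \<gamma> M] L u \<gamma> M sd unfolding L4 by auto
  have u': "continuous_on {0..L} (\<lambda>x. u (L - x))"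
    by (rule continuous_on_compose2[OF u]) (auto intro!: continuous_intros)
  have sd': "norm (u (L - (x + 2 * r)) - 2 *\<^sub>R u (L - (x + r)) + u (L - x)) \<le> M * r powr (1 + \<gamma>)"
    if "0 < x" "0 < r" "x + 2 * r < L" for x r
    using sd[of "L - x - 2 * r" r] that by (simp add: algebra_simps)
  obtain v2 where v2: "continuous_on {0..3 * L / 4} v2"
    "\<And>x. x \<in> {0..3 * L / 4} \<Longrightarrow> ((\<lambda>x. u (L - x)) has_vector_derivative v2 x) (at x within {0..3 * L / 4})"
    "\<And>x. x \<in> {0..3 * L / 4} \<Longrightarrow> norm (v2 x - (u (L - (x + L / 4)) - u (L - x)) /\<^sub>R (L / 4)) \<le> ?K"
    using second_difference_C1_right[of 0 "3 * L / 4" "L / 4" "\<lambda>x. u (L - x)" \<gamma> M] L u' \<gamma> M sd' unfolding L4 by auto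
  have d1: "(u has_vector_derivative v1 x) (at x within {0..L})" if x: "0 \<le> x" "x < 3 * L / 4" for x
  proof -
    have "at x within {0..L} = at x within {0..3 * L / 4}"
      by (rule at_within_nhd[of _ "{..<3 * L / 4}"]) (use x L in auto)
    then show ?thesis using v1(2)[of x] x by simp
  qed
  have d2: "(u has_vector_derivative - v2 (L - x)) (at x within {0..L})" if x: "L / 4 < x" "x \<le> L" for x
  proof -
    have "at x within {0..L} = at x within {L / 4..L}"
      by (rule at_within_nhd[of _ "{L / 4<..}"]) (use x L in auto)
    moreover have "((\<lambda>x. u (L - x)) \<circ> (\<lambda>x. L - x) has_vector_derivative (- 1) *\<^sub>R v2 (L - x)) (at x within {L / 4..L})"
    proof (rule vector_diff_chain_within)
      show "((\<lambda>x. L - x) has_vector_derivative - 1) (at x within {L / 4..L})"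
        by (auto intro!: derivative_eq_intros)
      show "((\<lambda>x. u (L - x)) has_vector_derivative v2 (L - x)) (at (L - x) within (\<lambda>x. L - x) ` {L / 4..L})"
      proof (rule has_vector_derivative_within_subset)
        show "((\<lambda>x. u (L - x)) has_vector_derivative v2 (L - x)) (at (L - x) within {0..3 * L / 4})"
          by (rule v2(2)) (use x in auto)
        show "(\<lambda>x. L - x) ` {L / 4..L} \<subseteq> {0..3 * L / 4}" by auto
      qed
    qed
    ultimately show ?thesis by (simp add: o_def)
  qed
  \<comment> \<open>With the derivative relative to the whole closed interval as v, the two pieces
    agree on their overlap by uniqueness of derivatives.\<close>
  define v where "v x = vector_derivative u (at x within {0..L})" for x
  have eq1: "v x = v1 x" if "0 \<le> x" "x < 3 * L / 4" for x
    unfolding v_def using d1[OF that] that L by (intro vector_derivative_within_closed_interval) auto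
  have eq2: "v x = - v2 (L - x)" if "L / 4 < x" "x \<le> L" for x
    unfolding v_def using d2[OF that] that L by (intro vector_derivative_within_closed_interval) auto
  have c1: "continuous_on {0..L / 2} v"
    using continuous_on_subset[OF v1(1), of "{0..L / 2}"] L
    by (subst continuous_on_cong[OF refl eq1]) auto
  have "continuous_on {L / 2..L} (\<lambda>x. - v2 (L - x))"
    by (intro continuous_intros continuous_on_compose2[OF v2(1)]) (use L in auto)
  then have c2: "continuous_on {L / 2..L} v"
    using L by (subst continuous_on_cong[OF refl eq2]) auto
  have "continuous_on ({0..L / 2} \<union> {L / 2..L}) v"
    by (rule continuous_on_closed_Un) (use c1 c2 in auto)
  moreover have "{0..L / 2} \<union> {L / 2..L} = {0..L}" using L by auto
  ultimately have cv: "continuous_on {0..L} v" by simp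
  show thesis
  proof (rule that[OF cv])
    fix x assume x: "x \<in> {0..L}"
    show "(u has_vector_derivative v x) (at x within {0..L})"
      using d1[of x] d2[of x] eq1[of x] eq2[of x] x L by (cases "x < 3 * L / 4") auto
    show "norm (v x) \<le> 8 / L * B + ?K"
    proof (cases "x < 3 * L / 4")
      case True
      then show ?thesis
        using norm_triangle_sub[of "v x" "(u (x + L / 4) - u x) /\<^sub>R (L / 4)"] quot[of "x + L / 4" x] v1(3)[of x] eq1[of x] x L
        by simp
    next
      case False
      let ?y = "L - x"
      have "norm (v x) = norm (v2 ?y)" using eq2[of x] False x L by simp
      then show ?thesis
        using norm_triangle_sub[of "v2 ?y" "(u (L - (?y + L / 4)) - u (L - ?y)) /\<^sub>R (L / 4)"]
          quot[of "L - (?y + L / 4)" "L - ?y"] v2(3)[of ?y] x L False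
        by simp
    qed
  qed
qed

subsection \<open>The Sobolev embedding\<close>

text \<open>The integral of g(a) - g(b) over the product of two adjacent windows of length r is r
  times the difference of the window integrals. Cauchy--Schwarz contributes the root of the measure
  of the product, again r, which cancels. Since |a - b| \<le> 2 r there, the squared difference is
  at most the kernel times (2 r) to the power 1 + 2 \<theta>.\<close>

lemma slobodeckij_mean_difference:
  fixes g :: "real \<Rightarrow> 'a::euclidean_space"
  assumes g: "g \<in> L2_space L" and \<theta>: "0 < \<theta>"
    and ker: "integrable (leb_interval L \<Otimes>\<^sub>M leb_interval L) (slobodeckij_kernel \<theta> g)"
    and x: "0 \<le> x" "0 < r" "x + 2 * r \<le> L"
  shows "(norm (iint L (x + r) (x + 2 * r) g - iint L x (x + r) g))\<^sup>2
    \<le> (2 * r) powr (1 + 2 * \<theta>) * integral\<^sup>L (leb_interval L \<Otimes>\<^sub>M leb_interval L) (slobodeckij_kernel \<theta> g)"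
proof -
  let ?M = "leb_interval L" and ?S = "slobodeckij_kernel \<theta> g"
  let ?P = "?M \<Otimes>\<^sub>M ?M"
  interpret finite_measure ?M by (rule finite_measure_leb_interval)
  interpret P: pair_sigma_finite ?M ?M ..
  have finP: "finite_measure ?P"
    by (rule finite_measure_pair_measure) (rule finite_measure_leb_interval)+
  define I where "I = {x<..x + r} \<inter> {0<..<L}"
  define J where "J = {x + r<..x + 2 * r} \<inter> {0<..<L}"
  define A where "A = J \<times> I"
  define c where "c = (2 * r) powr (1 + 2 * \<theta>)"
  have IJ: "I \<in> sets ?M" "J \<in> sets ?M"
    unfolding I_def J_def by (auto intro!: sets_leb_interval_borel)
  then have A: "A \<in> sets ?P" by (simp add: A_def)
  have mI: "measure ?M I = r" "measure ?M J = r"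
  proof -
    have "measure ?M ({y<..y + r} \<inter> {0<..<L}) = r" if "0 \<le> y" "y + r \<le> L" for y
    proof -
      have "iint L y (y + r) (\<lambda>_. 1::real) = (LINT z|?M. indicator ({y<..y + r} \<inter> {0<..<L}) z)"
        unfolding iint_def
        by (intro Bochner_Integration.integral_cong) (auto simp: space_restrict_space indicator_def)
      also have "\<dots> = measure ?M ({y<..y + r} \<inter> {0<..<L})"
        by (simp add: Int_absorb2 space_restrict_space)
      finally show ?thesis
        using iint_const[of y "y + r" L "1::real"] that x by (simp add: order_less_le)
    qed
    note meas = this
    show "measure ?M I = r"
      unfolding I_def by (rule meas) (use x in auto)
    have "J = {x + r<..x + r + r} \<inter> {0<..<L}"
      unfolding J_def by (intro arg_cong2[where f = "(\<inter>)"] arg_cong2[where f = greaterThanAtMost]) auto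
    then show "measure ?M J = r"
      by (simp only:) (rule meas, use x in auto)
  qed
  have mA: "measure ?P A = r\<^sup>2"
    using IJ mI unfolding A_def
    by (simp add: measure_def emeasure_pair_measure_Times enn2real_mult power2_eq_square)
  have [measurable]: "g \<in> borel_measurable ?M"
    using g by (simp add: L2_space_def)
  define f where "f = (\<lambda>z. indicator A z *\<^sub>R (g (fst z) - g (snd z)))"
  have fm: "f \<in> borel_measurable ?P"
    unfolding f_def using A by measurable
  have bound: "(norm (f z))\<^sup>2 \<le> c * ?S z" for z
  proof (cases "z \<in> A")
    case True
    obtain a b where z: "z = (a, b)" by (cases z)
    have ab: "0 < \<bar>a - b\<bar>" "\<bar>a - b\<bar> \<le> 2 * r"
      using True x by (auto simp: z A_def I_def J_def)
    have "(norm (g a - g b))\<^sup>2 * \<bar>a - b\<bar> powr (1 + 2 * \<theta>) \<le> (norm (g a - g b))\<^sup>2 * c"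
      unfolding c_def using ab \<theta> by (intro mult_left_mono powr_mono2) auto
    then show ?thesis
      using True ab by (simp add: f_def slobodeckij_kernel_def z field_simps)
  next
    case False
    then show ?thesis by (auto simp: f_def slobodeckij_kernel_def c_def split: prod.split)
  qed
  have sq: "integrable ?P (\<lambda>z. (norm (f z))\<^sup>2)"
  proof (rule Bochner_Integration.integrable_bound)
    show "integrable ?P (\<lambda>z. c * ?S z)" using ker by simp
    show "AE z in ?P. norm ((norm (f z))\<^sup>2) \<le> norm (c * ?S z)"
      using bound by (intro AE_I2) (auto intro: order_trans[OF _ abs_ge_self])
  qed (use fm in measurable)
  have const: "integrable ?M (\<lambda>b. indicat_real X b *\<^sub>R c)"
    "(LINT b|?M. indicat_real X b *\<^sub>R c) = measure ?M X *\<^sub>R c" if "X \<in> sets ?M" for X and c :: 'a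
  proof -
    have "integrable ?M (indicat_real X)"
      using that by (auto simp: less_top[symmetric] intro!: integrable_real_indicator)
    then show "integrable ?M (\<lambda>b. indicat_real X b *\<^sub>R c)"
      "(LINT b|?M. indicat_real X b *\<^sub>R c) = measure ?M X *\<^sub>R c"
      using Int_absorb2[OF sets.sets_into_space[OF that]] by simp_all
  qed
  note CS = integral_norm_indicator_le[OF finP fm sq A]
  have gi: "integrable ?M g" by (rule L2_space_imp_integrable[OF g])
  have iI: "(LINT z|?M. indicator I z *\<^sub>R g z) = iint L x (x + r) g"
    and iJ: "(LINT z|?M. indicator J z *\<^sub>R g z) = iint L (x + r) (x + 2 * r) g"
    unfolding iint_def I_def J_def
    by (auto intro!: Bochner_Integration.integral_cong simp: space_restrict_space indicator_def)
  have gI: "integrable ?M (\<lambda>z. indicator I z *\<^sub>R g z)" "integrable ?M (\<lambda>z. indicator J z *\<^sub>R g z)"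
    using integrable_mult_indicator[OF _ gi] IJ by auto
  have "integral\<^sup>L ?P f = (LINT a|?M. LINT b|?M. f (a, b))"
    using P.integral_fst'[OF CS(1)] by simp
  also have "\<dots> = (LINT a|?M. indicator J a *\<^sub>R (r *\<^sub>R g a - iint L x (x + r) g))"
  proof (rule Bochner_Integration.integral_cong[OF refl])
    fix a
    have "(LINT b|?M. f (a, b)) = (LINT b|?M. indicator J a *\<^sub>R (indicator I b *\<^sub>R g a - indicator I b *\<^sub>R g b))"
      by (intro Bochner_Integration.integral_cong) (auto simp: f_def A_def indicator_def)
    also have "\<dots> = indicator J a *\<^sub>R (r *\<^sub>R g a - iint L x (x + r) g)"
      using gI const[OF IJ(1), of "g a"] mI iI
      by (simp only: integral_scaleR_right Bochner_Integration.integral_diff)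
    finally show "(LINT b|?M. f (a, b)) = indicator J a *\<^sub>R (r *\<^sub>R g a - iint L x (x + r) g)" .
  qed
  also have "\<dots> = (LINT a|?M. r *\<^sub>R (indicator J a *\<^sub>R g a) - indicator J a *\<^sub>R iint L x (x + r) g)"
    by (intro Bochner_Integration.integral_cong) (auto simp: indicator_def)
  also have "\<dots> = r *\<^sub>R iint L (x + r) (x + 2 * r) g - r *\<^sub>R iint L x (x + r) g"
    using integrable_scaleR_right[OF gI(2), of r] const[OF IJ(2), of "iint L x (x + r) g"] mI iJ
    by (simp only: Bochner_Integration.integral_diff integral_scaleR_right)
  finally have fint: "integral\<^sup>L ?P f = r *\<^sub>R (iint L (x + r) (x + 2 * r) g - iint L x (x + r) g)"
    by (simp add: scaleR_diff_right)
  have "norm (integral\<^sup>L ?P f) \<le> (LINT z|?P. norm (f z))"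
    by (rule integral_norm_bound)
  also have "\<dots> = (LINT z|?P. indicator A z * norm (f z))"
    by (intro Bochner_Integration.integral_cong) (auto simp: f_def indicator_def)
  also have "\<dots> \<le> sqrt (measure ?P A * (LINT z|?P. indicator A z * (norm (f z))\<^sup>2))"
    by (rule CS(2))
  also have "\<dots> \<le> sqrt (r\<^sup>2 * (c * integral\<^sup>L ?P ?S))"
  proof (intro real_sqrt_le_mono mult_mono)
    have "(LINT z|?P. indicator A z * (norm (f z))\<^sup>2) = (LINT z|?P. (norm (f z))\<^sup>2)"
      by (intro Bochner_Integration.integral_cong) (auto simp: f_def indicator_def)
    also have "\<dots> \<le> (LINT z|?P. c * ?S z)"
      using bound sq ker by (intro integral_mono) auto
    finally show "(LINT z|?P. indicator A z * (norm (f z))\<^sup>2) \<le> c * integral\<^sup>L ?P ?S" by simp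
  qed (auto simp: mA intro!: integral_nonneg_AE)
  also have "\<dots> = r * sqrt (c * integral\<^sup>L ?P ?S)"
    using x by (simp add: real_sqrt_mult)
  finally have "norm (iint L (x + r) (x + 2 * r) g - iint L x (x + r) g) \<le> sqrt (c * integral\<^sup>L ?P ?S)"
    using x by (simp add: fint)
  moreover have "0 \<le> c * integral\<^sup>L ?P ?S"
    by (auto simp: c_def slobodeckij_kernel_def intro!: mult_nonneg_nonneg integral_nonneg_AE split: prod.split)
  ultimately show ?thesis
    unfolding c_def by (metis norm_ge_zero power_mono real_sqrt_pow2)
qed

section \<open>Weak derivatives up to null sets and bounds by the Sobolev norm\<close>

lemma weak_deriv_has_weak_deriv:
  "\<exists>g. has_weak_deriv L n f g \<Longrightarrow> has_weak_deriv L n f (weak_deriv L n f)"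
  unfolding weak_deriv_def by (rule someI_ex[of "has_weak_deriv L n f"])

lemma has_weak_deriv_unique_AE:
  fixes f :: "real \<Rightarrow> 'a::euclidean_space"
  assumes "has_weak_deriv L n f g" "has_weak_deriv L n f g'"
  shows "AE x in leb_interval L. g x = g' x"
proof (rule AE_eq_of_integral_test_functions)
  show "integrable (leb_interval L) g" "integrable (leb_interval L) g'"
    using assms by (auto simp: has_weak_deriv_def intro: L2_space_imp_integrable)
  fix \<psi> assume "\<psi> \<in> test_functions L"
  then have "(-1) ^ n *\<^sub>R (LINT x|leb_interval L. \<psi> x *\<^sub>R g x) = (-1) ^ n *\<^sub>R (LINT x|leb_interval L. \<psi> x *\<^sub>R g' x)"
    using assms unfolding has_weak_deriv_def by simp
  then show "(LINT x|leb_interval L. \<psi> x *\<^sub>R g x) = (LINT x|leb_interval L. \<psi> x *\<^sub>R g' x)"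
    by (simp only: scaleR_cancel_left) simp
qed

text \<open>The chosen \<open>weak_deriv\<close> of a difference is the difference of the chosen
  weak derivatives only almost everywhere, so the kernels are compared almost everywhere on the
  product. This allows the embedding to be applied to u s - u t.\<close>

lemma sobolev_space_diff:
  fixes f f' :: "real \<Rightarrow> 'a::euclidean_space"
  assumes f: "f \<in> sobolev_space L s" and f': "f' \<in> sobolev_space L s"
  shows "(\<lambda>x. f x - f' x) \<in> sobolev_space L s"
proof -
  let ?k = "nat \<lfloor>s\<rfloor>" and ?M = "leb_interval L"
  let ?P = "?M \<Otimes>\<^sub>M ?M"
  let ?h = "\<lambda>x. f x - f' x"
  have ex: "\<exists>g. has_weak_deriv L n ?h g" if "n \<le> ?k" for n
  proof -
    obtain g g' where "has_weak_deriv L n f g" "has_weak_deriv L n f' g'"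
      using assms \<open>n \<le> ?k\<close> unfolding sobolev_space_def by blast
    then show ?thesis by (blast intro: has_weak_deriv_diff)
  qed
  have "integrable ?P (slobodeckij_kernel (frac s) (weak_deriv L ?k ?h))" if s: "frac s \<noteq> 0"
  proof -
    interpret finite_measure ?M by (rule finite_measure_leb_interval)
    interpret P: pair_sigma_finite ?M ?M ..
    define a b c where "a = weak_deriv L ?k f" and "b = weak_deriv L ?k f'" and "c = weak_deriv L ?k ?h"
    have w: "has_weak_deriv L ?k f a" "has_weak_deriv L ?k f' b" "has_weak_deriv L ?k ?h c"
      unfolding a_def b_def c_def using f f' ex
      by (auto simp: sobolev_space_def intro!: weak_deriv_has_weak_deriv)
    then have [measurable]: "a \<in> borel_measurable ?M" "b \<in> borel_measurable ?M" "c \<in> borel_measurable ?M"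
      by (auto simp: has_weak_deriv_def L2_space_def)
    have eq: "AE x in ?M. c x = a x - b x"
      by (rule has_weak_deriv_unique_AE[OF w(3) has_weak_deriv_diff[OF w(1,2)]])
    have "AE z in ?P. c (fst z) = a (fst z) - b (fst z) \<and> c (snd z) = a (snd z) - b (snd z)"
    proof (rule P.AE_pair_measure)
      show "{z \<in> space ?P. c (fst z) = a (fst z) - b (fst z) \<and> c (snd z) = a (snd z) - b (snd z)} \<in> sets ?P"
        by measurable
      show "AE x in ?M. AE y in ?M. c (fst (x, y)) = a (fst (x, y)) - b (fst (x, y)) \<and> c (snd (x, y)) = a (snd (x, y)) - b (snd (x, y))"
        using eq by (auto elim!: eventually_mono intro: eventually_mono[OF eq])
    qed
    then have le: "AE z in ?P. norm (slobodeckij_kernel (frac s) c z)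
        \<le> norm (2 * slobodeckij_kernel (frac s) a z + 2 * slobodeckij_kernel (frac s) b z)"
    proof eventually_elim
      case (elim z)
      obtain x y where z: "z = (x, y)" by (cases z)
      have "(norm ((a x - a y) - (b x - b y)))\<^sup>2 \<le> (norm (a x - a y) + norm (b x - b y))\<^sup>2"
        by (intro power_mono norm_triangle_ineq4) auto
      also have "\<dots> \<le> 2 * (norm (a x - a y))\<^sup>2 + 2 * (norm (b x - b y))\<^sup>2"
        using sum_squares_bound[of "norm (a x - a y)" "norm (b x - b y)"] by (simp add: power2_sum)
      finally have "(norm ((a x - a y) - (b x - b y)))\<^sup>2 / \<bar>x - y\<bar> powr (1 + 2 * frac s) \<le>
          (2 * (norm (a x - a y))\<^sup>2 + 2 * (norm (b x - b y))\<^sup>2) / \<bar>x - y\<bar> powr (1 + 2 * frac s)"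
        by (intro divide_right_mono) auto
      moreover have "c x - c y = (a x - a y) - (b x - b y)"
        using elim by (simp add: z)
      ultimately show ?case
        by (simp add: slobodeckij_kernel_def z add_divide_distrib)
    qed
    have "integrable ?P (slobodeckij_kernel (frac s) c)"
    proof (rule Bochner_Integration.integrable_bound[OF _ _ le])
      show "integrable ?P (\<lambda>z. 2 * slobodeckij_kernel (frac s) a z + 2 * slobodeckij_kernel (frac s) b z)"
        using f f' s by (auto simp: sobolev_space_def a_def b_def)
      have [measurable]: "(\<lambda>x. x) \<in> ?M \<rightarrow>\<^sub>M borel"
        by (rule borel_measurable_leb_intervalI) simp
      show "slobodeckij_kernel (frac s) c \<in> borel_measurable ?P"
        unfolding slobodeckij_kernel_def by measurable
    qed
    then show ?thesis by (simp add: c_def)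
  qed
  then show ?thesis
    using ex by (simp add: sobolev_space_def)
qed

lemma L2_norm_weak_deriv_le_sobolev_norm:
  assumes "n \<le> nat \<lfloor>s\<rfloor>"
  shows "L2_norm L (weak_deriv L n f) \<le> sobolev_norm L s f"
proof -
  have "(L2_norm L (weak_deriv L n f))\<^sup>2 \<le> (\<Sum>k\<le>nat \<lfloor>s\<rfloor>. (L2_norm L (weak_deriv L k f))\<^sup>2)"
    using assms by (intro member_le_sum) auto
  moreover have "0 \<le> integral\<^sup>L (leb_interval L \<Otimes>\<^sub>M leb_interval L) (slobodeckij_kernel (frac s) (weak_deriv L (nat \<lfloor>s\<rfloor>) f))"
    by (intro integral_nonneg_AE AE_I2) (auto simp: slobodeckij_kernel_def split: prod.split)
  ultimately show ?thesis
    unfolding sobolev_norm_def by (intro real_le_rsqrt) auto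
qed

lemma slobodeckij_le_sobolev_norm:
  assumes "frac s \<noteq> 0"
  shows "integral\<^sup>L (leb_interval L \<Otimes>\<^sub>M leb_interval L) (slobodeckij_kernel (frac s) (weak_deriv L (nat \<lfloor>s\<rfloor>) f))
    \<le> (sobolev_norm L s f)\<^sup>2"
proof -
  have "0 \<le> integral\<^sup>L (leb_interval L \<Otimes>\<^sub>M leb_interval L) (slobodeckij_kernel (frac s) (weak_deriv L (nat \<lfloor>s\<rfloor>) f))"
    by (intro integral_nonneg_AE AE_I2) (auto simp: slobodeckij_kernel_def split: prod.split)
  then show ?thesis
    unfolding sobolev_norm_def using assms
    by (subst real_sqrt_pow2) (auto intro!: add_nonneg_nonneg sum_nonneg)
qed

text \<open>With \<open>deriv \<psi>\<close> itself as test function, the pairing of \<psi>' with g1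
  becomes minus that of \<psi>'' with f.\<close>

lemma weak_deriv_iterate:
  fixes f :: "real \<Rightarrow> 'a::euclidean_space"
  assumes "has_weak_deriv L 1 f g1" "has_weak_deriv L 2 f g2"
  shows "has_weak_deriv L 1 g1 g2"
  unfolding has_weak_deriv_def
proof (intro conjI ballI)
  show "g1 \<in> L2_space L" "g2 \<in> L2_space L"
    using assms by (auto simp: has_weak_deriv_def)
  fix \<psi> assume \<psi>: "\<psi> \<in> test_functions L"
  have "(LINT x|leb_interval L. (deriv ^^ 1) (deriv \<psi>) x *\<^sub>R f x) = (-1) ^ 1 *\<^sub>R (LINT x|leb_interval L. deriv \<psi> x *\<^sub>R g1 x)"
    using assms(1) deriv_test_function[OF \<psi>] unfolding has_weak_deriv_def by blast
  moreover have "(LINT x|leb_interval L. (deriv ^^ 2) \<psi> x *\<^sub>R f x) = (-1) ^ 2 *\<^sub>R (LINT x|leb_interval L. \<psi> x *\<^sub>R g2 x)"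
    using assms(2) \<psi> unfolding has_weak_deriv_def by blast
  ultimately show "(LINT x|leb_interval L. (deriv ^^ 1) \<psi> x *\<^sub>R g1 x) = (-1) ^ 1 *\<^sub>R (LINT x|leb_interval L. \<psi> x *\<^sub>R g2 x)"
    by (simp add: numeral_2_eq_2) (metis minus_minus)
qed

text \<open>w(x) is the mean of w plus the mean over y of w(x) - w(y). The L2 norm of w bounds the
  former, that of its weak derivative the oscillation; these are the two summands of the
  constant.\<close>

lemma sobolev_sup_bound:
  fixes w :: "real \<Rightarrow> 'a::euclidean_space"
  assumes L: "0 < L" and s: "1 \<le> s" and w: "w \<in> sobolev_space L s" "continuous_on {0..L} w" and x: "x \<in> {0..L}"
  shows "norm (w x) \<le> (1 / sqrt L + sqrt L) * sobolev_norm L s w"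
proof -
  let ?N = "sobolev_norm L s w"
  have s1: "1 \<le> nat \<lfloor>s\<rfloor>" using s by linarith
  define g0 g1 where "g0 = weak_deriv L 0 w" and "g1 = weak_deriv L 1 w"
  have d: "has_weak_deriv L 0 w g0" "has_weak_deriv L 1 w g1"
    unfolding g0_def g1_def using w(1) s1 by (auto simp: sobolev_space_def intro!: weak_deriv_has_weak_deriv)
  then have L2: "g0 \<in> L2_space L" "g1 \<in> L2_space L"
    by (auto simp: has_weak_deriv_def)
  have N: "L2_norm L g0 \<le> ?N" "L2_norm L g1 \<le> ?N"
    unfolding g0_def g1_def using s1 by (auto intro!: L2_norm_weak_deriv_le_sobolev_norm)
  have osc: "norm (w y - w x) \<le> sqrt L * ?N" if "0 \<le> x" "x \<le> y" "y \<le> L" for x y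
  proof -
    have "norm (w y - w x) \<le> iint L x y (\<lambda>z. norm (g1 z))"
      unfolding weak_deriv_fundamental_theorem[OF d(2) w(2) that] by (rule norm_iint_le)
    also have "\<dots> \<le> sqrt (y - x) * L2_norm L g1"
      by (rule iint_norm_le_L2_norm[OF L2(2) that])
    also have "\<dots> \<le> sqrt L * ?N"
      using that N by (intro mult_mono real_sqrt_le_mono) (auto simp: L2_norm_nonneg)
    finally show ?thesis .
  qed
  have osc: "norm (w x - w y) \<le> sqrt L * ?N" if "y \<in> {0..L}" for y
    using osc[of x y] osc[of y x] x that by (cases "x \<le> y") (auto simp: norm_minus_commute)
  \<comment> \<open>Even order 0 goes through the choice: \<open>weak_deriv L 0 w\<close> is some
    function known to equal w only almost everywhere.\<close>
  have "has_weak_deriv L 0 w w"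
    using continuous_imp_L2_space[OF w(2)] by (simp add: has_weak_deriv_def)
  then have ae: "AE y in leb_interval L. w y = g0 y"
    using has_weak_deriv_unique_AE d(1) by blast
  have wi: "integrable (leb_interval L) w" by (rule integrable_continuous_leb_interval[OF w(2)])
  have eq: "iint L 0 L w = iint L 0 L g0"
    unfolding iint_def
    by (rule integral_cong_AE) (use ae wi L2_space_imp_integrable[OF L2(1)] in
        \<open>auto intro!: borel_measurable_integrable integrable_indicator_leb_interval elim: eventually_mono\<close>)
  have "norm (iint L 0 L w) \<le> sqrt (L - 0) * L2_norm L g0"
    unfolding eq by (rule order_trans[OF norm_iint_le iint_norm_le_L2_norm[OF L2(1)]]) (use L in auto)
  also have "\<dots> \<le> sqrt L * ?N" using N L by (intro mult_mono) (auto simp: L2_norm_nonneg)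
  finally have m: "norm (iint L 0 L w) \<le> sqrt L * ?N" .
  have "L *\<^sub>R w x = iint L 0 L w + iint L 0 L (\<lambda>y. w x - w y)"
    using L wi by (subst iint_diff) (auto simp: iint_const integrable_continuous_leb_interval)
  also have "norm \<dots> \<le> norm (iint L 0 L w) + iint L 0 L (\<lambda>y. norm (w x - w y))"
    by (intro norm_triangle_le add_left_mono norm_iint_le)
  also have "iint L 0 L (\<lambda>y. norm (w x - w y)) \<le> iint L 0 L (\<lambda>y. sqrt L * ?N)"
    unfolding iint_def
    by (intro integral_mono_AE integrable_indicator_leb_interval integrable_continuous_leb_interval
          continuous_intros w(2) AE_I2) (auto simp: indicator_def space_restrict_space intro!: osc)
  also have "\<dots> = L * (sqrt L * ?N)"
    using L by (simp add: iint_const)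
  finally have "L * norm (w x) \<le> sqrt L * ?N + L * (sqrt L * ?N)"
    using m L by simp
  then have "norm (w x) \<le> (sqrt L / L + sqrt L) * ?N"
    using L by (simp add: field_simps)
  also have "sqrt L / L = 1 / sqrt L"
    using L by (simp add: real_divide_square_eq field_simps)
  finally show ?thesis .
qed

text \<open>By the fundamental theorem this is a difference of integrals of the weak derivative over
  two adjacent windows. The root of the Slobodeckij estimate with \<theta> = 2 \<alpha> - 1 has
  exponent (1 + 2 \<theta>) / 2 = 2 \<alpha> - 1/2, written as 1 plus the \<gamma> of the
  convergence argument. The factor 4 absorbs a power of 2.\<close>

lemma sobolev_second_difference:
  fixes w :: "real \<Rightarrow> 'a::euclidean_space"
  assumes \<alpha>: "3 / 4 < \<alpha>" "\<alpha> \<le> 1" and w: "w \<in> sobolev_space L (2 * \<alpha>)" "continuous_on {0..L} w"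
    and x: "0 < x" "0 < r" "x + 2 * r < L"
  shows "norm (w (x + 2 * r) - 2 *\<^sub>R w (x + r) + w x)
    \<le> 4 * sobolev_norm L (2 * \<alpha>) w * r powr (1 + (2 * \<alpha> - 3 / 2))"
proof -
  let ?N = "sobolev_norm L (2 * \<alpha>) w"
  define g where "g = weak_deriv L 1 w"
  have g: "has_weak_deriv L 1 w g"
    unfolding g_def using w(1) \<alpha>
    by (intro weak_deriv_has_weak_deriv) (auto simp: sobolev_space_def le_nat_iff le_floor_iff)
  have L2: "g \<in> L2_space L" using g by (simp add: has_weak_deriv_def)
  have N: "0 \<le> ?N"
    by (rule order_trans[OF L2_norm_nonneg L2_norm_weak_deriv_le_sobolev_norm[of 0]]) simp
  have eq: "w (x + 2 * r) - 2 *\<^sub>R w (x + r) + w x = iint L (x + r) (x + 2 * r) g - iint L x (x + r) g"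
    using weak_deriv_fundamental_theorem[OF g w(2), of x "x + r"]
      weak_deriv_fundamental_theorem[OF g w(2), of "x + r" "x + 2 * r"] x
    by (simp add: scaleR_2 algebra_simps)
  have two: "2 powr p \<le> 4" if "p \<le> 2" for p :: real
    using powr_mono[OF that, of 2] by simp
  show ?thesis
  proof (cases "\<alpha> = 1")
    \<comment> \<open>For \<alpha> = 1 the fractional part of 2 \<alpha> is 0 and the norm has no
      Slobodeckij term; the second weak derivative yields the same exponent, 3/2.\<close>
    case True
    define g2 where "g2 = weak_deriv L 2 w"
    have g2: "has_weak_deriv L 2 w g2"
      unfolding g2_def using w(1) True
      by (intro weak_deriv_has_weak_deriv) (auto simp: sobolev_space_def)
    then have L22: "g2 \<in> L2_space L" by (simp add: has_weak_deriv_def)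
    have e: "x + r + r = x + 2 * r" by simp
    have "norm (iint L x (x + r) g - iint L (x + r) (x + 2 * r) g) \<le> r * iint L x (x + 2 * r) (\<lambda>x. norm (g2 x))"
      using weak_deriv_mean_difference[OF weak_deriv_iterate[OF g g2], of x r r] x unfolding e by simp
    also have "\<dots> \<le> r * (sqrt (x + 2 * r - x) * L2_norm L g2)"
      using x by (intro mult_left_mono iint_norm_le_L2_norm L22) auto
    also have "\<dots> \<le> r * (sqrt (2 * r) * ?N)"
      using x L2_norm_weak_deriv_le_sobolev_norm[of 2 "2 * \<alpha>" L w] True
      by (intro mult_left_mono) (auto simp: g2_def)
    also have "\<dots> = 2 powr (1 / 2) * ?N * r powr (1 + 1 / 2)"
    proof -
      have "r powr (1 + 1 / 2) = r * sqrt r"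
        by (subst powr_add) (use x in \<open>simp add: powr_half_sqrt\<close>)
      then show ?thesis
        using x by (simp only:) (simp add: powr_half_sqrt real_sqrt_mult)
    qed
    also have "\<dots> \<le> 4 * ?N * r powr (1 + 1 / 2)"
      using N by (intro mult_right_mono two) auto
    finally show ?thesis
      unfolding eq True by (subst norm_minus_commute) simp
  next
    case False
    have fl: "\<lfloor>2 * \<alpha>\<rfloor> = 1" using \<alpha> False by (intro floor_unique) auto
    then have fr: "frac (2 * \<alpha>) = 2 * \<alpha> - 1" by (simp add: frac_def)
    let ?\<theta> = "2 * \<alpha> - 1"
    let ?I = "integral\<^sup>L (leb_interval L \<Otimes>\<^sub>M leb_interval L) (slobodeckij_kernel ?\<theta> g)"
    have ker: "integrable (leb_interval L \<Otimes>\<^sub>M leb_interval L) (slobodeckij_kernel ?\<theta> g)"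
      using w(1) \<alpha> by (auto simp: sobolev_space_def fl fr g_def)
    have "(norm (iint L (x + r) (x + 2 * r) g - iint L x (x + r) g))\<^sup>2 \<le> (2 * r) powr (1 + 2 * ?\<theta>) * ?I"
      by (rule slobodeckij_mean_difference[OF L2 _ ker]) (use x \<alpha> in auto)
    also have "\<dots> \<le> (2 * r) powr (1 + 2 * ?\<theta>) * ?N\<^sup>2"
      using slobodeckij_le_sobolev_norm[of "2 * \<alpha>" L w] \<alpha>
      by (intro mult_left_mono) (auto simp: fl fr g_def)
    also have "\<dots> = ((2 * r) powr (1 + (2 * \<alpha> - 3 / 2)) * ?N)\<^sup>2"
      using x by (simp add: power_mult_distrib powr_power algebra_simps)
    finally have "norm (iint L (x + r) (x + 2 * r) g - iint L x (x + r) g) \<le> (2 * r) powr (1 + (2 * \<alpha> - 3 / 2)) * ?N"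
      by (rule power2_le_imp_le) (use N in auto)
    also have "\<dots> = 2 powr (1 + (2 * \<alpha> - 3 / 2)) * ?N * r powr (1 + (2 * \<alpha> - 3 / 2))"
      using x by (simp add: powr_mult)
    also have "\<dots> \<le> 4 * ?N * r powr (1 + (2 * \<alpha> - 3 / 2))"
      using N \<alpha> by (intro mult_right_mono two) auto
    finally show ?thesis unfolding eq .
  qed
qed

lemma sobolev_embedding_C1:
  fixes L \<alpha> :: real
  assumes L: "0 < L" and \<alpha>: "3 / 4 < \<alpha>" "\<alpha> \<le> 1"
  obtains C where "0 \<le> C"
    "\<And>w :: real \<Rightarrow> 'a::euclidean_space. w \<in> sobolev_space L (2 * \<alpha>) \<Longrightarrow> continuous_on {0..L} w \<Longrightarrow>
      \<exists>v. continuous_on {0..L} v \<and>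
        (\<forall>x\<in>{0..L}. (w has_vector_derivative v x) (at x within {0..L}) \<and>
          norm (w x) \<le> C * sobolev_norm L (2 * \<alpha>) w \<and> norm (v x) \<le> C * sobolev_norm L (2 * \<alpha>) w)"
proof -
  define \<gamma> where "\<gamma> = 2 * \<alpha> - 3 / 2"
  have \<gamma>: "0 < \<gamma>" using \<alpha> by (simp add: \<gamma>_def)
  define a where "a = 1 / sqrt L + sqrt L"
  \<comment> \<open>The bound of \<open>second_difference_C1\<close> for B equal to a times the norm
    and M equal to 4 times the norm, with the norm factored out; the constant thus depends only on L
    and \<alpha>.\<close>
  define b where "b = 8 / L * a + 4 * (L / 4) powr \<gamma> / (1 - 2 powr (- \<gamma>))"
  have "0 \<le> a" using L by (simp add: a_def)
  show thesis
  proof (rule that[of "max a b"])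
    show "0 \<le> max a b" using \<open>0 \<le> a\<close> by simp
    fix w :: "real \<Rightarrow> 'a" assume w: "w \<in> sobolev_space L (2 * \<alpha>)" "continuous_on {0..L} w"
    let ?N = "sobolev_norm L (2 * \<alpha>) w"
    have N: "0 \<le> ?N"
      by (rule order_trans[OF L2_norm_nonneg L2_norm_weak_deriv_le_sobolev_norm[of 0]]) simp
    have sup: "norm (w x) \<le> a * ?N" if "x \<in> {0..L}" for x
      unfolding a_def using \<alpha> by (intro sobolev_sup_bound[OF L _ w that]) auto
    obtain v where v: "continuous_on {0..L} v"
      "\<And>x. x \<in> {0..L} \<Longrightarrow> (w has_vector_derivative v x) (at x within {0..L})"
      "\<And>x. x \<in> {0..L} \<Longrightarrow> norm (v x) \<le> 8 / L * (a * ?N) + 4 * ?N * (L / 4) powr \<gamma> / (1 - 2 powr (- \<gamma>))"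
      using second_difference_C1[OF L w(2) \<gamma>, of "4 * ?N" "a * ?N"]
        sobolev_second_difference[OF \<alpha> w] N sup by (auto simp: \<gamma>_def)
    have "norm (v x) \<le> b * ?N" if "x \<in> {0..L}" for x
      using v(3)[OF that] by (simp add: b_def algebra_simps)
    then have "norm (w x) \<le> max a b * ?N" "norm (v x) \<le> max a b * ?N" if "x \<in> {0..L}" for x
      using sup[OF that] that N by (meson mult_right_mono max.cobounded1 max.cobounded2 order_trans)+
    then show "\<exists>v. continuous_on {0..L} v \<and>
        (\<forall>x\<in>{0..L}. (w has_vector_derivative v x) (at x within {0..L}) \<and>
          norm (w x) \<le> max a b * ?N \<and> norm (v x) \<le> max a b * ?N)"
      using v(1,2) by blast
  qed
qed

subsection \<open>Curves of states\<close>

text \<open>w is the slope in x. The embedding is applied to u s - u t, whose slope is w s - w t by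
  uniqueness of derivatives, so that convergence in the Sobolev norm becomes uniform convergence of
  values and slopes.\<close>

lemma sobolev_curve_C1:
  fixes u :: "real \<Rightarrow> real \<Rightarrow> real^3"
  assumes L: "0 < L" and \<alpha>: "3 / 4 < \<alpha>" "\<alpha> \<le> 1"
    and u: "\<And>t. t \<in> I \<Longrightarrow> u t \<in> sobolev_space_N L (2 * \<alpha>)"
    and curve: "continuous_curve (sobolev_norm L (2 * \<alpha>)) I u"
  obtains w where "\<And>t. t \<in> I \<Longrightarrow> continuous_on {0..L} (w t)"
    "\<And>t x. t \<in> I \<Longrightarrow> x \<in> {0..L} \<Longrightarrow> (u t has_vector_derivative w t x) (at x within {0..L})"
    "\<And>t. t \<in> I \<Longrightarrow> w t 0 = 0 \<and> w t L = 0"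
    "\<And>t. t \<in> I \<Longrightarrow> uniform_limit {0..L} u (u t) (at t within I)"
    "\<And>t. t \<in> I \<Longrightarrow> uniform_limit {0..L} w (w t) (at t within I)"
proof -
  obtain C where C: "0 \<le> C"
    "\<And>w :: real \<Rightarrow> real^3. w \<in> sobolev_space L (2 * \<alpha>) \<Longrightarrow> continuous_on {0..L} w \<Longrightarrow>
      \<exists>v. continuous_on {0..L} v \<and>
        (\<forall>x\<in>{0..L}. (w has_vector_derivative v x) (at x within {0..L}) \<and>
          norm (w x) \<le> C * sobolev_norm L (2 * \<alpha>) w \<and> norm (v x) \<le> C * sobolev_norm L (2 * \<alpha>) w)"
    using sobolev_embedding_C1[OF L \<alpha>] by metis
  define w where "w t x = vector_derivative (u t) (at x within {0..L})" for t x
  have wI: "w t x = v" if "(u t has_vector_derivative v) (at x within {0..L})" "x \<in> {0..L}" for t x v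
    unfolding w_def by (rule vector_derivative_within_closed_interval[OF L that(2,1)])
  have H: "u t \<in> sobolev_space L (2 * \<alpha>)" "continuous_on {0..L} (u t)" if "t \<in> I" for t
    using u[OF that] by (auto simp: sobolev_space_N_def)
  have d: "(u t has_vector_derivative w t x) (at x within {0..L})" if "t \<in> I" "x \<in> {0..L}" for t x
    using C(2)[OF H[OF that(1)]] wI that(2) by metis
  have close: "norm (u s x - u t x) \<le> C * sobolev_norm L (2 * \<alpha>) (\<lambda>x. u s x - u t x)"
    "norm (w s x - w t x) \<le> C * sobolev_norm L (2 * \<alpha>) (\<lambda>x. u s x - u t x)"
    if "s \<in> I" "t \<in> I" "x \<in> {0..L}" for s t x
  proof -
    have "continuous_on {0..L} (\<lambda>x. u s x - u t x)"
      using H that by (intro continuous_intros) auto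
    from C(2)[OF sobolev_space_diff[OF H(1) H(1)] this] that obtain v where v:
      "((\<lambda>x. u s x - u t x) has_vector_derivative v x) (at x within {0..L})"
      "norm (u s x - u t x) \<le> C * sobolev_norm L (2 * \<alpha>) (\<lambda>x. u s x - u t x)"
      "norm (v x) \<le> C * sobolev_norm L (2 * \<alpha>) (\<lambda>x. u s x - u t x)"
      by blast
    have "w s x - w t x = v x"
      using vector_derivative_within_closed_interval[OF L that(3) v(1)]
        vector_derivative_within_closed_interval[OF L that(3)
          has_vector_derivative_diff[OF d[OF that(1,3)] d[OF that(2,3)]]] by simp
    with v show "norm (u s x - u t x) \<le> C * sobolev_norm L (2 * \<alpha>) (\<lambda>x. u s x - u t x)"
      "norm (w s x - w t x) \<le> C * sobolev_norm L (2 * \<alpha>) (\<lambda>x. u s x - u t x)" by auto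
  qed
  have ev: "\<forall>\<^sub>F s in at t within I. s \<in> I \<and> C * sobolev_norm L (2 * \<alpha>) (\<lambda>x. u s x - u t x) < e"
    if "t \<in> I" "e > 0" for t e
  proof -
    have "((\<lambda>s. C * sobolev_norm L (2 * \<alpha>) (\<lambda>x. u s x - u t x)) \<longlongrightarrow> C * 0) (at t within I)"
      using curve that unfolding continuous_curve_def by (intro tendsto_mult tendsto_const) auto
    then have "\<forall>\<^sub>F s in at t within I. C * sobolev_norm L (2 * \<alpha>) (\<lambda>x. u s x - u t x) < e"
      using that by (auto dest: order_tendstoD(2))
    moreover have "\<forall>\<^sub>F s in at t within I. s \<in> I"
      by (simp add: eventually_at_filter)
    ultimately show ?thesis by eventually_elim auto
  qed
  show thesis
  proof (rule that[of w])
    fix t assume t: "t \<in> I"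
    obtain v where v: "continuous_on {0..L} v"
      "\<And>x. x \<in> {0..L} \<Longrightarrow> (u t has_vector_derivative v x) (at x within {0..L})"
      using C(2)[OF H[OF t]] by blast
    show "continuous_on {0..L} (w t)"
      using v wI by (subst continuous_on_cong[OF refl wI[OF v(2)]]) auto
    show "w t 0 = 0 \<and> w t L = 0"
      using u[OF t] L by (auto simp: sobolev_space_N_def intro!: wI)
    show "uniform_limit {0..L} u (u t) (at t within I)"
    proof (rule uniform_limitI)
      fix e :: real assume "e > 0"
      from ev[OF t this] show "\<forall>\<^sub>F s in at t within I. \<forall>x\<in>{0..L}. dist (u s x) (u t x) < e"
        by eventually_elim (use close(1) t in \<open>force simp: dist_norm\<close>)
    qed
    show "uniform_limit {0..L} w (w t) (at t within I)"
    proof (rule uniform_limitI)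
      fix e :: real assume "e > 0"
      from ev[OF t this] show "\<forall>\<^sub>F s in at t within I. \<forall>x\<in>{0..L}. dist (w s x) (w t x) < e"
        by eventually_elim (use close(2) t in \<open>force simp: dist_norm\<close>)
    qed
  qed (rule d)
qed

section \<open>Time limits and time derivatives of integral functionals\<close>

lemma uniform_limit_Pair:
  fixes f :: "'a \<Rightarrow> 'b \<Rightarrow> 'c::real_normed_vector" and g :: "'a \<Rightarrow> 'b \<Rightarrow> 'd::real_normed_vector"
  assumes f: "uniform_limit S f f' F" and g: "uniform_limit S g g' F"
  shows "uniform_limit S (\<lambda>s x. (f s x, g s x)) (\<lambda>x. (f' x, g' x)) F"
proof (rule uniform_limitI)
  fix e :: real assume "e > 0"
  then have e: "e / 2 > 0" by simp
  show "\<forall>\<^sub>F s in F. \<forall>x\<in>S. dist (f s x, g s x) (f' x, g' x) < e"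
    using uniform_limitD[OF f e] uniform_limitD[OF g e]
  proof eventually_elim
    case (elim s)
    show ?case
    proof
      fix x assume "x \<in> S"
      then have "norm (f s x - f' x) < e / 2" "norm (g s x - g' x) < e / 2"
        using elim by (auto simp: dist_norm)
      then show "dist (f s x, g s x) (f' x, g' x) < e"
        using norm_Pair_le[of "f s x - f' x" "g s x - g' x"] by (simp add: dist_norm)
    qed
  qed
qed

lemma integral_leb_interval_const: "0 \<le> L \<Longrightarrow> (LINT x|leb_interval L. (c :: real)) = c * L"
proof -
  have "(LINT x|leb_interval L. c) = iint L 0 L (\<lambda>x. c)"
    unfolding iint_def by (intro Bochner_Integration.integral_cong) (auto simp: space_restrict_space)
  then show "0 \<le> L \<Longrightarrow> (LINT x|leb_interval L. c) = c * L"
    by (simp add: iint_const)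
qed

text \<open>Q is continuous only on \<Omega>, so composition with it need not respect uniform
  convergence globally. The compact image of V has a compact neighbourhood inside \<Omega>; there Q
  is uniformly continuous, and U s eventually takes its values there.\<close>

lemma integral_composition_tendsto:
  fixes U :: "'i \<Rightarrow> real \<Rightarrow> 'a::euclidean_space" and Q :: "'a \<Rightarrow> real"
  assumes L: "0 < L" and Q: "continuous_on \<Omega> Q" and \<Omega>: "open \<Omega>"
    and lim: "uniform_limit {0..L} U V F"
    and cU: "\<forall>\<^sub>F s in F. continuous_on {0..L} (U s)" and cV: "continuous_on {0..L} V"
    and V: "\<And>x. x \<in> {0..L} \<Longrightarrow> V x \<in> \<Omega>"
  shows "((\<lambda>s. LINT x|leb_interval L. Q (U s x)) \<longlongrightarrow> (LINT x|leb_interval L. Q (V x))) F"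
proof -
  let ?K = "V ` {0..L}"
  have K: "compact ?K" "?K \<noteq> {}" "?K \<subseteq> \<Omega>"
    using L V by (auto intro: compact_continuous_image cV)
  obtain e where e: "e > 0" "{x. infdist x ?K \<le> e} \<subseteq> \<Omega>"
    using compact_in_open_separated[OF K(2,1) \<Omega> K(3)] .
  let ?B = "{x. infdist x ?K \<le> e}"
  have B: "compact ?B" by (rule compact_infdist_le[OF K(2,1) e(1)])
  have uQ: "uniformly_continuous_on ?B Q"
    by (intro compact_uniformly_continuous continuous_on_subset[OF Q] e B)
  have ev: "\<forall>\<^sub>F s in F. \<forall>x\<in>{0..L}. U s x \<in> ?B"
    using uniform_limitD[OF lim e(1)]
  proof eventually_elim
    case (elim s)
    show ?case
    proof
      fix x assume x: "x \<in> {0..L}"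
      have "infdist (U s x) ?K \<le> dist (U s x) (V x)"
        by (intro infdist_le) (use x in auto)
      then show "U s x \<in> ?B" using elim x by force
    qed
  qed
  have ul: "uniform_limit {0..L} (\<lambda>s x. Q (U s x)) (\<lambda>x. Q (V x)) F"
    by (rule uniform_limit_compose_uniformly_continuous_on[OF lim uQ ev]) (rule compact_imp_closed[OF B])
  have cQV: "continuous_on {0..L} (\<lambda>x. Q (V x))"
    by (rule continuous_on_compose2[OF Q cV]) (use V in auto)
  show ?thesis
  proof (rule tendstoI)
    fix d :: real assume d: "d > 0"
    then have "d / (2 * L) > 0" using L by simp
    from uniform_limitD[OF ul this] ev cU
    show "\<forall>\<^sub>F s in F. dist (LINT x|leb_interval L. Q (U s x)) (LINT x|leb_interval L. Q (V x)) < d"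
    proof eventually_elim
      case (elim s)
      have c: "continuous_on {0..L} (\<lambda>x. Q (U s x))"
        by (rule continuous_on_compose2[OF Q elim(3)]) (use elim(2) e(2) in auto)
      note i = integrable_continuous_leb_interval[OF c] integrable_continuous_leb_interval[OF cQV]
      have "dist (LINT x|leb_interval L. Q (U s x)) (LINT x|leb_interval L. Q (V x))
          = norm (LINT x|leb_interval L. Q (U s x) - Q (V x))"
        using i by (simp add: dist_norm)
      also have "\<dots> \<le> (LINT x|leb_interval L. norm (Q (U s x) - Q (V x)))"
        by (rule integral_norm_bound)
      also have "\<dots> \<le> (LINT x|leb_interval L. d / (2 * L))"
      proof (rule integral_mono)
        show "integrable (leb_interval L) (\<lambda>x. norm (Q (U s x) - Q (V x)))"
          using i by (intro integrable_norm Bochner_Integration.integrable_diff)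
        show "integrable (leb_interval L) (\<lambda>x. d / (2 * L))"
          by (intro integrable_continuous_leb_interval continuous_intros)
        show "norm (Q (U s x) - Q (V x)) \<le> d / (2 * L)" if "x \<in> space (leb_interval L)" for x
        proof -
          have "x \<in> {0..L}" using that by (simp add: space_restrict_space)
          then show ?thesis using elim(1) by (auto simp: dist_norm intro: less_imp_le)
        qed
      qed
      also have "\<dots> = d / (2 * L) * L" using L by (intro integral_leb_interval_const) simp
      also have "\<dots> < d" using L d by simp
      finally show ?case .
    qed
  qed
qed

lemma integral_norm_le_L2_norm:
  fixes f :: "real \<Rightarrow> 'a::euclidean_space"
  assumes "0 < L" "f \<in> L2_space L"
  shows "(LINT x|leb_interval L. norm (f x)) \<le> sqrt L * L2_norm L f"
proof -
  have "iint L 0 L (\<lambda>x. norm (f x)) = (LINT x|leb_interval L. norm (f x))"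
    unfolding iint_def by (intro Bochner_Integration.integral_cong) (auto simp: space_restrict_space)
  then show ?thesis
    using iint_norm_le_L2_norm[OF assms(2), of 0 L] assms(1) by simp
qed

text \<open>The time derivative exists only in the L2 sense, not pointwise in x. Divided by s - t,
  the quadratic remainder is at most C |s - t| times the square of the norm of the quotient, whose
  integral stays bounded; the linear part converges because F' (u t) is bounded on the
  interval.\<close>

lemma energy_has_derivative:
  fixes u v :: "real \<Rightarrow> real \<Rightarrow> 'a::euclidean_space" and F :: "'a \<Rightarrow> real" and F' :: "'a \<Rightarrow> 'a"
  assumes L: "0 < L" and F: "continuous_on \<Omega> F" and F': "continuous_on \<Omega> F'"
    and C1: "C1_curve_L2 L I u v" and I: "open I" and t: "t \<in> I"
    and u: "\<And>s. s \<in> I \<Longrightarrow> continuous_on {0..L} (u s)" "\<And>s x. s \<in> I \<Longrightarrow> x \<in> {0..L} \<Longrightarrow> u s x \<in> \<Omega>"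
    and rem: "\<forall>\<^sub>F s in at t. \<forall>x\<in>{0..L}.
      \<bar>F (u s x) - F (u t x) - F' (u t x) \<bullet> (u s x - u t x)\<bar> \<le> C * (norm (u s x - u t x))\<^sup>2"
    and C: "0 \<le> C"
  shows "((\<lambda>s. LINT x|leb_interval L. F (u s x)) has_real_derivative
    (LINT x|leb_interval L. F' (u t x) \<bullet> v t x)) (at t)"
proof -
  let ?M = "leb_interval L"
  define e where "e s x = (u s x - u t x) /\<^sub>R (s - t) - v t x" for s x
  define N where "N s = L2_norm L (e s)" for s
  define V where "V = L2_norm L (v t)"
  have vL2: "v t \<in> L2_space L" using C1 t by (auto simp: C1_curve_L2_def)
  have N0: "(N \<longlongrightarrow> 0) (at t)"
  proof -
    have "at t within I = at t" using I t by (rule at_within_open[rotated])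
    then show ?thesis
      using C1 t by (auto simp: C1_curve_L2_def N_def[abs_def] e_def[abs_def])
  qed
  have cu: "continuous_on {0..L} (\<lambda>x. F' (u t x))"
    by (rule continuous_on_compose2[OF F' u(1)[OF t]]) (use u(2) t in auto)
  have "bounded ((\<lambda>x. F' (u t x)) ` {0..L})"
    by (intro compact_imp_bounded compact_continuous_image cu) simp
  then obtain B where B: "\<And>x. x \<in> {0..L} \<Longrightarrow> norm (F' (u t x)) \<le> B"
    by (force simp: bounded_iff)
  have B0: "0 \<le> B" by (rule order_trans[OF norm_ge_zero B[of 0]]) (use L in auto)
  have mF': "(\<lambda>x. F' (u t x)) \<in> borel_measurable ?M"
    by (intro measurable_continuous_leb_interval continuous_on_subset[OF cu]) auto
  have inner_int: "integrable ?M (\<lambda>x. F' (u t x) \<bullet> f x)" if "f \<in> L2_space L" for f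
  proof (rule Bochner_Integration.integrable_bound)
    show "integrable ?M (\<lambda>x. B *\<^sub>R f x)"
      using L2_space_imp_integrable[OF that] by simp
    show "(\<lambda>x. F' (u t x) \<bullet> f x) \<in> borel_measurable ?M"
      using that by (intro borel_measurable_inner mF') (simp add: L2_space_def)
    show "AE x in ?M. norm (F' (u t x) \<bullet> f x) \<le> norm (B *\<^sub>R f x)"
      using B B0 by (intro AE_I2) (auto simp: space_restrict_space
          intro!: order_trans[OF Cauchy_Schwarz_ineq2] mult_right_mono)
  qed
  \<comment> \<open>Majorant of the error: the quadratic remainder, with the square of a sum
    estimated by twice the squares, plus the gradient paired with the L2 error e of the
    quotient.\<close>
  define Z where "Z s = C * \<bar>s - t\<bar> * (2 * (N s)\<^sup>2 + 2 * V\<^sup>2) + B * (sqrt L * N s)" for s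
  have Z: "(Z \<longlongrightarrow> 0) (at t)"
  proof -
    have "(Z \<longlongrightarrow> C * \<bar>t - t\<bar> * (2 * 0\<^sup>2 + 2 * V\<^sup>2) + B * (sqrt L * 0)) (at t)"
      unfolding Z_def by (intro tendsto_intros N0)
    then show ?thesis by simp
  qed
  have evI: "\<forall>\<^sub>F s in at t. s \<in> I \<and> s \<noteq> t"
    using I t by (auto simp: eventually_at_topological)
  have "\<forall>\<^sub>F s in at t. norm (((LINT x|?M. F (u s x)) - (LINT x|?M. F (u t x))) / (s - t)
      - (LINT x|?M. F' (u t x) \<bullet> v t x)) \<le> Z s"
    using evI rem
  proof eventually_elim
    case (elim s)
    then have s: "s \<in> I" "s - t \<noteq> 0" by auto
    have eL2: "e s \<in> L2_space L"
      unfolding e_def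
      by (intro L2_space_diff continuous_imp_L2_space vL2 continuous_intros u s t)
    have cF: "continuous_on {0..L} (\<lambda>x. F (u r x))" if "r \<in> I" for r
      by (rule continuous_on_compose2[OF F u(1)[OF that]]) (use u(2) that in auto)
    have i: "integrable ?M (\<lambda>x. F (u s x))" "integrable ?M (\<lambda>x. F (u t x))"
      using s t by (auto intro!: integrable_continuous_leb_interval cF)
    define R where "R x = (F (u s x) - F (u t x) - F' (u t x) \<bullet> (u s x - u t x)) / (s - t)" for x
    have Ri: "integrable ?M R"
      unfolding R_def using s t
      by (intro integrable_continuous_leb_interval continuous_intros cF cu u) auto
    have split: "(F (u s x) - F (u t x)) / (s - t) - F' (u t x) \<bullet> v t x = R x + F' (u t x) \<bullet> e s x" for x
      using s by (simp add: R_def e_def inner_diff_right diff_divide_distrib inner_scaleR_right divide_inverse algebra_simps)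
    have Rb: "\<bar>R x\<bar> \<le> C * \<bar>s - t\<bar> * (2 * (norm (e s x))\<^sup>2 + 2 * (norm (v t x))\<^sup>2)" if x: "x \<in> {0..L}" for x
    proof -
      have "u s x - u t x = (s - t) *\<^sub>R (e s x + v t x)"
        using s by (simp add: e_def)
      then have n: "norm (u s x - u t x) = \<bar>s - t\<bar> * norm (e s x + v t x)" by simp
      have "\<bar>R x\<bar> \<le> C * (norm (u s x - u t x))\<^sup>2 / \<bar>s - t\<bar>"
        using elim x by (auto simp: R_def abs_divide intro!: divide_right_mono)
      also have "\<dots> = C * \<bar>s - t\<bar> * (norm (e s x + v t x))\<^sup>2"
        unfolding n using s by (simp add: power2_eq_square)
      also have "(norm (e s x + v t x))\<^sup>2 \<le> (norm (e s x) + norm (v t x))\<^sup>2"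
        by (intro power_mono norm_triangle_ineq) auto
      also have "\<dots> \<le> 2 * (norm (e s x))\<^sup>2 + 2 * (norm (v t x))\<^sup>2"
        using sum_squares_bound[of "norm (e s x)" "norm (v t x)"] by (simp add: power2_sum)
      finally show ?thesis using C by (simp add: mult_left_mono)
    qed
    have "((LINT x|?M. F (u s x)) - (LINT x|?M. F (u t x))) / (s - t) - (LINT x|?M. F' (u t x) \<bullet> v t x)
        = (LINT x|?M. (F (u s x) - F (u t x)) / (s - t) - F' (u t x) \<bullet> v t x)"
      using i inner_int[OF vL2] by simp
    also have "\<dots> = (LINT x|?M. R x) + (LINT x|?M. F' (u t x) \<bullet> e s x)"
      unfolding split by (intro Bochner_Integration.integral_add Ri inner_int eL2)
    also have "norm \<dots> \<le> norm (LINT x|?M. R x) + norm (LINT x|?M. F' (u t x) \<bullet> e s x)"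
      by (rule norm_triangle_ineq)
    also have "norm (LINT x|?M. R x) \<le> C * \<bar>s - t\<bar> * (2 * (N s)\<^sup>2 + 2 * V\<^sup>2)"
    proof -
      have sq: "integrable ?M (\<lambda>x. (norm (e s x))\<^sup>2)" "integrable ?M (\<lambda>x. (norm (v t x))\<^sup>2)"
        using eL2 vL2 by (auto simp: L2_space_def)
      have "norm (LINT x|?M. R x) \<le> (LINT x|?M. norm (R x))"
        by (rule integral_norm_bound)
      also have "\<dots> \<le> (LINT x|?M. C * \<bar>s - t\<bar> * (2 * (norm (e s x))\<^sup>2 + 2 * (norm (v t x))\<^sup>2))"
        using Ri sq Rb by (intro integral_mono) (auto simp: space_restrict_space)
      also have "\<dots> = C * \<bar>s - t\<bar> * (2 * (N s)\<^sup>2 + 2 * V\<^sup>2)"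
        using sq by (simp add: N_def V_def L2_norm_square)
      finally show ?thesis .
    qed
    also have "norm (LINT x|?M. F' (u t x) \<bullet> e s x) \<le> B * (sqrt L * N s)"
    proof -
      have "norm (LINT x|?M. F' (u t x) \<bullet> e s x) \<le> (LINT x|?M. norm (F' (u t x) \<bullet> e s x))"
        by (rule integral_norm_bound)
      also have "\<dots> \<le> (LINT x|?M. B * norm (e s x))"
        using inner_int[OF eL2] L2_space_imp_integrable[OF eL2] B
        by (intro integral_mono) (auto simp: space_restrict_space
          intro!: order_trans[OF Cauchy_Schwarz_ineq2] mult_right_mono)
      also have "\<dots> = B * (LINT x|?M. norm (e s x))" by simp
      also have "\<dots> \<le> B * (sqrt L * N s)"
        unfolding N_def by (intro mult_left_mono integral_norm_le_L2_norm L eL2 B0)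
      finally show ?thesis .
    qed
    finally show ?case by (simp add: Z_def)
  qed
  then have "((\<lambda>s. ((LINT x|?M. F (u s x)) - (LINT x|?M. F (u t x))) / (s - t)
      - (LINT x|?M. F' (u t x) \<bullet> v t x)) \<longlongrightarrow> 0) (at t)"
    by (rule Lim_null_comparison[OF _ Z])
  then show ?thesis
    unfolding has_field_derivative_iff by (rule LIM_zero_cancel)
qed

section \<open>Fluxes vanishing at the ends, and the derivative at the initial time\<close>

lemma has_weak_deriv_cong:
  fixes f f' :: "real \<Rightarrow> 'a::euclidean_space"
  assumes w: "has_weak_deriv L n f g" and eq: "\<And>x. x \<in> {0<..<L} \<Longrightarrow> f x = f' x"
  shows "has_weak_deriv L n f' g"
proof -
  have "(LINT x|leb_interval L. (deriv ^^ n) \<psi> x *\<^sub>R f' x) = (LINT x|leb_interval L. (deriv ^^ n) \<psi> x *\<^sub>R f x)" for \<psi>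
    using eq by (intro Bochner_Integration.integral_cong) (auto simp: space_restrict_space)
  moreover have "f' \<in> L2_space L"
  proof -
    have "f' \<in> borel_measurable (leb_interval L) \<longleftrightarrow> f \<in> borel_measurable (leb_interval L)"
      using eq by (intro measurable_cong) (auto simp: space_restrict_space)
    moreover have "integrable (leb_interval L) (\<lambda>x. (norm (f' x))\<^sup>2) \<longleftrightarrow> integrable (leb_interval L) (\<lambda>x. (norm (f x))\<^sup>2)"
      using eq by (intro Bochner_Integration.integrable_cong) (auto simp: space_restrict_space)
    ultimately show ?thesis
      using w by (auto simp: has_weak_deriv_def L2_space_def)
  qed
  ultimately show ?thesis
    using w by (auto simp: has_weak_deriv_def)
qed

text \<open>f 0 = 0 makes f the primitive of its weak derivative J, and f L = 0 makes the integral
  of J vanish, which removes the only boundary term.\<close>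

lemma flux_integral_by_parts:
  fixes f J \<psi> :: "real \<Rightarrow> real"
  assumes L: "0 < L" and w: "has_weak_deriv L 1 f J" and f: "continuous_on {0..L} f" "f 0 = 0" "f L = 0"
    and \<psi>: "\<And>x. x \<in> {0..L} \<Longrightarrow> (\<psi> has_real_derivative \<psi>' x) (at x within {0..L})"
    and \<psi>': "continuous_on {0..L} \<psi>'"
  shows "(LINT x|leb_interval L. \<psi> x * J x) = - (LINT x|leb_interval L. \<psi>' x * f x)"
proof -
  have J: "integrable (leb_interval L) J"
    using w by (auto simp: has_weak_deriv_def intro: L2_space_imp_integrable)
  have p: "iint L 0 x J = f x" if "x \<in> {0..L}" for x
    using weak_deriv_fundamental_theorem[OF w f(1), of 0 x] f that by simp
  have "iint L 0 L J = (LINT x|leb_interval L. J x)"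
    unfolding iint_def by (intro Bochner_Integration.integral_cong) (auto simp: space_restrict_space)
  then have "(LINT x|leb_interval L. J x) = 0" using p[of L] f L by simp
  moreover have "(LINT x|leb_interval L. \<psi>' x *\<^sub>R iint L 0 x J) = (LINT x|leb_interval L. \<psi>' x * f x)"
    using p by (intro Bochner_Integration.integral_cong) (auto simp: space_restrict_space)
  ultimately show ?thesis
    using integral_primitive_by_parts[OF _ J \<psi> \<psi>'] L by simp
qed

lemma has_real_derivative_at_right_0_limit:
  fixes E R :: "real \<Rightarrow> real"
  assumes d: "0 < d" and E': "\<And>t. 0 < t \<Longrightarrow> t < d \<Longrightarrow> (E has_real_derivative R t) (at t)"
    and E0: "(E \<longlongrightarrow> E 0) (at_right 0)" and R0: "(R \<longlongrightarrow> R 0) (at_right 0)"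
  shows "(E has_real_derivative R 0) (at_right 0)"
  unfolding has_field_derivative_iff
proof (rule tendstoI)
  fix e :: real assume "e > 0"
  from tendstoD[OF R0 this] obtain b where b: "b > 0" "\<And>z. 0 < z \<Longrightarrow> z < b \<Longrightarrow> dist (R z) (R 0) < e"
    by (auto simp: eventually_at_right_field)
  have "dist ((E s - E 0) / (s - 0)) (R 0) < e" if s: "0 < s" "s < min b d" for s
  proof -
    have "continuous_on {0..s} E"
      unfolding continuous_on_eq_continuous_within
    proof
      fix x assume x: "x \<in> {0..s}"
      show "continuous (at x within {0..s}) E"
      proof (cases "x = 0")
        case True
        then show ?thesis
          using E0 s at_within_Icc_at_right[of 0 s] by (simp add: continuous_within)
      next
        case False
        then have "isCont E x" using E'[of x] x s by (auto intro: DERIV_isCont)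
        then show ?thesis by (rule continuous_at_imp_continuous_at_within)
      qed
    qed
    moreover have "E differentiable at x" if "0 < x" "x < s" for x
      using E'[of x] that s by (auto simp: real_differentiable_def)
    ultimately obtain l z where z: "0 < z" "z < s" "(E has_real_derivative l) (at z)" "E s - E 0 = (s - 0) * l"
      using MVT[of 0 s E] s by blast
    have "l = R z" using DERIV_unique[OF z(3) E'[of z]] z s by simp
    then show ?thesis using z s b(2)[of z] by simp
  qed
  then show "\<forall>\<^sub>F s in at_right 0. dist ((E s - E 0) / (s - 0)) (R 0) < e"
    unfolding eventually_at_right_field using b d by (intro exI[of _ "min b d"]) auto
qed

subsection \<open>The energy functional\<close>

text \<open>Here s is the slope of \<sigma>(\<Gamma>), r and p are the values of \<phi>'' at
  \<Gamma> and at c, and a suffix x marks slopes. Apart from the two diffusion terms, what remains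
  after the cancellations is G^2/3 h^3 hx^2 - G h^2 hx s + h s^2: three quarters of the last term
  complete the square, one quarter is left over.\<close>

lemma dissipation_identity:
  fixes h m g hx mx gx s r p G D \<delta> \<beta> :: real
  assumes h: "h > 0" and \<beta>: "\<beta> > 0" and s: "s = - (r * g * gx)"
    and c: "c = \<beta> * m / h" and cx: "cx = \<beta> * (mx * h - m * hx) / h\<^sup>2"
  shows "(G * hx - 1 / \<beta> * (c * p * cx)) * (G / 3 * h ^ 3 * hx - 1 / 2 * h\<^sup>2 * s)
      + p * cx * (G / 3 * h\<^sup>2 * m * hx - 1 / 2 * h * m * s + \<delta> * mx - \<delta> * (m / h) * hx)
      + r * gx * (G / 2 * h\<^sup>2 * g * hx - h * g * s + D * gx)
    = D * (r * gx\<^sup>2) + \<delta> / \<beta> * (p * h * cx\<^sup>2) + 1 / 4 * (h * s\<^sup>2)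
      + (G / sqrt 3 * h powr (3 / 2) * hx - sqrt 3 / 2 * h powr (1 / 2) * s)\<^sup>2"
proof -
  \<comment> \<open>With k = m / h the flux of m is k f + \<delta> h y, where f is the flux of h and
    y the slope of k. As c = \<beta> k, the contribution of k f cancels against the c p cx part of
    the first product.\<close>
  define k y f where "k = c / \<beta>" and "y = cx / \<beta>" and "f = G / 3 * h ^ 3 * hx - 1 / 2 * h\<^sup>2 * s"
  have m: "m = k * h" and c': "c = \<beta> * k" and cx': "cx = \<beta> * y"
    using h \<beta> by (auto simp: k_def y_def c)
  have mx: "mx = h * y + k * hx"
    using h \<beta> by (simp add: y_def cx k_def c field_simps power2_eq_square)
  have "p * cx * (G / 3 * h\<^sup>2 * m * hx - 1 / 2 * h * m * s + \<delta> * mx - \<delta> * (m / h) * hx)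
      = p * cx * (k * f + \<delta> * h * y)"
    using h by (simp add: m mx f_def power2_eq_square power3_eq_cube algebra_simps)
  moreover have "(G * hx - 1 / \<beta> * (c * p * cx)) * f + p * cx * (k * f + \<delta> * h * y)
      = G * hx * f + \<delta> / \<beta> * (p * h * cx\<^sup>2)"
    using \<beta> by (simp add: c' cx' power2_eq_square algebra_simps)
  moreover have "r * gx * (G / 2 * h\<^sup>2 * g * hx - h * g * s + D * gx)
      = - s * (G / 2 * h\<^sup>2 * hx - h * s) + D * (r * gx\<^sup>2)"
    by (simp add: s power2_eq_square algebra_simps)
  moreover have "(G / sqrt 3 * h powr (3 / 2) * hx - sqrt 3 / 2 * h powr (1 / 2) * s)\<^sup>2
      = G\<^sup>2 / 3 * h ^ 3 * hx\<^sup>2 - G * h\<^sup>2 * hx * s + 3 / 4 * h * s\<^sup>2"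
  proof -
    have e: "h powr (1 + 1 / 2) = h * sqrt h"
      by (subst powr_add) (use h in \<open>simp add: powr_half_sqrt\<close>)
    have sq: "(X / t - t / 2 * s)\<^sup>2 = X\<^sup>2 / t\<^sup>2 - X * s + t\<^sup>2 / 4 * s\<^sup>2" if "t \<noteq> 0" for X t :: real
      using that by (simp add: power2_eq_square field_simps)
    have "G / sqrt 3 * h powr (3 / 2) * hx - sqrt 3 / 2 * h powr (1 / 2) * s
        = sqrt h * (G * h * hx / sqrt 3 - sqrt 3 / 2 * s)"
      using e h by (simp add: powr_half_sqrt algebra_simps)
    then have "(G / sqrt 3 * h powr (3 / 2) * hx - sqrt 3 / 2 * h powr (1 / 2) * s)\<^sup>2
        = h * ((G * h * hx)\<^sup>2 / 3 - G * h * hx * s + 3 / 4 * s\<^sup>2)"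
      using sq[of "sqrt 3" "G * h * hx"] h by (simp add: power_mult_distrib)
    also have "\<dots> = G\<^sup>2 / 3 * h ^ 3 * hx\<^sup>2 - G * h\<^sup>2 * hx * s + 3 / 4 * h * s\<^sup>2"
      by (simp add: power2_eq_square power3_eq_cube algebra_simps)
    finally show ?thesis .
  qed
  ultimately show ?thesis
    unfolding f_def by (simp add: power2_eq_square power3_eq_cube algebra_simps)
qed

text \<open>The mean value inequality is used for \<phi>' and for \<phi> minus its linear part at x,
  whose slope between x and y is at most B |y - x|. Compactness of {p..q} inside the positive axis
  bounds \<phi>''.\<close>

lemma taylor_remainder_bound:
  fixes \<phi> \<phi>' \<phi>'' :: "real \<Rightarrow> real"
  assumes \<phi>: "\<And>r. r > 0 \<Longrightarrow> (\<phi> has_real_derivative \<phi>' r) (at r)"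
    and \<phi>': "\<And>r. r > 0 \<Longrightarrow> (\<phi>' has_real_derivative \<phi>'' r) (at r)"
    and c: "continuous_on {0<..} \<phi>''" and "0 < p" "p \<le> q"
  obtains B where "0 \<le> B"
    "\<And>x y. x \<in> {p..q} \<Longrightarrow> y \<in> {p..q} \<Longrightarrow> \<bar>\<phi> y - \<phi> x - \<phi>' x * (y - x)\<bar> \<le> B * (y - x)\<^sup>2"
proof -
  have "bounded (\<phi>'' ` {p..q})"
    by (intro compact_imp_bounded compact_continuous_image continuous_on_subset[OF c]) (use assms in auto)
  then obtain B where B: "\<And>x. x \<in> {p..q} \<Longrightarrow> \<bar>\<phi>'' x\<bar> \<le> B"
    by (force simp: bounded_iff)
  have B0: "0 \<le> B" by (rule order_trans[OF abs_ge_zero B[of p]]) (use assms in auto)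
  have lip: "\<bar>\<phi>' y - \<phi>' x\<bar> \<le> B * \<bar>y - x\<bar>" if "x \<in> {p..q}" "y \<in> {p..q}" for x y
  proof -
    have d: "(\<phi>' has_real_derivative \<phi>'' z) (at z within {p..q})" if "z \<in> {p..q}" for z
      by (rule has_field_derivative_at_within[OF \<phi>']) (use that assms(4) in auto)
    have "norm (\<phi>' y - \<phi>' x) \<le> B * norm (y - x)"
      by (rule field_differentiable_bound[OF _ d]) (use that B in auto)
    then show ?thesis by simp
  qed
  show thesis
  proof (rule that[OF B0])
    fix x y assume x: "x \<in> {p..q}" and y: "y \<in> {p..q}"
    let ?S = "closed_segment x y"
    have S: "?S \<subseteq> {p..q}"
      using x y by (auto simp: closed_segment_eq_real_ivl split: if_splits)
    have d: "((\<lambda>z. \<phi> z - \<phi>' x * z) has_real_derivative \<phi>' z - \<phi>' x) (at z within ?S)" if "z \<in> ?S" for z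
      using that S assms(4) by (auto intro!: derivative_eq_intros has_field_derivative_at_within[OF \<phi>])
    have "norm ((\<lambda>z. \<phi> z - \<phi>' x * z) y - (\<lambda>z. \<phi> z - \<phi>' x * z) x) \<le> (B * \<bar>y - x\<bar>) * norm (y - x)"
    proof (rule field_differentiable_bound[OF _ d])
      fix z assume z: "z \<in> ?S"
      have "\<bar>\<phi>' z - \<phi>' x\<bar> \<le> B * \<bar>z - x\<bar>"
        using lip[of x z] x z S by auto
      also have "\<dots> \<le> B * \<bar>y - x\<bar>"
        using z B0 by (intro mult_left_mono) (auto simp: closed_segment_eq_real_ivl split: if_splits)
      finally show "norm (\<phi>' z - \<phi>' x) \<le> B * \<bar>y - x\<bar>" by simp
    qed auto
    then show "\<bar>\<phi> y - \<phi> x - \<phi>' x * (y - x)\<bar> \<le> B * (y - x)\<^sup>2"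
      by (simp add: algebra_simps power2_eq_square abs_mult[symmetric])
  qed
qed

locale film_energy =
  fixes L G D \<delta> \<beta> K :: real and \<sigma> \<sigma>' \<phi> \<phi>' \<phi>'' :: "real \<Rightarrow> real"
  assumes pos: "L > 0" "G > 0" "D > 0" "\<delta> > 0" "\<beta> > 0" "K > 0"
    and \<sigma>: "\<And>r. (\<sigma> has_real_derivative \<sigma>' r) (at r)" and \<sigma>'_cont: "continuous_on UNIV \<sigma>'"
    and \<phi>: "\<And>r. r > 0 \<Longrightarrow> (\<phi> has_real_derivative \<phi>' r) (at r)"
    and \<phi>': "\<And>r. r > 0 \<Longrightarrow> (\<phi>' has_real_derivative \<phi>'' r) (at r)"
    and \<phi>'': "\<And>r. r > 0 \<Longrightarrow> \<phi>'' r * r = - \<sigma>' r"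
begin

definition positive :: "(real^3) set" where
  "positive = {a. 0 < a $ 1 \<and> 0 < a $ 2 \<and> 0 < a $ 3}"

definition conc :: "real^3 \<Rightarrow> real" where
  "conc a = \<beta> * a $ 2 / a $ 1"

definition conc_slope :: "real^3 \<Rightarrow> real^3 \<Rightarrow> real" where
  "conc_slope a b = \<beta> * (b $ 2 * a $ 1 - a $ 2 * b $ 1) / (a $ 1)\<^sup>2"

definition energy :: "real^3 \<Rightarrow> real" where
  "energy a = \<phi> (a $ 3) + 1 / \<beta> * a $ 1 * \<phi> (conc a) + G / 2 * (a $ 1)\<^sup>2"

text \<open>The h derivative of h \<phi>(\<beta> m / h) / \<beta> is (\<phi>(c) - c \<phi>'(c)) /
  \<beta>; in the m derivative the inner factor \<beta> / h cancels the weight h / \<beta>.\<close>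

definition energy_grad :: "real^3 \<Rightarrow> real^3" where
  "energy_grad a = vector [1 / \<beta> * (\<phi> (conc a) - conc a * \<phi>' (conc a)) + G * a $ 1, \<phi>' (conc a), \<phi>' (a $ 3)]"

text \<open>The integrands of the five dissipation terms, numbered in the order of the claim.\<close>

definition dissip :: "nat \<Rightarrow> (real^3) \<times> (real^3) \<Rightarrow> real" where
  "dissip j z = (let a = fst z; b = snd z in
     if j = 0 then \<phi>'' (a $ 3) * (b $ 3)\<^sup>2
     else if j = 1 then \<phi>'' (conc a) * a $ 1 * (conc_slope a b)\<^sup>2
     else if j = 2 then a $ 1 * (\<sigma>' (a $ 3) * b $ 3)\<^sup>2
     else if j = 3 then (G / sqrt 3 * a $ 1 powr (3 / 2) * b $ 1 - sqrt 3 / 2 * a $ 1 powr (1 / 2) * (\<sigma>' (a $ 3) * b $ 3))\<^sup>2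
     else (\<phi>' (a $ 3) - \<phi>' (conc a)) * (a $ 3 - conc a))"

text \<open>A functional of values and slopes on the closed interval, without \<open>deriv\<close>:
  this form passes to the limit at the initial time, and \<open>dissipation_eq\<close> translates it
  into the integrals of the claim.\<close>

definition dissipation :: "(real \<Rightarrow> real^3) \<Rightarrow> (real \<Rightarrow> real^3) \<Rightarrow> real" where
  "dissipation u w =
     - D * (LINT x|leb_interval L. dissip 0 (u x, w x))
     - \<delta> / \<beta> * (LINT x|leb_interval L. dissip 1 (u x, w x))
     - 1 / 4 * (LINT x|leb_interval L. dissip 2 (u x, w x))
     - (LINT x|leb_interval L. dissip 3 (u x, w x))
     - K * (LINT x|leb_interval L. dissip 4 (u x, w x))"

lemma open_positive: "open positive"
  unfolding positive_def by (intro open_Collect_conj open_Collect_less continuous_intros)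

lemma \<phi>_cont: "continuous_on {0<..} \<phi>" and \<phi>'_cont: "continuous_on {0<..} \<phi>'"
  using \<phi> \<phi>' by (auto intro!: continuous_at_imp_continuous_on DERIV_isCont)

text \<open>Only existence of \<phi>'' is given; its continuity comes from \<phi>''(r) = -
  \<sigma>'(r) / r. The Taylor bound and the continuity of the dissipation rest on it.\<close>

lemma \<phi>''_cont: "continuous_on {0<..} \<phi>''"
proof -
  have "continuous_on {0<..} (\<lambda>r. - \<sigma>' r / r)"
    by (intro continuous_intros continuous_on_subset[OF \<sigma>'_cont]) auto
  then show ?thesis
  proof (rule continuous_on_eq)
    show "- \<sigma>' r / r = \<phi>'' r" if "r \<in> {0<..}" for r
      using \<phi>''[of r] that by (simp add: field_simps)
  qed
qed

lemma conc_pos: "a \<in> positive \<Longrightarrow> 0 < conc a"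
  using pos by (auto simp: positive_def conc_def)

lemma continuous_on_conc: "continuous_on positive conc"
  unfolding conc_def[abs_def] by (intro continuous_intros) (auto simp: positive_def)

lemma continuous_on_comp_positive:
  fixes f :: "real \<Rightarrow> real"
  assumes "continuous_on {0<..} f"
  shows "continuous_on positive (\<lambda>a. f (a $ 3))" "continuous_on positive (\<lambda>a. f (conc a))"
proof -
  show "continuous_on positive (\<lambda>a. f (a $ 3))"
    by (rule continuous_on_compose2[OF assms]) (auto simp: positive_def intro!: continuous_intros)
  show "continuous_on positive (\<lambda>a. f (conc a))"
    by (rule continuous_on_compose2[OF assms continuous_on_conc]) (auto dest: conc_pos)
qed

lemma continuous_on_energy: "continuous_on positive energy"
  unfolding energy_def[abs_def]
  by (intro continuous_intros continuous_on_comp_positive \<phi>_cont)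

lemma continuous_on_energy_grad: "continuous_on positive energy_grad"
proof -
  have "continuous_on positive (\<lambda>a. energy_grad a $ i)" for i
    using exhaust_3[of i] unfolding energy_grad_def
    by (elim disjE; simp only: vector_3)
       (intro continuous_intros continuous_on_comp_positive \<phi>_cont \<phi>'_cont continuous_on_conc)+
  then have "continuous_on positive (\<lambda>a. \<chi> i. energy_grad a $ i)"
    by (rule continuous_on_vec_lambda)
  then show ?thesis by simp
qed

lemma continuous_on_dissip: "continuous_on (positive \<times> UNIV) (dissip j)"
proof -
  have 1: "continuous_on (positive \<times> UNIV) (\<lambda>z. f (fst z))" if "continuous_on positive f"
    for f :: "real^3 \<Rightarrow> real"
    by (rule continuous_on_compose2[OF that]) (auto intro!: continuous_intros)
  have \<sigma>'': "continuous_on positive (\<lambda>a. \<sigma>' (a $ 3))"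
    by (rule continuous_on_comp_positive(1)[OF continuous_on_subset[OF \<sigma>'_cont]]) auto
  have slope: "continuous_on (positive \<times> UNIV) (\<lambda>z. conc_slope (fst z) (snd z))"
    unfolding conc_slope_def by (intro continuous_intros) (auto simp: positive_def)
  note c = 1[OF continuous_on_comp_positive(1)[OF \<phi>''_cont]] 1[OF continuous_on_comp_positive(2)[OF \<phi>''_cont]]
    1[OF continuous_on_comp_positive(1)[OF \<phi>'_cont]] 1[OF continuous_on_comp_positive(2)[OF \<phi>'_cont]]
    1[OF \<sigma>''] 1[OF continuous_on_conc] slope
  show ?thesis
    unfolding dissip_def[abs_def] Let_def
    by (cases "j = 0"; cases "j = 1"; cases "j = 2"; cases "j = 3"; simp)
       (intro continuous_intros c; auto simp: positive_def)+
qed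

lemma energy_remainder:
  assumes lo: "0 < lo" "lo \<le> hi"
  obtains C where "0 \<le> C"
    "\<And>a b. (\<And>i. a $ i \<in> {lo..hi}) \<Longrightarrow> (\<And>i. b $ i \<in> {lo..hi}) \<Longrightarrow>
      \<bar>energy b - energy a - energy_grad a \<bullet> (b - a)\<bar> \<le> C * (norm (b - a))\<^sup>2"
proof -
  obtain B1 where B1: "0 \<le> B1"
    "\<And>x y. x \<in> {lo..hi} \<Longrightarrow> y \<in> {lo..hi} \<Longrightarrow> \<bar>\<phi> y - \<phi> x - \<phi>' x * (y - x)\<bar> \<le> B1 * (y - x)\<^sup>2"
    using taylor_remainder_bound[OF \<phi> \<phi>' \<phi>''_cont lo] by blast
  \<comment> \<open>These bounds enclose the values of \<open>conc\<close> on states with components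
    in {lo..hi}: a compact part of the positive axis, on which the Taylor bound applies.\<close>
  have "0 < \<beta> * lo / hi" "\<beta> * lo / hi \<le> \<beta> * hi / lo"
    using lo pos by (auto intro!: frac_le mult_left_mono)
  then obtain B2 where B2: "0 \<le> B2"
    "\<And>x y. x \<in> {\<beta> * lo / hi..\<beta> * hi / lo} \<Longrightarrow> y \<in> {\<beta> * lo / hi..\<beta> * hi / lo} \<Longrightarrow>
      \<bar>\<phi> y - \<phi> x - \<phi>' x * (y - x)\<bar> \<le> B2 * (y - x)\<^sup>2"
    using taylor_remainder_bound[OF \<phi> \<phi>' \<phi>''_cont] by blast
  \<comment> \<open>A Lipschitz constant of \<open>conc\<close> on the box: in the difference of two
    quotients the numerator is at most 2 * \<beta> * hi times the distance and the denominator at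
    least \<open>lo\<^sup>2\<close>.\<close>
  define M where "M = 2 * \<beta> * hi / lo\<^sup>2"
  define C where "C = B1 + 1 / \<beta> * hi * (B2 * M\<^sup>2) + G / 2"
  show thesis
  proof (rule that[of C])
    show "0 \<le> C" using B1 B2 lo pos by (simp add: C_def)
    fix a b :: "real^3"
    assume a: "\<And>i. a $ i \<in> {lo..hi}" and b: "\<And>i. b $ i \<in> {lo..hi}"
    let ?N = "norm (b - a)"
    have comp: "\<bar>b $ i - a $ i\<bar> \<le> ?N" for i
      using component_le_norm_cart[of "b - a" i] by simp
    have sq: "(b $ i - a $ i)\<^sup>2 \<le> ?N\<^sup>2" for i
      using comp[of i] by (metis abs_le_square_iff abs_norm_cancel)
    have apos: "0 < a $ 1" "0 < b $ 1" "0 < a $ 2" using a[of 1] b[of 1] a[of 2] lo by auto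
    have crange: "conc z \<in> {\<beta> * lo / hi..\<beta> * hi / lo}" if "\<And>i. z $ i \<in> {lo..hi}" for z
      unfolding conc_def using that[of 1] that[of 2] lo pos by (auto intro!: frac_le mult_left_mono)
    have cdiff: "\<bar>conc b - conc a\<bar> \<le> M * ?N"
    proof -
      have "conc b - conc a = \<beta> * ((b $ 2 - a $ 2) * a $ 1 - a $ 2 * (b $ 1 - a $ 1)) / (a $ 1 * b $ 1)"
        using apos by (simp add: conc_def field_simps)
      then have "\<bar>conc b - conc a\<bar> = \<beta> * \<bar>(b $ 2 - a $ 2) * a $ 1 - a $ 2 * (b $ 1 - a $ 1)\<bar> / (a $ 1 * b $ 1)"
        using apos pos by (simp add: abs_mult)
      also have "\<dots> \<le> \<beta> * (?N * hi + hi * ?N) / (lo * lo)"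
      proof (intro frac_le mult_left_mono)
        have "\<bar>(b $ 2 - a $ 2) * a $ 1 - a $ 2 * (b $ 1 - a $ 1)\<bar> \<le> \<bar>b $ 2 - a $ 2\<bar> * a $ 1 + a $ 2 * \<bar>b $ 1 - a $ 1\<bar>"
          using apos by (intro order_trans[OF abs_triangle_ineq4]) (simp add: abs_mult)
        also have "\<dots> \<le> ?N * hi + hi * ?N"
          using comp[of 2] comp[of 1] a[of 1] a[of 2] apos by (intro add_mono mult_mono) auto
        finally show "\<bar>(b $ 2 - a $ 2) * a $ 1 - a $ 2 * (b $ 1 - a $ 1)\<bar> \<le> ?N * hi + hi * ?N" .
        show "lo * lo \<le> a $ 1 * b $ 1" using a[of 1] b[of 1] lo by (intro mult_mono) auto
      qed (use pos lo in auto)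
      also have "\<dots> = M * ?N" by (simp add: M_def power2_eq_square)
      finally show ?thesis .
    qed
    have csq: "(conc b - conc a)\<^sup>2 \<le> M\<^sup>2 * ?N\<^sup>2"
      using power_mono[OF cdiff abs_ge_zero, of 2] by (simp add: power_mult_distrib)
    have m: "\<beta> * a $ 2 = conc a * a $ 1" "\<beta> * b $ 2 = conc b * b $ 1"
      using apos by (auto simp: conc_def)
    \<comment> \<open>An exact identity: with m written as \<open>conc\<close> times h / \<beta>,
      the terms linear in the change of h cancel against \<phi>(c) - c \<phi>'(c). The weight left
      over is the h of the new state b.\<close>
    have "energy b - energy a - energy_grad a \<bullet> (b - a) =
        (\<phi> (b $ 3) - \<phi> (a $ 3) - \<phi>' (a $ 3) * (b $ 3 - a $ 3))
        + 1 / \<beta> * b $ 1 * (\<phi> (conc b) - \<phi> (conc a) - \<phi>' (conc a) * (conc b - conc a))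
        + G / 2 * (b $ 1 - a $ 1)\<^sup>2" (is "_ = ?t1 + ?t2 + ?t3")
    proof -
      have m': "a $ 2 = conc a * a $ 1 / \<beta>" "b $ 2 = conc b * b $ 1 / \<beta>"
        using m pos by (auto simp: field_simps)
      show ?thesis
        unfolding energy_def energy_grad_def inner_vec_def
        by (simp add: sum_3 vector_3 m') (simp add: power2_eq_square diff_divide_distrib add_divide_distrib algebra_simps)
    qed
    also have "\<bar>?t1 + ?t2 + ?t3\<bar> \<le> \<bar>?t1\<bar> + \<bar>?t2\<bar> + \<bar>?t3\<bar>" by linarith
    also have "\<bar>?t1\<bar> \<le> B1 * ?N\<^sup>2"
      using B1(2)[OF a b, of 3 3] sq[of 3] B1(1) by (meson mult_left_mono order_trans)
    also have "\<bar>?t2\<bar> \<le> 1 / \<beta> * hi * (B2 * M\<^sup>2) * ?N\<^sup>2"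
    proof -
      have "\<bar>?t2\<bar> = 1 / \<beta> * b $ 1 * \<bar>\<phi> (conc b) - \<phi> (conc a) - \<phi>' (conc a) * (conc b - conc a)\<bar>"
        using apos pos by (simp add: abs_mult)
      also have "\<dots> \<le> 1 / \<beta> * hi * (B2 * (M\<^sup>2 * ?N\<^sup>2))"
        using order_trans[OF B2(2)[OF crange[OF a] crange[OF b]] mult_left_mono[OF csq B2(1)]] b[of 1] apos pos lo
        by (intro mult_mono) auto
      finally show ?thesis by (simp add: mult_ac)
    qed
    also have "\<bar>?t3\<bar> \<le> G / 2 * ?N\<^sup>2"
      using sq[of 1] pos by (simp add: abs_mult)
    finally show "\<bar>energy b - energy a - energy_grad a \<bullet> (b - a)\<bar> \<le> C * ?N\<^sup>2"
      by (simp add: C_def algebra_simps)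
  qed
qed

lemma dissip_integrable:
  assumes "continuous_on {0..L} u" "continuous_on {0..L} w" "\<And>x. x \<in> {0..L} \<Longrightarrow> u x \<in> positive"
  shows "integrable (leb_interval L) (\<lambda>x. dissip j (u x, w x))"
  by (intro integrable_continuous_leb_interval continuous_on_compose2[OF continuous_on_dissip])
     (use assms in \<open>auto intro!: continuous_intros\<close>)

text \<open>Value and slope are joined into one curve in the product space, so each integrand is a
  continuous function composed with a uniformly convergent family.\<close>

lemma dissipation_tendsto:
  assumes lim: "uniform_limit {0..L} u u0 F" "uniform_limit {0..L} w w0 F"
    and c: "\<forall>\<^sub>F s in F. continuous_on {0..L} (u s)" "\<forall>\<^sub>F s in F. continuous_on {0..L} (w s)"
    and c0: "continuous_on {0..L} u0" "continuous_on {0..L} w0" and p: "\<And>x. x \<in> {0..L} \<Longrightarrow> u0 x \<in> positive"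
  shows "((\<lambda>s. dissipation (u s) (w s)) \<longlongrightarrow> dissipation u0 w0) F"
proof -
  have "((\<lambda>s. LINT x|leb_interval L. dissip j (u s x, w s x)) \<longlongrightarrow> (LINT x|leb_interval L. dissip j (u0 x, w0 x))) F" for j
  proof (rule integral_composition_tendsto[OF pos(1) continuous_on_dissip, where U = "\<lambda>s x. (u s x, w s x)" and V = "\<lambda>x. (u0 x, w0 x)"])
    show "open (positive \<times> (UNIV :: (real^3) set))"
      by (intro open_Times open_positive open_UNIV)
    show "uniform_limit {0..L} (\<lambda>s x. (u s x, w s x)) (\<lambda>x. (u0 x, w0 x)) F"
      by (rule uniform_limit_Pair[OF lim])
    show "\<forall>\<^sub>F s in F. continuous_on {0..L} (\<lambda>x. (u s x, w s x))"
      using c by eventually_elim (intro continuous_intros)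
    show "continuous_on {0..L} (\<lambda>x. (u0 x, w0 x))"
      by (intro continuous_intros c0)
  qed (use p in auto)
  then show ?thesis
    unfolding dissipation_def by (intro tendsto_intros)
qed

lemma component_derivative:
  assumes "(u has_vector_derivative d) (at x within S)"
  shows "((\<lambda>x. u x $ i) has_real_derivative d $ i) (at x within S)"
  using bounded_linear.has_vector_derivative[OF bounded_linear_vec_nth assms]
  by (simp add: has_real_derivative_iff_has_vector_derivative)

lemma conc_derivative:
  assumes "(u has_vector_derivative d) (at x within S)" "u x \<in> positive"
  shows "((\<lambda>x. conc (u x)) has_real_derivative conc_slope (u x) d) (at x within S)"
  unfolding conc_def using assms(2)
  by (auto intro!: derivative_eq_intros component_derivative[OF assms(1)]
      simp: positive_def conc_slope_def power2_eq_square field_simps)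

text \<open>\<open>deriv\<close> is two-sided, while slopes are taken relative to the closed
  interval. The two agree in the open interval, which is all that the integrals see.\<close>

lemma deriv_interior:
  assumes "(u has_vector_derivative d) (at x within {0..L})" and x: "x \<in> {0<..<L}"
  shows "deriv (\<lambda>y. u y $ i) x = d $ i"
    "deriv (\<lambda>y. \<sigma> (u y $ i)) x = \<sigma>' (u x $ i) * d $ i"
    "u x \<in> positive \<Longrightarrow> deriv (\<lambda>y. \<beta> * u y $ 2 / u y $ 1) x = conc_slope (u x) d"
proof -
  have "at x within {0..L} = at x"
    using x by (simp add: at_within_Icc_at)
  then have d: "(u has_vector_derivative d) (at x within UNIV)"
    using assms(1) by simp
  show "deriv (\<lambda>y. u y $ i) x = d $ i"
    by (rule DERIV_imp_deriv[OF component_derivative[OF d]])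
  show "deriv (\<lambda>y. \<sigma> (u y $ i)) x = \<sigma>' (u x $ i) * d $ i"
    by (rule DERIV_imp_deriv[OF DERIV_chain2[OF \<sigma> component_derivative[OF d]]])
  show "u x \<in> positive \<Longrightarrow> deriv (\<lambda>y. \<beta> * u y $ 2 / u y $ 1) x = conc_slope (u x) d"
    using DERIV_imp_deriv[OF conc_derivative[OF d]] by (simp add: conc_def)
qed

lemma dissipation_eq:
  assumes d: "\<And>x. x \<in> {0..L} \<Longrightarrow> (u has_vector_derivative w x) (at x within {0..L})"
    and p: "\<And>x. x \<in> {0..L} \<Longrightarrow> u x \<in> positive"
  shows "dissipation u w =
     - D * (LINT x|leb_interval L. \<phi>'' (u x $ 3) * \<bar>deriv (\<lambda>y. u y $ 3) x\<bar>^2)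
     - \<delta> / \<beta> * (LINT x|leb_interval L. \<phi>'' (\<beta> * u x $ 2 / u x $ 1) * u x $ 1 * \<bar>deriv (\<lambda>y. \<beta> * u y $ 2 / u y $ 1) x\<bar>^2)
     - 1 / 4 * (LINT x|leb_interval L. u x $ 1 * \<bar>deriv (\<lambda>y. \<sigma> (u y $ 3)) x\<bar>^2)
     - (LINT x|leb_interval L. (G / sqrt 3 * u x $ 1 powr (3 / 2) * deriv (\<lambda>y. u y $ 1) x
               - sqrt 3 / 2 * u x $ 1 powr (1 / 2) * deriv (\<lambda>y. \<sigma> (u y $ 3)) x)^2)
     - K * (LINT x|leb_interval L.
              (\<phi>' (u x $ 3) - \<phi>' (\<beta> * u x $ 2 / u x $ 1)) * (u x $ 3 - \<beta> * u x $ 2 / u x $ 1))"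
proof -
  have cong: "(LINT x|leb_interval L. f x) = (LINT x|leb_interval L. g x)"
    if "\<And>x. x \<in> {0<..<L} \<Longrightarrow> f x = g x" for f g :: "real \<Rightarrow> real"
    using that by (intro Bochner_Integration.integral_cong) (auto simp: space_restrict_space)
  note e = deriv_interior[OF d]
  have e': "deriv (\<lambda>y. u y $ i) x = w x $ i" "deriv (\<lambda>y. \<sigma> (u y $ i)) x = \<sigma>' (u x $ i) * w x $ i"
    "deriv (\<lambda>y. \<beta> * u y $ 2 / u y $ 1) x = conc_slope (u x) (w x)" if "x \<in> {0<..<L}" for x i
    using e[of x] p[of x] that by auto
  show ?thesis
    unfolding dissipation_def
    by (intro arg_cong2[where f = "(-)"] arg_cong2[where f = "(*)"] refl cong)
       (simp_all only: dissip_def Let_def fst_conv snd_conv e' conc_def power2_abs, simp_all)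
qed

text \<open>The left side is the energy derivative given by the chain rule. The equations, valid
  almost everywhere, replace v by weak derivatives of fluxes and reaction terms; the components of
  the gradient along u are C1 in x, so the derivatives can be moved from the fluxes onto
  them.\<close>

lemma energy_balance:
  assumes d: "\<And>x. x \<in> {0..L} \<Longrightarrow> (u has_vector_derivative w x) (at x within {0..L})"
    and cw: "continuous_on {0..L} w" and w0: "w 0 = 0" "w L = 0"
    and p: "\<And>x. x \<in> {0..L} \<Longrightarrow> u x \<in> positive" and v: "v \<in> L2_space L"
    and eq: "film_equations L G D \<delta> \<beta> K \<sigma> (\<lambda>x. u x $ 1) (\<lambda>x. u x $ 2) (\<lambda>x. u x $ 3)
      (\<lambda>x. v x $ 1) (\<lambda>x. v x $ 2) (\<lambda>x. v x $ 3)"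
  shows "(LINT x|leb_interval L. energy_grad (u x) \<bullet> v x) = dissipation u w"
proof -
  let ?M = "leb_interval L"
  have cu: "continuous_on {0..L} u"
    unfolding continuous_on_eq_continuous_within by (intro ballI has_vector_derivative_continuous[OF d])
  have cpos: "continuous_on {0..L} (\<lambda>x. f (u x))" if "continuous_on positive f" for f :: "real^3 \<Rightarrow> real"
    by (rule continuous_on_compose2[OF that cu]) (use p in auto)
  have nz: "u x $ 1 \<noteq> 0" if "x \<in> {0..L}" for x using p[OF that] by (simp add: positive_def)
  have cs: "continuous_on {0..L} (\<lambda>x. conc_slope (u x) (w x))"
    unfolding conc_slope_def by (intro continuous_intros cu cw) (use nz in auto)
  have c\<sigma>: "continuous_on {0..L} (\<lambda>x. \<sigma>' (u x $ 3))"
    by (rule continuous_on_compose2[OF \<sigma>'_cont]) (auto intro!: continuous_intros cu)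
  note c = cpos[OF continuous_on_comp_positive(1)[OF \<phi>''_cont]] cpos[OF continuous_on_comp_positive(2)[OF \<phi>''_cont]]
    cpos[OF continuous_on_conc] cs c\<sigma> cu cw
  \<comment> \<open>The fluxes with \<open>deriv\<close> replaced by the slope w: equal to the given
    ones inside the interval, and continuous up to the ends, where w = 0.\<close>
  define f1 where "f1 x = G / 3 * (u x $ 1) ^ 3 * w x $ 1 - 1 / 2 * (u x $ 1)\<^sup>2 * (\<sigma>' (u x $ 3) * w x $ 3)" for x
  define f2 where "f2 x = G / 3 * (u x $ 1)\<^sup>2 * u x $ 2 * w x $ 1 - 1 / 2 * u x $ 1 * u x $ 2 * (\<sigma>' (u x $ 3) * w x $ 3)
    + \<delta> * w x $ 2 - \<delta> * (u x $ 2 / u x $ 1) * w x $ 1" for x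
  define f3 where "f3 x = G / 2 * (u x $ 1)\<^sup>2 * u x $ 3 * w x $ 1 - u x $ 1 * u x $ 3 * (\<sigma>' (u x $ 3) * w x $ 3)
    + D * w x $ 3" for x
  obtain J1 J2 J3 where J: "has_weak_deriv L 1 f1 J1" "has_weak_deriv L 1 f2 J2" "has_weak_deriv L 1 f3 J3"
    "AE x in ?M. v x $ 1 - J1 x = 0 \<and>
          v x $ 2 - J2 x = - K * (\<beta> * u x $ 2 / u x $ 1 - u x $ 3) \<and>
          v x $ 3 - J3 x = K * (\<beta> * u x $ 2 / u x $ 1 - u x $ 3)"
  proof -
    have e: "deriv (\<lambda>y. u y $ i) x = w x $ i" "deriv (\<lambda>y. \<sigma> (u y $ i)) x = \<sigma>' (u x $ i) * w x $ i"
      if "x \<in> {0<..<L}" for x i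
      using deriv_interior[OF d, of x] that by auto
    from eq obtain J1 J2 J3 where J:
      "has_weak_deriv L 1 (\<lambda>x. G / 3 * (u x $ 1)^3 * deriv (\<lambda>x. u x $ 1) x - 1 / 2 * (u x $ 1)^2 * deriv (\<lambda>y. \<sigma> (u y $ 3)) x) J1"
      "has_weak_deriv L 1
         (\<lambda>x. G / 3 * (u x $ 1)^2 * u x $ 2 * deriv (\<lambda>x. u x $ 1) x - 1 / 2 * u x $ 1 * u x $ 2 * deriv (\<lambda>y. \<sigma> (u y $ 3)) x
              + \<delta> * deriv (\<lambda>x. u x $ 2) x - \<delta> * (u x $ 2 / u x $ 1) * deriv (\<lambda>x. u x $ 1) x) J2"
      "has_weak_deriv L 1
         (\<lambda>x. G / 2 * (u x $ 1)^2 * u x $ 3 * deriv (\<lambda>x. u x $ 1) x - u x $ 1 * u x $ 3 * deriv (\<lambda>y. \<sigma> (u y $ 3)) x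
              + D * deriv (\<lambda>x. u x $ 3) x) J3"
      "AE x in ?M. v x $ 1 - J1 x = 0 \<and>
          v x $ 2 - J2 x = - K * (\<beta> * u x $ 2 / u x $ 1 - u x $ 3) \<and>
          v x $ 3 - J3 x = K * (\<beta> * u x $ 2 / u x $ 1 - u x $ 3)"
      unfolding film_equations_def by blast
    show ?thesis
      by (rule that[OF has_weak_deriv_cong[OF J(1)] has_weak_deriv_cong[OF J(2)] has_weak_deriv_cong[OF J(3)] J(4)])
         (simp_all only: f1_def f2_def f3_def e)
  qed
  define g1 where "g1 x = 1 / \<beta> * (\<phi> (conc (u x)) - conc (u x) * \<phi>' (conc (u x))) + G * u x $ 1" for x
  define g2 where "g2 x = \<phi>' (conc (u x))" for x
  define g3 where "g3 x = \<phi>' (u x $ 3)" for x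
  define g1' where "g1' x = G * w x $ 1 - 1 / \<beta> * (conc (u x) * \<phi>'' (conc (u x)) * conc_slope (u x) (w x))" for x
  define g2' where "g2' x = \<phi>'' (conc (u x)) * conc_slope (u x) (w x)" for x
  define g3' where "g3' x = \<phi>'' (u x $ 3) * w x $ 3" for x
  have dg2: "(g2 has_real_derivative g2' x) (at x within {0..L})" if "x \<in> {0..L}" for x
    unfolding g2_def[abs_def] g2'_def
    by (rule DERIV_chain2[OF \<phi>'[OF conc_pos[OF p[OF that]]] conc_derivative[OF d[OF that] p[OF that]]])
  have dg3: "(g3 has_real_derivative g3' x) (at x within {0..L})" if "x \<in> {0..L}" for x
    unfolding g3_def[abs_def] g3'_def
    by (rule DERIV_chain2[OF \<phi>' component_derivative[OF d[OF that]]]) (use p[OF that] in \<open>simp add: positive_def\<close>)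
  have dg1: "(g1 has_real_derivative g1' x) (at x within {0..L})" if x: "x \<in> {0..L}" for x
  proof -
    note dc = conc_derivative[OF d[OF x] p[OF x]]
    have "((\<lambda>x. \<phi> (conc (u x))) has_real_derivative \<phi>' (conc (u x)) * conc_slope (u x) (w x)) (at x within {0..L})"
      by (rule DERIV_chain2[OF \<phi>[OF conc_pos[OF p[OF x]]] dc])
    \<comment> \<open>In the slope of \<phi>(c) - c \<phi>'(c) the two \<phi>'(c) terms cancel,
      leaving - c \<phi>''(c) times the slope of c.\<close>
    from DERIV_add[OF DERIV_cmult[OF DERIV_diff[OF this DERIV_mult[OF dc dg2[OF x]]], of "1 / \<beta>"]
        DERIV_cmult[OF component_derivative[where i = 1, OF d[OF x]], of G]]
    show ?thesis
      unfolding g1_def[abs_def] g1'_def g2_def[abs_def] g2'_def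
      by (rule DERIV_cong) (simp add: algebra_simps)
  qed
  have cg': "continuous_on {0..L} g1'" "continuous_on {0..L} g2'" "continuous_on {0..L} g3'"
    unfolding g1'_def[abs_def] g2'_def[abs_def] g3'_def[abs_def] by (intro continuous_intros c)+
  have cg: "continuous_on {0..L} g1" "continuous_on {0..L} g2" "continuous_on {0..L} g3"
    by (rule DERIV_continuous_on, erule dg1 dg2 dg3)+
  have cf: "continuous_on {0..L} f1" "continuous_on {0..L} f2" "continuous_on {0..L} f3"
    unfolding f1_def[abs_def] f2_def[abs_def] f3_def[abs_def]
    by (intro continuous_intros c; simp add: nz)+
  have f0: "f1 0 = 0" "f1 L = 0" "f2 0 = 0" "f2 L = 0" "f3 0 = 0" "f3 L = 0"
    by (simp_all add: f1_def f2_def f3_def w0)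
  have parts: "(LINT x|?M. g1 x * J1 x) = - (LINT x|?M. g1' x * f1 x)"
    "(LINT x|?M. g2 x * J2 x) = - (LINT x|?M. g2' x * f2 x)"
    "(LINT x|?M. g3 x * J3 x) = - (LINT x|?M. g3' x * f3 x)"
    by (rule flux_integral_by_parts; (rule pos J cf f0 dg1 dg2 dg3 cg'; assumption?))+
  have Ji: "integrable ?M J1" "integrable ?M J2" "integrable ?M J3"
    using J by (auto simp: has_weak_deriv_def intro: L2_space_imp_integrable)
  have gJ: "integrable ?M (\<lambda>x. g1 x * J1 x)" "integrable ?M (\<lambda>x. g2 x * J2 x)" "integrable ?M (\<lambda>x. g3 x * J3 x)"
    using integrable_continuous_scaleR[OF cg(1) Ji(1)] integrable_continuous_scaleR[OF cg(2) Ji(2)]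
      integrable_continuous_scaleR[OF cg(3) Ji(3)] by simp_all
  have gf: "integrable ?M (\<lambda>x. g1' x * f1 x)" "integrable ?M (\<lambda>x. g2' x * f2 x)" "integrable ?M (\<lambda>x. g3' x * f3 x)"
    by (intro integrable_continuous_leb_interval continuous_intros cg' cf)+
  note di = dissip_integrable[OF cu cw p]
  have vm: "v \<in> borel_measurable ?M" using v by (simp add: L2_space_def)
  have gm: "(\<lambda>x. energy_grad (u x)) \<in> borel_measurable ?M"
    by (intro measurable_continuous_leb_interval continuous_on_compose2[OF continuous_on_energy_grad]
        continuous_on_subset[OF cu]) (use p in auto)
  have "(LINT x|?M. energy_grad (u x) \<bullet> v x)
      = (LINT x|?M. g1 x * J1 x + g2 x * J2 x + g3 x * J3 x - K * dissip 4 (u x, w x))"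
  proof (rule integral_cong_AE)
    show "(\<lambda>x. energy_grad (u x) \<bullet> v x) \<in> borel_measurable ?M"
      by (rule borel_measurable_inner[OF gm vm])
    show "(\<lambda>x. g1 x * J1 x + g2 x * J2 x + g3 x * J3 x - K * dissip 4 (u x, w x)) \<in> borel_measurable ?M"
      using gJ di by (intro borel_measurable_integrable) simp
    show "AE x in ?M. energy_grad (u x) \<bullet> v x = g1 x * J1 x + g2 x * J2 x + g3 x * J3 x - K * dissip 4 (u x, w x)"
      using J(4)
    proof eventually_elim
      case (elim x)
      then have e: "v x $ 1 = J1 x" "v x $ 2 = J2 x - K * (conc (u x) - u x $ 3)" "v x $ 3 = J3 x + K * (conc (u x) - u x $ 3)"
        by (auto simp: conc_def)
      have "energy_grad (u x) \<bullet> v x = g1 x * v x $ 1 + g2 x * v x $ 2 + g3 x * v x $ 3"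
        by (simp add: inner_vec_def sum_3 energy_grad_def vector_3 g1_def g2_def g3_def)
      \<comment> \<open>The reaction contributes K (c - \<Gamma>) times \<phi>'(\<Gamma>) -
        \<phi>'(c), that is, - K times the integrand with index 4.\<close>
      then show ?case
        unfolding e by (simp add: dissip_def Let_def g2_def g3_def algebra_simps)
    qed
  qed
  also have "\<dots> = - ((LINT x|?M. g1' x * f1 x) + (LINT x|?M. g2' x * f2 x) + (LINT x|?M. g3' x * f3 x))
      - K * (LINT x|?M. dissip 4 (u x, w x))"
    using gJ di by (simp add: parts)
  also have "(LINT x|?M. g1' x * f1 x) + (LINT x|?M. g2' x * f2 x) + (LINT x|?M. g3' x * f3 x)
      = (LINT x|?M. g1' x * f1 x + g2' x * f2 x + g3' x * f3 x)"
    using gf by simp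
  also have "\<dots> = (LINT x|?M. D * dissip 0 (u x, w x) + \<delta> / \<beta> * dissip 1 (u x, w x) + 1 / 4 * dissip 2 (u x, w x) + dissip 3 (u x, w x))"
  proof (rule Bochner_Integration.integral_cong[OF refl])
    fix x assume "x \<in> space ?M"
    then have "u x \<in> positive" by (intro p) (auto simp: space_restrict_space)
    then have pu: "u x $ 1 > 0" "u x $ 3 > 0" by (auto simp: positive_def)
    show "g1' x * f1 x + g2' x * f2 x + g3' x * f3 x = D * dissip 0 (u x, w x) + \<delta> / \<beta> * dissip 1 (u x, w x) + 1 / 4 * dissip 2 (u x, w x) + dissip 3 (u x, w x)"
      using dissipation_identity[OF pu(1) pos(5), where s = "\<sigma>' (u x $ 3) * w x $ 3" and r = "\<phi>'' (u x $ 3)"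
          and g = "u x $ 3" and gx = "w x $ 3" and p = "\<phi>'' (conc (u x))" and c = "conc (u x)"
          and cx = "conc_slope (u x) (w x)" and hx = "w x $ 1" and mx = "w x $ 2" and m = "u x $ 2" and G = G and D = D and \<delta> = \<delta>,
          OF _ conc_def conc_slope_def] \<phi>''[OF pu(2)]
      unfolding g1'_def g2'_def g3'_def f1_def f2_def f3_def dissip_def Let_def fst_conv snd_conv
      by simp
  qed
  also have "\<dots> = D * (LINT x|?M. dissip 0 (u x, w x)) + \<delta> / \<beta> * (LINT x|?M. dissip 1 (u x, w x))
      + 1 / 4 * (LINT x|?M. dissip 2 (u x, w x)) + (LINT x|?M. dissip 3 (u x, w x))"
    using di by simp
  finally show ?thesis
    unfolding dissipation_def by simp
qed

end

theorem proposition3p2: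
  fixes L G D \<delta> \<beta> K \<alpha> :: real
    and \<sigma> \<sigma>' \<sigma>'' \<phi> \<phi>' \<phi>'' :: "real \<Rightarrow> real"
    and h0 m0 \<Gamma>0 :: "real \<Rightarrow> real"
    and h m \<Gamma> :: "real \<Rightarrow> real \<Rightarrow> real"
    and T :: ereal
  assumes "L > 0" "G > 0" "D > 0" "\<delta> > 0" "\<beta> > 0" "K > 0"
    and "\<And>r. (\<sigma> has_real_derivative \<sigma>' r) (at r)"
    and "\<And>r. (\<sigma>' has_real_derivative \<sigma>'' r) (at r)"
    and "continuous_on UNIV \<sigma>''"
    and "antimono \<sigma>"
    and "3 / 4 < \<alpha>" "\<alpha> \<le> 1"
    and "(\<lambda>x. vector [h0 x, m0 x, \<Gamma>0 x]) \<in> positive_states L \<alpha>"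
    and "maximal_strong_solution L G D \<delta> \<beta> K \<sigma> \<alpha> (\<lambda>x. vector [h0 x, m0 x, \<Gamma>0 x]) T
           (\<lambda>t x. vector [h t x, m t x, \<Gamma> t x])"
    and "\<And>r. r > 0 \<Longrightarrow> (\<phi> has_real_derivative \<phi>' r) (at r)"
    and "\<And>r. r > 0 \<Longrightarrow> (\<phi>' has_real_derivative \<phi>'' r) (at r)"
    and "\<And>r. r > 0 \<Longrightarrow> \<phi>'' r * r = - \<sigma>' r \<and> - \<sigma>' r \<ge> 0"
  shows "\<forall>t. 0 \<le> t \<and> ereal t < T \<longrightarrow>
    ((\<lambda>s. LINT x|lebesgue_on {0<..<L}.
            \<phi> (\<Gamma> s x) + 1 / \<beta> * h s x * \<phi> (\<beta> * m s x / h s x) + G / 2 * (h s x)^2)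
      has_real_derivative
        (- D * (LINT x|lebesgue_on {0<..<L}. \<phi>'' (\<Gamma> t x) * \<bar>deriv (\<Gamma> t) x\<bar>^2)
         - \<delta> / \<beta> * (LINT x|lebesgue_on {0<..<L}.
              \<phi>'' (\<beta> * m t x / h t x) * h t x * \<bar>deriv (\<lambda>y. \<beta> * m t y / h t y) x\<bar>^2)
         - 1 / 4 * (LINT x|lebesgue_on {0<..<L}. h t x * \<bar>deriv (\<lambda>y. \<sigma> (\<Gamma> t y)) x\<bar>^2)
         - (LINT x|lebesgue_on {0<..<L}.
              (G / sqrt 3 * h t x powr (3 / 2) * deriv (h t) x
               - sqrt 3 / 2 * h t x powr (1 / 2) * deriv (\<lambda>y. \<sigma> (\<Gamma> t y)) x)^2)
         - K * (LINT x|lebesgue_on {0<..<L}.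
              (\<phi>' (\<Gamma> t x) - \<phi>' (\<beta> * m t x / h t x)) * (\<Gamma> t x - \<beta> * m t x / h t x))))
      (at t within {s. 0 \<le> s \<and> ereal s < T})"
proof -
  have \<sigma>'_cont: "continuous_on UNIV \<sigma>'"
    using assms(8) by (auto intro!: continuous_at_imp_continuous_on DERIV_isCont)
  interpret film_energy L G D \<delta> \<beta> K \<sigma> \<sigma>' \<phi> \<phi>' \<phi>''
    by unfold_locales (use assms \<sigma>'_cont in auto)
  define u :: "real \<Rightarrow> real \<Rightarrow> real^3" where "u t x = vector [h t x, m t x, \<Gamma> t x]" for t x
  define I where "I = {t. 0 \<le> t \<and> ereal t < T}"
  define I' where "I' = {t. 0 < t \<and> ereal t < T}"
  have "strong_solution L G D \<delta> \<beta> K \<sigma> \<alpha> (\<lambda>x. vector [h0 x, m0 x, \<Gamma>0 x]) T u"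
    using assms(14) by (simp add: maximal_strong_solution_def u_def[abs_def])
  then obtain v where T: "0 < T" and pstate: "\<And>t. t \<in> I \<Longrightarrow> u t \<in> positive_states L \<alpha>"
    and curve: "continuous_curve (sobolev_norm L (2 * \<alpha>)) I u" and C1: "C1_curve_L2 L I' u v"
    and eqs: "\<And>t. t \<in> I' \<Longrightarrow> film_equations L G D \<delta> \<beta> K \<sigma>
             (\<lambda>x. u t x $ 1) (\<lambda>x. u t x $ 2) (\<lambda>x. u t x $ 3)
             (\<lambda>x. v t x $ 1) (\<lambda>x. v t x $ 2) (\<lambda>x. v t x $ 3)"
    unfolding strong_solution_def I_def[symmetric] I'_def[symmetric] by blast
  have uN: "u t \<in> sobolev_space_N L (2 * \<alpha>)" and upos: "x \<in> {0..L} \<Longrightarrow> u t x \<in> positive" if "t \<in> I" for t x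
    using pstate[OF that] by (auto simp: positive_states_def positive_def)
  obtain w where cw: "\<And>t. t \<in> I \<Longrightarrow> continuous_on {0..L} (w t)"
    and d: "\<And>t x. t \<in> I \<Longrightarrow> x \<in> {0..L} \<Longrightarrow> (u t has_vector_derivative w t x) (at x within {0..L})"
    and w0: "\<And>t. t \<in> I \<Longrightarrow> w t 0 = 0 \<and> w t L = 0"
    and ulim: "\<And>t. t \<in> I \<Longrightarrow> uniform_limit {0..L} u (u t) (at t within I)"
    and wlim: "\<And>t. t \<in> I \<Longrightarrow> uniform_limit {0..L} w (w t) (at t within I)"
    using sobolev_curve_C1[OF pos(1) assms(11,12) uN curve] by blast
  have cu: "continuous_on {0..L} (u t)" if "t \<in> I" for t
    using uN[OF that] by (simp add: sobolev_space_N_def)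
  have sub: "I' \<subseteq> I" by (auto simp: I_def I'_def)
  have openI': "open I'"
  proof (cases T)
    case (real r)
    then have "I' = {0<..<r}" by (auto simp: I'_def)
    then show ?thesis by simp
  next
    case PInf
    then have "I' = {0<..}" by (auto simp: I'_def)
    then show ?thesis by simp
  qed (use T in auto)
  define E where "E s = (LINT x|leb_interval L. energy (u s x))" for s
  define R where "R t = dissipation (u t) (w t)" for t
  have evI: "\<forall>\<^sub>F s in at t within I. s \<in> I" for t
    by (simp add: eventually_at_filter)
  have interior: "(E has_real_derivative R t) (at t)" if t': "t \<in> I'" for t
  proof -
    have t: "t \<in> I" using sub t' by auto
    \<comment> \<open>Uniform convergence is known relative to I, which contains the initial time;
      since t lies in the open subset I', it holds from both sides.\<close>
    have le: "at t \<le> at t within I"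
      using at_le[OF sub, of t] at_within_open[OF t' openI'] by simp
    have ul: "uniform_limit {0..L} u (u t) (at t)"
      using ulim[OF t] unfolding uniform_limit_iff using filter_leD[OF le] by blast
    have comp_cont: "continuous_on {0..L} (\<lambda>x. u t x $ i)" for i
      by (intro continuous_intros cu t)
    \<comment> \<open>At time t a margin lo is left inside the box {lo..hi}, so every state closer
      than lo to the present one still lies in the box of the Taylor estimate.\<close>
    obtain lo hi where lo: "0 < lo" "lo \<le> hi" and box: "\<And>x i. x \<in> {0..L} \<Longrightarrow> u t x $ i \<in> {2 * lo..hi - lo}"
    proof -
      have ne: "{0..L} \<noteq> {}" using pos(1) by simp
      have "\<exists>a b. 0 < a \<and> (\<forall>x\<in>{0..L}. a \<le> u t x $ i \<and> u t x $ i \<le> b)" for i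
      proof -
        obtain x y where "x \<in> {0..L}" "\<forall>z\<in>{0..L}. u t x $ i \<le> u t z $ i"
          "\<forall>z\<in>{0..L}. u t z $ i \<le> u t y $ i"
          using continuous_attains_inf[OF _ ne comp_cont[of i]] continuous_attains_sup[OF _ ne comp_cont[of i]] by auto
        moreover have "0 < u t x $ i"
          using upos[OF t \<open>x \<in> {0..L}\<close>] exhaust_3[of i] by (auto simp: positive_def)
        ultimately show ?thesis by blast
      qed
      then obtain a b where ab: "\<And>i. 0 < a i" "\<And>i x. x \<in> {0..L} \<Longrightarrow> a i \<le> u t x $ i \<and> u t x $ i \<le> b i"
        by metis
      define lo where "lo = Min (range (a :: 3 \<Rightarrow> real)) / 2"
      define hi where "hi = Max (range (b :: 3 \<Rightarrow> real)) + lo"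
      have lo: "0 < lo" "\<And>i. 2 * lo \<le> a i" using ab(1) by (auto simp: lo_def)
      have hi: "b i \<le> hi - lo" for i by (auto simp: hi_def)
      show ?thesis
      proof (rule that[of lo hi])
        show "u t x $ i \<in> {2 * lo..hi - lo}" if "x \<in> {0..L}" for x i
          using ab(2)[OF that, of i] lo(2)[of i] hi[of i] by auto
        from this[of 0 1] show "lo \<le> hi" using lo(1) pos(1) by simp
      qed (rule lo)
    qed
    obtain C where C: "0 \<le> C" "\<And>a b. (\<And>i. a $ i \<in> {lo..hi}) \<Longrightarrow> (\<And>i. b $ i \<in> {lo..hi}) \<Longrightarrow>
      \<bar>energy b - energy a - energy_grad a \<bullet> (b - a)\<bar> \<le> C * (norm (b - a))\<^sup>2"
      using energy_remainder[OF lo] by blast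
    have rem: "\<forall>\<^sub>F s in at t. \<forall>x\<in>{0..L}.
        \<bar>energy (u s x) - energy (u t x) - energy_grad (u t x) \<bullet> (u s x - u t x)\<bar> \<le> C * (norm (u s x - u t x))\<^sup>2"
      using uniform_limitD[OF ul lo(1)]
    proof eventually_elim
      case (elim s)
      show ?case
      proof (intro ballI C(2))
        fix x i assume x: "x \<in> {0..L}"
        show "u t x $ i \<in> {lo..hi}" using box[OF x, of i] lo by auto
        have "norm (u s x - u t x) < lo" using elim x by (simp add: dist_norm)
        then have "\<bar>u s x $ i - u t x $ i\<bar> < lo"
          using component_le_norm_cart[of "u s x - u t x" i] by simp
        then show "u s x $ i \<in> {lo..hi}" using box[OF x, of i] by auto
      qed
    qed
    have "(E has_real_derivative (LINT x|leb_interval L. energy_grad (u t x) \<bullet> v t x)) (at t)"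
      unfolding E_def
      by (rule energy_has_derivative[OF pos(1) continuous_on_energy continuous_on_energy_grad C1 openI' t' _ _ rem C(1)])
         (use sub cu upos in auto)
    also have "(LINT x|leb_interval L. energy_grad (u t x) \<bullet> v t x) = R t"
      unfolding R_def
      by (rule energy_balance[OF d[OF t] cw[OF t] _ _ upos[OF t] _ eqs[OF t']])
         (use w0[OF t] C1 t' in \<open>auto simp: C1_curve_L2_def\<close>)
    finally show ?thesis .
  qed
  have main: "(E has_real_derivative R t) (at t within I)" if t: "t \<in> I" for t
  proof (cases "t = 0")
    case False
    then have "t \<in> I'" using t by (auto simp: I_def I'_def)
    then show ?thesis by (rule has_field_derivative_at_within[OF interior])
  next
    case True
    have 0: "0 \<in> I" using t True by simp
    \<comment> \<open>T may be infinite; b is a real time below it, giving a right neighbourhood of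
      0 on which the interior result holds.\<close>
    obtain b where b: "0 < b" "ereal b < T"
      using ereal_dense2[OF T] by (auto simp: zero_ereal_def)
    have below: "ereal s < T" if "s < b" for s
      using that b(2) by (meson less_ereal.simps(1) order_less_trans)
    \<comment> \<open>Near 0 the time domain is a half-line, so the derivative within it is the
      right-hand one.\<close>
    have at0: "at 0 within I = at_right 0"
    proof (rule at_within_nhd[of _ "{- 1<..<b}"])
      show "I \<inter> {- 1<..<b} - {0} = {0<..} \<inter> {- 1<..<b} - {0}"
        using below by (auto simp: I_def)
    qed (use b in auto)
    have ev: "\<forall>\<^sub>F s in at 0 within I. continuous_on {0..L} (u s)" "\<forall>\<^sub>F s in at 0 within I. continuous_on {0..L} (w s)"
      using evI[of 0] by (auto elim!: eventually_mono intro: cu cw)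
    have "(E has_real_derivative R 0) (at_right 0)"
    proof (rule has_real_derivative_at_right_0_limit[OF b(1)])
      show "(E has_real_derivative R s) (at s)" if "0 < s" "s < b" for s
        by (rule interior) (use that below in \<open>auto simp: I'_def\<close>)
      show "(E \<longlongrightarrow> E 0) (at_right 0)"
        unfolding E_def at0[symmetric]
        by (rule integral_composition_tendsto[OF pos(1) continuous_on_energy open_positive ulim[OF 0] ev(1) cu[OF 0] upos[OF 0]])
      show "(R \<longlongrightarrow> R 0) (at_right 0)"
        unfolding R_def at0[symmetric]
        by (rule dissipation_tendsto[OF ulim[OF 0] wlim[OF 0] ev cu[OF 0] cw[OF 0] upos[OF 0]])
    qed
    then show ?thesis by (simp add: True at0)
  qed
  have comp: "u t x $ 1 = h t x" "u t x $ 2 = m t x" "u t x $ 3 = \<Gamma> t x" for t x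
    by (simp_all add: u_def vector_3)
  show ?thesis
  proof (intro allI impI)
    fix t assume "0 \<le> t \<and> ereal t < T"
    then have t: "t \<in> I" by (simp add: I_def)
    show "((\<lambda>s. LINT x|lebesgue_on {0<..<L}.
            \<phi> (\<Gamma> s x) + 1 / \<beta> * h s x * \<phi> (\<beta> * m s x / h s x) + G / 2 * (h s x)^2)
      has_real_derivative
        (- D * (LINT x|lebesgue_on {0<..<L}. \<phi>'' (\<Gamma> t x) * \<bar>deriv (\<Gamma> t) x\<bar>^2)
         - \<delta> / \<beta> * (LINT x|lebesgue_on {0<..<L}.
              \<phi>'' (\<beta> * m t x / h t x) * h t x * \<bar>deriv (\<lambda>y. \<beta> * m t y / h t y) x\<bar>^2)
         - 1 / 4 * (LINT x|lebesgue_on {0<..<L}. h t x * \<bar>deriv (\<lambda>y. \<sigma> (\<Gamma> t y)) x\<bar>^2)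
         - (LINT x|lebesgue_on {0<..<L}.
              (G / sqrt 3 * h t x powr (3 / 2) * deriv (h t) x
               - sqrt 3 / 2 * h t x powr (1 / 2) * deriv (\<lambda>y. \<sigma> (\<Gamma> t y)) x)^2)
         - K * (LINT x|lebesgue_on {0<..<L}.
              (\<phi>' (\<Gamma> t x) - \<phi>' (\<beta> * m t x / h t x)) * (\<Gamma> t x - \<beta> * m t x / h t x))))
      (at t within {s. 0 \<le> s \<and> ereal s < T})"
    proof (rule DERIV_cong[OF main[OF t, unfolded E_def[abs_def] energy_def conc_def comp I_def]])
      show "R t = (- D * (LINT x|lebesgue_on {0<..<L}. \<phi>'' (\<Gamma> t x) * \<bar>deriv (\<Gamma> t) x\<bar>^2)
         - \<delta> / \<beta> * (LINT x|lebesgue_on {0<..<L}.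
              \<phi>'' (\<beta> * m t x / h t x) * h t x * \<bar>deriv (\<lambda>y. \<beta> * m t y / h t y) x\<bar>^2)
         - 1 / 4 * (LINT x|lebesgue_on {0<..<L}. h t x * \<bar>deriv (\<lambda>y. \<sigma> (\<Gamma> t y)) x\<bar>^2)
         - (LINT x|lebesgue_on {0<..<L}.
              (G / sqrt 3 * h t x powr (3 / 2) * deriv (h t) x
               - sqrt 3 / 2 * h t x powr (1 / 2) * deriv (\<lambda>y. \<sigma> (\<Gamma> t y)) x)^2)
         - K * (LINT x|lebesgue_on {0<..<L}.
              (\<phi>' (\<Gamma> t x) - \<phi>' (\<beta> * m t x / h t x)) * (\<Gamma> t x - \<beta> * m t x / h t x)))"
        unfolding R_def
        by (rule trans[OF dissipation_eq[where u = "u t" and w = "w t"]], erule d[OF t], erule upos[OF t])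
          (simp only: comp)
    qed
  qed
qed

end
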